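(* Let $R$ be an indecomposable commutative ring and let $(\Sigma,i,q)$ be a discrete $R$-twist over an ample Hausdorff groupoid $G$. Let $\mathcal I$ denote the interior of the isotropy in $G$ and let $\mathcal J=q^{-1}(\mathcal I)$, which is the interior of the isotropy in $\Sigma$. Let $A=A_R(G;\Sigma)$, let $A'=A_R(\mathcal I;\mathcal J)$ (regarded as a subalgebra of $A$ by extending functions by zero), and let $B=A_R(G^{(0)};q^{-1}(G^{(0)}))$. Then (a) the normaliser $N_{A'}(B)$ of $B$ in $A'$ satisfies $N_{A'}(B)=N_A(B)\cap A'$; and (b) $(\Sigma,i,q)$ satisfies the local bisection hypothesis if and only if $(\mathcal J,i,q|_{\mathcal J})$ does.
   Context: **Rings and groupoids.** A commutative ring $R$ with identity is indecomposable if its only idempotents are $0$ and $1$. $R^\times$ is its group of units, with the discrete topology. Groupoids are locally compact topological groupoids with Hausdorff unit space $G^{(0)}$ and range/source maps $r,s$. A bisection is a subset $D$ contained in an open set $O$ such that $r|_O,s|_O$ are homeomorphisms onto open subsets of $G^{(0)}$. $G$ is étale if $r$ is a local homeomorphism, and ample if it is étale with a basis of compact open bisections. The isotropy of $G$ is $\{\gamma\in G:r(\gamma)=s(\gamma)\}$. **Twists.** A discrete $R$-twist $(\Sigma,i,q)$ over an étale groupoid $G$ is a sequence $G^{(0)}\times R^\times\xrightarrow{i}\Sigma\xrightarrow{q}G$, where $G^{(0)}\times R^\times$ is the trivial group bundle, $\Sigma$ is a topological groupoid with $\Sigma^{(0)}=i(G^{(0)}\times\{1\})$ (identified with $G^{(0)}$),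 and $i,q$ are continuous groupoid homomorphisms restricting to homeomorphisms of unit spaces, such that: (DT1) $i(\{x\}\times R^\times)=q^{-1}(x)$ for $x\in G^{(0)}$, $i$ injective, $q$ surjective; (DT2) each $\alpha\in G$ has an open bisection $B_\alpha\ni\alpha$ and a continuous $P_\alpha\colon B_\alpha\to\Sigma$ with $q\circ P_\alpha=\mathrm{id}$ and $(\beta,t)\mapsto i(r(\beta),t)P_\alpha(\beta)$ a homeomorphism $B_\alpha\times R^\times\to q^{-1}(B_\alpha)$; (DT3) $i(r(\sigma),t)\sigma=\sigma i(s(\sigma),t)$. Write $t\cdot\sigma=i(r(\sigma),t)\sigma$. With $\mathcal I,\mathcal J$ as in the claim, $(\mathcal J,i,q|_{\mathcal J})$ is a discrete $R$-twist over $\mathcal I$. **Twisted Steinberg algebra.** $\operatorname{supp}(f)=\{f\neq0\}$, $\operatorname{supp}_G(f)=q(\operatorname{supp}(f))$. For a discrete $R$-twist over an ample Hausdorff groupoid $G$, $A_R(G;\Sigma)$ is the set of locally constant $f\colon\Sigma\to R$ with $f(t\cdot\sigma)=t^{-1}f(\sigma)$ for $t\in R^\times$ and $q(\operatorname{supp}(f))$ compact; it is an $R$-algebra under pointwise operations and $(f*g)(\sigma)=\sum_{\alpha\in r^{-1}(r(\sigma))\cap\operatorname{supp}_G(f)}f(S(\alpha))g(S(\alpha)^{-1}\sigma)$, with $S\colon\operatorname{supp}_G(f)\to\operatorname{supp}(f)$ any section for $q$. $A_R(G^{(0)};q^{-1}(G^{(0)}))$ is the commutative subalgebra of those $f$ supported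 in $q^{-1}(G^{(0)})$. **Normalisers and the local bisection hypothesis.** For an algebra $C\supseteq B$, $N_C(B)=\{n\in C:\exists k\in C,\ knk=k,\ nkn=n,\ kBn\cup nBk\subseteq B\}$. A twist $(\Sigma,i,q)$ over $G$ satisfies the local bisection hypothesis if $\operatorname{supp}_G(n)$ is a bisection of $G$ for every $n\in N_A(B)$, where $A=A_R(G;\Sigma)$, $B=A_R(G^{(0)};q^{-1}(G^{(0)}))$; for $(\mathcal J,i,q|_{\mathcal J})$ this is applied with $\mathcal I,\mathcal J$ in place of $G,\Sigma$. *)

theory Defs
  imports "HOL-Analysis.Abstract_Topological_Spaces"
begin

text \<open>Coefficient rings are types of sort \<open>{comm_ring, comm_monoid_mult}\<close>: commutative rings with
  identity. Unlike \<open>comm_ring_1\<close>, this does not exclude the zero ring.\<close>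

definition ring_units :: "'r::{comm_ring, comm_monoid_mult} set" where
  "ring_units = {t. t dvd 1}"

definition unit_inv :: "'r::{comm_ring, comm_monoid_mult} \<Rightarrow> 'r" where
  "unit_inv t = (THE u. t * u = 1)"

definition indecomposable_ring :: "'r::{comm_ring, comm_monoid_mult} itself \<Rightarrow> bool" where
  "indecomposable_ring _ \<longleftrightarrow> (\<forall>e::'r. e * e = e \<longrightarrow> e = 0 \<or> e = 1)"


section \<open>Topological groupoids\<close>

text \<open>A groupoid is given by its space of arrows; the unit space is a subset of the arrows.
  All operations are total functions and are meaningful only on arrows
  (for \<open>gmult\<close>: on composable pairs, \<open>src x = rng y\<close>).\<close>

record 'a top_groupoid =
  arrow_top :: "'a topology"
  rng :: "'a \<Rightarrow> 'a"
  src :: "'a \<Rightarrow> 'a"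
  gmult :: "'a \<Rightarrow> 'a \<Rightarrow> 'a"
  ginv :: "'a \<Rightarrow> 'a"

definition arrows :: "'a top_groupoid \<Rightarrow> 'a set" where
  "arrows G = topspace (arrow_top G)"

definition units :: "'a top_groupoid \<Rightarrow> 'a set" where
  "units G = rng G ` arrows G"

definition unit_top :: "'a top_groupoid \<Rightarrow> 'a topology" where
  "unit_top G = subtopology (arrow_top G) (units G)"

definition composable :: "'a top_groupoid \<Rightarrow> ('a \<times> 'a) set" where
  "composable G = {(x, y). x \<in> arrows G \<and> y \<in> arrows G \<and> src G x = rng G y}"

text \<open>As a standing convention, topological groupoids are locally compact with Hausdorff unit
  space; the arrow space itself need not be Hausdorff.\<close>

locale topological_groupoid =
  fixes G :: "'a top_groupoid"
  assumes rng_closed: "x \<in> arrows G \<Longrightarrow> rng G x \<in> arrows G"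
    and src_closed: "x \<in> arrows G \<Longrightarrow> src G x \<in> arrows G"
    and rng_rng: "x \<in> arrows G \<Longrightarrow> rng G (rng G x) = rng G x"
    and src_rng: "x \<in> arrows G \<Longrightarrow> src G (rng G x) = rng G x"
    and rng_src: "x \<in> arrows G \<Longrightarrow> rng G (src G x) = src G x"
    and src_src: "x \<in> arrows G \<Longrightarrow> src G (src G x) = src G x"
    and mult_closed: "(x, y) \<in> composable G \<Longrightarrow> gmult G x y \<in> arrows G"
    and rng_mult: "(x, y) \<in> composable G \<Longrightarrow> rng G (gmult G x y) = rng G x"
    and src_mult: "(x, y) \<in> composable G \<Longrightarrow> src G (gmult G x y) = src G y"
    and mult_assoc: "(x, y) \<in> composable G \<Longrightarrow> (y, z) \<in> composable G \<Longrightarrow>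
        gmult G (gmult G x y) z = gmult G x (gmult G y z)"
    and rng_mult_left: "x \<in> arrows G \<Longrightarrow> gmult G (rng G x) x = x"
    and src_mult_right: "x \<in> arrows G \<Longrightarrow> gmult G x (src G x) = x"
    and inv_closed: "x \<in> arrows G \<Longrightarrow> ginv G x \<in> arrows G"
    and rng_inv: "x \<in> arrows G \<Longrightarrow> rng G (ginv G x) = src G x"
    and src_inv: "x \<in> arrows G \<Longrightarrow> src G (ginv G x) = rng G x"
    and mult_inv_right: "x \<in> arrows G \<Longrightarrow> gmult G x (ginv G x) = rng G x"
    and mult_inv_left: "x \<in> arrows G \<Longrightarrow> gmult G (ginv G x) x = src G x"
    and continuous_inv: "continuous_map (arrow_top G) (arrow_top G) (ginv G)"
    and continuous_mult: "continuous_map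
        (subtopology (prod_topology (arrow_top G) (arrow_top G)) (composable G))
        (arrow_top G) (\<lambda>(x, y). gmult G x y)"
    and locally_compact: "locally_compact_space (arrow_top G)"
    and Hausdorff_units: "Hausdorff_space (unit_top G)"

definition homeo_onto_open :: "'a topology \<Rightarrow> 'b topology \<Rightarrow> ('a \<Rightarrow> 'b) \<Rightarrow> 'a set \<Rightarrow> bool" where
  "homeo_onto_open X Y f U \<longleftrightarrow> openin X U \<and> openin Y (f ` U) \<and>
     homeomorphic_map (subtopology X U) (subtopology Y (f ` U)) f"

definition local_homeomorphism :: "'a topology \<Rightarrow> 'b topology \<Rightarrow> ('a \<Rightarrow> 'b) \<Rightarrow> bool" where
  "local_homeomorphism X Y f \<longleftrightarrow> (\<forall>x\<in>topspace X. \<exists>U. x \<in> U \<and> homeo_onto_open X Y f U)"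

definition bisection :: "'a top_groupoid \<Rightarrow> 'a set \<Rightarrow> bool" where
  "bisection G D \<longleftrightarrow> (\<exists>U. D \<subseteq> U \<and>
     homeo_onto_open (arrow_top G) (unit_top G) (rng G) U \<and>
     homeo_onto_open (arrow_top G) (unit_top G) (src G) U)"

locale etale_groupoid = topological_groupoid +
  assumes local_homeo_rng: "local_homeomorphism (arrow_top G) (unit_top G) (rng G)"

locale ample_groupoid = etale_groupoid +
  assumes compact_open_bisection_base:
    "openin (arrow_top G) W \<Longrightarrow> x \<in> W \<Longrightarrow>
       \<exists>D. x \<in> D \<and> D \<subseteq> W \<and> openin (arrow_top G) D \<and> compactin (arrow_top G) D \<and> bisection G D"

definition isotropy :: "'a top_groupoid \<Rightarrow> 'a set" where
  "isotropy G = {x \<in> arrows G. rng G x = src G x}"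

definition restrict_groupoid :: "'a top_groupoid \<Rightarrow> 'a set \<Rightarrow> 'a top_groupoid" where
  "restrict_groupoid G H = G\<lparr>arrow_top := subtopology (arrow_top G) H\<rparr>"

definition continuous_groupoid_hom ::
    "'a top_groupoid \<Rightarrow> 'b top_groupoid \<Rightarrow> ('a \<Rightarrow> 'b) \<Rightarrow> bool" where
  "continuous_groupoid_hom G H f \<longleftrightarrow> continuous_map (arrow_top G) (arrow_top H) f \<and>
     (\<forall>(x, y)\<in>composable G. (f x, f y) \<in> composable H \<and> f (gmult G x y) = gmult H (f x) (f y))"


section \<open>Discrete twists\<close>

definition trivial_bundle ::
    "'g top_groupoid \<Rightarrow> ('g \<times> 'r::{comm_ring, comm_monoid_mult}) top_groupoid" where
  "trivial_bundle G =
     \<lparr>arrow_top = prod_topology (unit_top G) (discrete_topology ring_units),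
      rng = (\<lambda>(x, t). (x, 1)),
      src = (\<lambda>(x, t). (x, 1)),
      gmult = (\<lambda>(x, t) (y, u). (x, t * u)),
      ginv = (\<lambda>(x, t). (x, unit_inv t))\<rparr>"

definition preimage_arrows :: "'s top_groupoid \<Rightarrow> ('s \<Rightarrow> 'g) \<Rightarrow> 'g set \<Rightarrow> 's set" where
  "preimage_arrows \<Sigma> q H = {\<sigma> \<in> arrows \<Sigma>. q \<sigma> \<in> H}"

text \<open>The unit space of \<open>\<Sigma>\<close> is identified with that of \<open>G\<close> by \<open>q\<close>, whose inverse on units is
  \<open>x \<mapsto> i (x, 1)\<close>. Hence a unit \<open>u\<close> of \<open>\<Sigma>\<close> enters the first argument of \<open>i\<close> as \<open>q u\<close>.\<close>

definition twist_act :: "'s top_groupoid \<Rightarrow> ('g \<times> 'r \<Rightarrow> 's) \<Rightarrow> ('s \<Rightarrow> 'g) \<Rightarrow> 'r \<Rightarrow> 's \<Rightarrow> 's" where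
  "twist_act \<Sigma> i q t \<sigma> = gmult \<Sigma> (i (q (rng \<Sigma> \<sigma>), t)) \<sigma>"

locale discrete_twist = G: etale_groupoid G + \<Sigma>: topological_groupoid \<Sigma>
  for G :: "'g top_groupoid" and \<Sigma> :: "'s top_groupoid" +
  fixes i :: "'g \<times> 'r::{comm_ring, comm_monoid_mult} \<Rightarrow> 's" and q :: "'s \<Rightarrow> 'g"
  assumes units_twist: "units \<Sigma> = i ` (units G \<times> {1})"
    and hom_i: "continuous_groupoid_hom (trivial_bundle G) \<Sigma> i"
    and hom_q: "continuous_groupoid_hom \<Sigma> G q"
    and homeo_units_i: "homeomorphic_map
        (unit_top (trivial_bundle G :: ('g \<times> 'r) top_groupoid)) (unit_top \<Sigma>) i"
    and homeo_units_q: "homeomorphic_map (unit_top \<Sigma>) (unit_top G) q"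
    and DT1_fibre: "x \<in> units G \<Longrightarrow> i ` ({x} \<times> ring_units) = preimage_arrows \<Sigma> q {x}"
    and DT1_inj: "inj_on i (units G \<times> ring_units)"
    and DT1_surj: "q ` arrows \<Sigma> = arrows G"
    and DT2: "\<alpha> \<in> arrows G \<Longrightarrow> \<exists>D P. \<alpha> \<in> D \<and> openin (arrow_top G) D \<and> bisection G D \<and>
        continuous_map (subtopology (arrow_top G) D) (arrow_top \<Sigma>) P \<and>
        (\<forall>\<beta>\<in>D. q (P \<beta>) = \<beta>) \<and>
        homeomorphic_map
          (prod_topology (subtopology (arrow_top G) D) (discrete_topology (ring_units :: 'r set)))
          (subtopology (arrow_top \<Sigma>) (preimage_arrows \<Sigma> q D))
          (\<lambda>(\<beta>, t). gmult \<Sigma> (i (rng G \<beta>, t)) (P \<beta>))"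
    and DT3: "\<sigma> \<in> arrows \<Sigma> \<Longrightarrow> t \<in> ring_units \<Longrightarrow>
        gmult \<Sigma> (i (q (rng \<Sigma> \<sigma>), t)) \<sigma> = gmult \<Sigma> \<sigma> (i (q (src \<Sigma> \<sigma>), t))"


section \<open>Twisted Steinberg algebras\<close>

definition supp :: "('s \<Rightarrow> 'r::zero) \<Rightarrow> 's set" where
  "supp f = {\<sigma>. f \<sigma> \<noteq> 0}"

definition locally_constant_on :: "'s topology \<Rightarrow> ('s \<Rightarrow> 'r) \<Rightarrow> bool" where
  "locally_constant_on X f \<longleftrightarrow>
     (\<forall>x\<in>topspace X. \<exists>U. openin X U \<and> x \<in> U \<and> (\<forall>y\<in>U. f y = f x))"

text \<open>A function on \<open>\<Sigma>\<close> is a total function that vanishes outside the arrows of \<open>\<Sigma>\<close>. Extension by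
  zero from a subgroupoid is therefore the identity, and the algebra of the restriction of \<open>\<Sigma>\<close> to
  an open subgroupoid is literally a subset of the algebra of \<open>\<Sigma>\<close>.\<close>

definition steinberg_algebra ::
    "'g top_groupoid \<Rightarrow> 's top_groupoid \<Rightarrow> ('g \<times> 'r::{comm_ring, comm_monoid_mult} \<Rightarrow> 's)
      \<Rightarrow> ('s \<Rightarrow> 'g) \<Rightarrow> ('s \<Rightarrow> 'r) set" where
  "steinberg_algebra G \<Sigma> i q = {f.
     supp f \<subseteq> arrows \<Sigma> \<and>
     locally_constant_on (arrow_top \<Sigma>) f \<and>
     (\<forall>\<sigma>\<in>arrows \<Sigma>. \<forall>t\<in>ring_units. f (twist_act \<Sigma> i q t \<sigma>) = unit_inv t * f \<sigma>) \<and>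
     compactin (arrow_top G) (q ` supp f)}"

text \<open>The section \<open>S\<close> of \<open>q\<close> over \<open>q ` supp f\<close> used in the convolution is \<open>inv_into (supp f) q\<close>; for
  \<open>f\<close> and \<open>g\<close> in the algebra the value does not depend on this choice and the sum is finite.\<close>

definition twisted_conv ::
    "'g top_groupoid \<Rightarrow> 's top_groupoid \<Rightarrow> ('s \<Rightarrow> 'g)
      \<Rightarrow> ('s \<Rightarrow> 'r::{comm_ring, comm_monoid_mult}) \<Rightarrow> ('s \<Rightarrow> 'r) \<Rightarrow> 's \<Rightarrow> 'r" where
  "twisted_conv G \<Sigma> q f g \<sigma> =
     (let S = inv_into (supp f) q in
      if \<sigma> \<in> arrows \<Sigma>
      then \<Sum>\<alpha> \<in> {\<alpha> \<in> q ` supp f. rng G \<alpha> = q (rng \<Sigma> \<sigma>)}. f (S \<alpha>) * g (gmult \<Sigma> (ginv \<Sigma> (S \<alpha>)) \<sigma>)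
      else 0)"

definition diagonal_algebra ::
    "'g top_groupoid \<Rightarrow> 's top_groupoid \<Rightarrow> ('g \<times> 'r::{comm_ring, comm_monoid_mult} \<Rightarrow> 's)
      \<Rightarrow> ('s \<Rightarrow> 'g) \<Rightarrow> ('s \<Rightarrow> 'r) set" where
  "diagonal_algebra G \<Sigma> i q =
     steinberg_algebra (restrict_groupoid G (units G))
       (restrict_groupoid \<Sigma> (preimage_arrows \<Sigma> q (units G))) i q"

definition normaliser :: "('c \<Rightarrow> 'c \<Rightarrow> 'c) \<Rightarrow> 'c set \<Rightarrow> 'c set \<Rightarrow> 'c set" where
  "normaliser mul C B = {n \<in> C. \<exists>k\<in>C.
     mul (mul k n) k = k \<and> mul (mul n k) n = n \<and>
     (\<forall>b\<in>B. mul (mul k b) n \<in> B \<and> mul (mul n b) k \<in> B)}"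

definition local_bisection_hypothesis ::
    "'g top_groupoid \<Rightarrow> 's top_groupoid \<Rightarrow> ('g \<times> 'r::{comm_ring, comm_monoid_mult} \<Rightarrow> 's)
      \<Rightarrow> ('s \<Rightarrow> 'g) \<Rightarrow> bool" where
  "local_bisection_hypothesis G \<Sigma> i q \<longleftrightarrow>
     (\<forall>n \<in> normaliser (twisted_conv G \<Sigma> q) (steinberg_algebra G \<Sigma> i q) (diagonal_algebra G \<Sigma> i q).
        bisection G (q ` supp n))"

end

theory Submission
  imports Defs
begin

text \<open>Write \<open>f \<star> g\<close> for the convolution. An element \<open>b\<close> of the diagonal \<open>B\<close> acts by
  \<open>(b \<star> f)(\<sigma>) = b(r(\<sigma>)) f(\<sigma>)\<close> and \<open>(f \<star> b)(\<sigma>) = f(\<sigma>) b(s(\<sigma>))\<close>, and \<open>B\<close>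
  contains the indicators of all compact open sets of units, which separate units. So an element of
  \<open>A\<close> commutes with \<open>B\<close> iff its support lies in the isotropy, and, supports being open in
  \<open>G\<close>, iff it lies in \<open>A'\<close>.

  Part (a). Let \<open>n \<in> A'\<close> be a normaliser of \<open>B\<close> in \<open>A\<close> with partial inverse \<open>k\<close>.
  Local units show that \<open>k \<star> n\<close> and \<open>n \<star> k\<close> are in \<open>B\<close>. Since \<open>n\<close> commutes with
  \<open>B\<close> and \<open>B\<close> is commutative, an algebraic computation
  (\<open>partial_inverse_isotropy\<close>) shows that \<open>k\<close> commutes with \<open>B\<close>. Hence \<open>k \<in> A'\<close>, so
  that \<open>n\<close> is a normaliser already in \<open>A'\<close>.

  Part (b). By (a), normalisers in \<open>A'\<close> are normalisers in \<open>A\<close>, which gives one direction.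
  Conversely, let \<open>n\<close> be any normaliser in \<open>A\<close>. Conjugation by \<open>n\<close> and \<open>k\<close> maps
  idempotents of \<open>B\<close> to idempotents of \<open>B\<close>, and these are indicators because the coefficient
  ring is indecomposable. It follows that two arrows in the support of \<open>n\<close> have the same range
  iff they have the same source (\<open>normaliser_rng_eq_iff_src_eq\<close>). Let \<open>\<alpha>\<close> and \<open>\<beta>\<close> be
  two such arrows. Choose a compact open bisection around \<open>\<alpha>\<close> inside the support of \<open>n\<close>, with
  a continuous section of \<open>q\<close>, and let \<open>m'\<close> be the function in \<open>A\<close> given by the inverse
  section. Then \<open>m' \<star> n\<close> is again a normaliser, and its support consists of isotropy arrows,
  among them \<open>\<alpha>\<inverse> \<alpha>\<close> and \<open>\<alpha>\<inverse> \<beta>\<close>. By (a) it is a normaliser in \<open>A'\<close>, and the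
  local bisection hypothesis over the isotropy gives \<open>\<alpha> = \<beta>\<close>
  (\<open>bisection_from_isotropy\<close>). So range and source are injective on the open support of \<open>n\<close>,
  which is therefore a bisection.

  The groundwork is that \<open>A\<close> is an associative algebra (\<open>conv_assoc\<close>,
  \<open>conv_in_algebra\<close>) and that continuous sections over compact open sets define elements of
  \<open>A\<close> (\<open>section_function_in_algebra\<close>).\<close>


section \<open>Algebra and topology of etale groupoids\<close>

context topological_groupoid
begin

lemma mult_in: "x \<in> arrows G \<Longrightarrow> y \<in> arrows G \<Longrightarrow> src G x = rng G y \<Longrightarrow> gmult G x y \<in> arrows G"
  and rng_mult': "x \<in> arrows G \<Longrightarrow> y \<in> arrows G \<Longrightarrow> src G x = rng G y \<Longrightarrow> rng G (gmult G x y) = rng G x"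
  and src_mult': "x \<in> arrows G \<Longrightarrow> y \<in> arrows G \<Longrightarrow> src G x = rng G y \<Longrightarrow> src G (gmult G x y) = src G y"
  using mult_closed rng_mult src_mult by (auto simp: composable_def)

lemmas arrow_simps [simp] = rng_closed src_closed inv_closed rng_rng src_rng rng_src src_src
  rng_inv src_inv mult_inv_right mult_inv_left rng_mult_left src_mult_right mult_in rng_mult' src_mult'

lemma assoc: "x \<in> arrows G \<Longrightarrow> y \<in> arrows G \<Longrightarrow> z \<in> arrows G \<Longrightarrow> src G x = rng G y \<Longrightarrow>
    src G y = rng G z \<Longrightarrow> gmult G (gmult G x y) z = gmult G x (gmult G y z)"
  using mult_assoc by (auto simp: composable_def)

lemma cancel_left [simp]:
  "x \<in> arrows G \<Longrightarrow> y \<in> arrows G \<Longrightarrow> src G x = rng G y \<Longrightarrow> gmult G (ginv G x) (gmult G x y) = y"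
  "x \<in> arrows G \<Longrightarrow> y \<in> arrows G \<Longrightarrow> rng G x = rng G y \<Longrightarrow> gmult G x (gmult G (ginv G x) y) = y"
  by (metis assoc inv_closed mult_inv_left rng_mult_left src_inv)
     (metis assoc inv_closed mult_inv_right rng_inv rng_mult_left src_inv)

lemma cancel_right [simp]:
  "x \<in> arrows G \<Longrightarrow> y \<in> arrows G \<Longrightarrow> src G x = rng G y \<Longrightarrow> gmult G (gmult G x y) (ginv G y) = x"
  "x \<in> arrows G \<Longrightarrow> y \<in> arrows G \<Longrightarrow> src G x = src G y \<Longrightarrow> gmult G (gmult G x (ginv G y)) y = x"
  by (metis assoc inv_closed mult_inv_right rng_inv src_mult_right)
     (metis assoc inv_closed mult_inv_left rng_inv src_inv src_mult_right)

lemma inv_unique: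
  assumes "x \<in> arrows G" "y \<in> arrows G" "src G x = rng G y" "gmult G x y = rng G x"
  shows "y = ginv G x"
  by (metis assms cancel_left(1) inv_closed src_inv src_mult_right)

lemma inv_inv [simp]: "x \<in> arrows G \<Longrightarrow> ginv G (ginv G x) = x"
  by (rule inv_unique [symmetric]) auto

lemma inv_mult:
  "x \<in> arrows G \<Longrightarrow> y \<in> arrows G \<Longrightarrow> src G x = rng G y \<Longrightarrow>
    ginv G (gmult G x y) = gmult G (ginv G y) (ginv G x)"
  by (rule inv_unique [symmetric]) (auto simp: assoc)

lemma units_iff: "u \<in> units G \<longleftrightarrow> u \<in> arrows G \<and> rng G u = u"
  unfolding units_def by (auto intro: rev_image_eqI)

lemma unitI: "u \<in> arrows G \<Longrightarrow> rng G u = u \<Longrightarrow> u \<in> units G"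
  by (simp add: units_iff)

lemma unit_simps [simp]:
  assumes "u \<in> units G"
  shows "u \<in> arrows G" "rng G u = u" "src G u = u" "ginv G u = u"
proof -
  show u: "u \<in> arrows G" "rng G u = u" using assms units_iff by auto
  show s: "src G u = u" using src_rng [of u] u by simp
  show "ginv G u = u"
    using inv_unique [of u u] u s rng_mult_left [of u] by simp
qed

lemma rng_in_units [simp]: "x \<in> arrows G \<Longrightarrow> rng G x \<in> units G"
  by (rule unitI) (simp_all del: unit_simps)

lemma src_in_units [simp]: "x \<in> arrows G \<Longrightarrow> src G x \<in> units G"
  by (rule unitI) (simp_all del: unit_simps)

lemma units_subset: "units G \<subseteq> isotropy G"
  by (auto simp: isotropy_def)

lemma continuous_mult_comp:
  assumes "continuous_map X (arrow_top G) f" "continuous_map X (arrow_top G) g"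
    and "\<And>x. x \<in> topspace X \<Longrightarrow> src G (f x) = rng G (g x)"
  shows "continuous_map X (arrow_top G) (\<lambda>x. gmult G (f x) (g x))"
proof -
  have "continuous_map X (subtopology (prod_topology (arrow_top G) (arrow_top G)) (composable G))
          (\<lambda>x. (f x, g x))"
    unfolding continuous_map_in_subtopology continuous_map_paired
    using assms continuous_map_funspace [OF assms(1)] continuous_map_funspace [OF assms(2)]
    by (auto simp: composable_def arrows_def Pi_iff)
  from continuous_map_compose [OF this continuous_mult] show ?thesis
    by (simp add: o_def)
qed

lemma continuous_rng: "continuous_map (arrow_top G) (arrow_top G) (rng G)"
proof -
  have "continuous_map (arrow_top G) (arrow_top G) (\<lambda>x. gmult G x (ginv G x))"
    by (rule continuous_mult_comp)
       (simp_all add: continuous_inv continuous_map_id [unfolded id_def] flip: arrows_def)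
  then show ?thesis
    by (rule continuous_map_eq) (simp flip: arrows_def)
qed

lemma continuous_src: "continuous_map (arrow_top G) (arrow_top G) (src G)"
proof -
  have "continuous_map (arrow_top G) (arrow_top G) (\<lambda>x. gmult G (ginv G x) x)"
    by (rule continuous_mult_comp)
       (simp_all add: continuous_inv continuous_map_id [unfolded id_def] flip: arrows_def)
  then show ?thesis
    by (rule continuous_map_eq) (simp flip: arrows_def)
qed

lemma continuous_rng_units: "continuous_map (arrow_top G) (unit_top G) (rng G)"
  and continuous_src_units: "continuous_map (arrow_top G) (unit_top G) (src G)"
  unfolding unit_top_def continuous_map_in_subtopology
  using continuous_rng continuous_src by (auto simp: arrows_def [symmetric])

lemma inv_image_open:
  assumes "openin (arrow_top G) U"
  shows "openin (arrow_top G) (ginv G ` U)"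
proof -
  have "U \<subseteq> arrows G" using assms by (simp add: arrows_def openin_subset)
  then have "ginv G ` U = {x \<in> topspace (arrow_top G). ginv G x \<in> U}"
    by (force simp: arrows_def [symmetric] intro: rev_image_eqI)
  then show ?thesis
    using openin_continuous_map_preimage [OF continuous_inv assms] by simp
qed

lemma src_image: "U \<subseteq> arrows G \<Longrightarrow> src G ` U = rng G ` ginv G ` U"
  by (force simp: image_image)

end

lemma homeo_onto_openD:
  assumes "homeo_onto_open X Y f U"
  shows "openin X U" "openin Y (f ` U)" "inj_on f U"
    "\<And>V. openin X V \<Longrightarrow> V \<subseteq> U \<Longrightarrow> openin Y (f ` V)"
proof -
  show *: "openin X U" "openin Y (f ` U)" using assms by (auto simp: homeo_onto_open_def)
  have h: "homeomorphic_map (subtopology X U) (subtopology Y (f ` U)) f"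
    using assms by (auto simp: homeo_onto_open_def)
  show "inj_on f U"
    using homeomorphic_imp_injective_map [OF h] * by (simp add: openin_subset Int_absorb1)
  fix V assume "openin X V" "V \<subseteq> U"
  then have "openin (subtopology Y (f ` U)) (f ` V)"
    using homeomorphic_imp_open_map [OF h] * by (simp add: open_map_def openin_open_subtopology)
  then show "openin Y (f ` V)" using * by (simp add: openin_open_subtopology)
qed

lemma homeo_onto_openI:
  assumes "openin X U" "continuous_map X Y f" "inj_on f U"
    and "\<And>V. openin X V \<Longrightarrow> V \<subseteq> U \<Longrightarrow> openin Y (f ` V)"
  shows "homeo_onto_open X Y f U"
  unfolding homeo_onto_open_def
proof (intro conjI bijective_open_imp_homeomorphic_map)
  show o: "openin X U" "openin Y (f ` U)" using assms by auto
  show "continuous_map (subtopology X U) (subtopology Y (f ` U)) f"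
    using assms(2) by (auto simp: continuous_map_in_subtopology continuous_map_from_subtopology)
  show "open_map (subtopology X U) (subtopology Y (f ` U)) f"
    using assms o by (auto simp: open_map_def openin_open_subtopology)
  show "f ` topspace (subtopology X U) = topspace (subtopology Y (f ` U))"
    using o by (simp add: openin_subset Int_absorb1)
  show "inj_on f (topspace (subtopology X U))"
    using assms(3) by (auto simp: inj_on_def)
qed

lemma bisectionD:
  assumes "bisection G D"
  shows "inj_on (rng G) D" "inj_on (src G) D"
  using assms unfolding bisection_def by (auto dest: homeo_onto_openD(3) intro: inj_on_subset)

lemma rng_restrict [simp]: "rng (restrict_groupoid G H) = rng G"
  and src_restrict [simp]: "src (restrict_groupoid G H) = src G"
  and gmult_restrict [simp]: "gmult (restrict_groupoid G H) = gmult G"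
  and ginv_restrict [simp]: "ginv (restrict_groupoid G H) = ginv G"
  and arrow_top_restrict [simp]: "arrow_top (restrict_groupoid G H) = subtopology (arrow_top G) H"
  by (simp_all add: restrict_groupoid_def)

lemma arrows_restrict [simp]: "arrows (restrict_groupoid G H) = arrows G \<inter> H"
  by (simp add: arrows_def)

lemma restrict_restrict:
  "K \<subseteq> H \<Longrightarrow> restrict_groupoid (restrict_groupoid G H) K = restrict_groupoid G K"
  by (simp add: restrict_groupoid_def subtopology_subtopology Int_absorb1)

context etale_groupoid
begin

lemma openin_units: "openin (arrow_top G) (units G)"
proof (subst openin_subopen, intro ballI)
  fix x assume x: "x \<in> units G"
  then obtain U where U: "x \<in> U" "homeo_onto_open (arrow_top G) (unit_top G) (rng G) U"
    using local_homeo_rng unit_simps(1) [OF x]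
    unfolding local_homeomorphism_def arrows_def [symmetric] by blast
  let ?V = "{y \<in> topspace (arrow_top G). rng G y \<in> U} \<inter> U"
  have "openin (arrow_top G) ?V"
    using openin_continuous_map_preimage [OF continuous_rng] homeo_onto_openD(1) [OF U(2)]
    by (intro openin_Int) auto
  moreover have "x \<in> ?V" using U x by (auto simp: arrows_def [symmetric])
  moreover have "?V \<subseteq> units G"
  proof
    fix y assume y: "y \<in> ?V"
    \<comment> \<open>\<open>y\<close> and \<open>rng y\<close> lie in a set on which \<open>rng\<close> is injective, and have the same range.\<close>
    then have "rng G y = y"
      using inj_onD [OF homeo_onto_openD(3) [OF U(2)], of "rng G y" y] by (auto simp: arrows_def)
    then show "y \<in> units G" using y by (intro unitI) (auto simp: arrows_def)
  qed
  ultimately show "\<exists>T. openin (arrow_top G) T \<and> x \<in> T \<and> T \<subseteq> units G" by blast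
qed

lemma openin_unit_top: "openin (unit_top G) U \<longleftrightarrow> openin (arrow_top G) U \<and> U \<subseteq> units G"
  by (auto simp: unit_top_def openin_open_subtopology openin_units)

lemma open_rng:
  assumes V: "openin (arrow_top G) V"
  shows "openin (unit_top G) (rng G ` V)"
proof (subst openin_subopen, intro ballI)
  fix y assume "y \<in> rng G ` V"
  then obtain x where x: "x \<in> V" "y = rng G x" by auto
  then obtain U where U: "x \<in> U" "homeo_onto_open (arrow_top G) (unit_top G) (rng G) U"
    using local_homeo_rng V openin_subset unfolding local_homeomorphism_def by blast
  have "openin (unit_top G) (rng G ` (U \<inter> V))"
    by (rule homeo_onto_openD(4) [OF U(2)]) (use V homeo_onto_openD(1) [OF U(2)] in auto)
  then show "\<exists>T. openin (unit_top G) T \<and> y \<in> T \<and> T \<subseteq> rng G ` V"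
    using x U by blast
qed

lemma open_src: "openin (arrow_top G) V \<Longrightarrow> openin (unit_top G) (src G ` V)"
  using src_image [of V] open_rng [OF inv_image_open] openin_subset by (metis arrows_def)

text \<open>Since range and source are open maps, openness and injectivity suffice for a bisection.\<close>

lemma bisectionI:
  assumes "openin (arrow_top G) D" "inj_on (rng G) D" "inj_on (src G) D"
  shows "bisection G D"
  unfolding bisection_def using assms
  by (intro exI [of _ D] conjI subset_refl homeo_onto_openI continuous_rng_units
      continuous_src_units open_rng open_src)

lemma unit_top_restrict:
  assumes "units G \<subseteq> H"
  shows "units (restrict_groupoid G H) = units G" "unit_top (restrict_groupoid G H) = unit_top G"
proof -
  have "rng G ` (arrows G \<inter> H) = rng G ` arrows G"
  proof -
    have "rng G ` arrows G \<subseteq> rng G ` (arrows G \<inter> H)"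
    proof
      fix y assume "y \<in> rng G ` arrows G"
      then have "y \<in> units G" unfolding units_def .
      then show "y \<in> rng G ` (arrows G \<inter> H)"
        using assms by (intro image_eqI [of _ _ y]) auto
    qed
    then show ?thesis by auto
  qed
  then show *: "units (restrict_groupoid G H) = units G" unfolding units_def by simp
  show "unit_top (restrict_groupoid G H) = unit_top G"
    using assms by (simp add: unit_top_def * subtopology_subtopology Int_absorb1)
qed

lemma bisection_restrictI:
  assumes "openin (arrow_top G) H" "units G \<subseteq> H"
    and "openin (arrow_top G) D" "D \<subseteq> H" "inj_on (rng G) D" "inj_on (src G) D"
  shows "bisection (restrict_groupoid G H) D"
  unfolding bisection_def rng_restrict src_restrict arrow_top_restrict unit_top_restrict(2) [OF assms(2)]
  using assms
  by (intro exI [of _ D] conjI subset_refl homeo_onto_openI continuous_map_from_subtopology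
      continuous_rng_units continuous_src_units open_rng open_src)
     (simp_all add: openin_open_subtopology)

text \<open>A compact set is covered by finitely many open sets on which the range map is injective.\<close>

lemma finite_rng_fibre:
  assumes "compactin (arrow_top G) K"
  shows "finite {\<alpha> \<in> K. rng G \<alpha> = x}"
proof -
  let ?\<U> = "{U. homeo_onto_open (arrow_top G) (unit_top G) (rng G) U}"
  have cov: "K \<subseteq> \<Union>?\<U>"
  proof
    fix y assume "y \<in> K"
    then have "y \<in> topspace (arrow_top G)" using compactin_subset_topspace [OF assms] by auto
    then obtain U where "y \<in> U" "homeo_onto_open (arrow_top G) (unit_top G) (rng G) U"
      using local_homeo_rng unfolding local_homeomorphism_def by meson
    then show "y \<in> \<Union>?\<U>" by blast
  qed
  have op: "openin (arrow_top G) U" if "U \<in> ?\<U>" for U using that homeo_onto_openD(1) by auto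
  obtain \<F> where \<F>: "finite \<F>" "\<F> \<subseteq> ?\<U>" "K \<subseteq> \<Union>\<F>"
    using compactinD [OF assms op cov] by meson
  have "finite {\<alpha> \<in> U. rng G \<alpha> = x}" if "U \<in> \<F>" for U
  proof (rule inj_on_finite [of "rng G" _ "{x}"])
    show "inj_on (rng G) {\<alpha> \<in> U. rng G \<alpha> = x}"
    proof (rule inj_on_subset)
      show "inj_on (rng G) U"
        by (rule homeo_onto_openD(3) [of "arrow_top G" "unit_top G"]) (use \<F>(2) that in blast)
    qed blast
  qed auto
  then have "finite (\<Union>U\<in>\<F>. {\<alpha> \<in> U. rng G \<alpha> = x})" using \<F>(1) by simp
  moreover have "{\<alpha> \<in> K. rng G \<alpha> = x} \<subseteq> (\<Union>U\<in>\<F>. {\<alpha> \<in> U. rng G \<alpha> = x})"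
    using \<F>(3) by auto
  ultimately show ?thesis using finite_subset by blast
qed

end

section \<open>The action of the coefficient units on a twist\<close>

lemma one_ring_unit [simp]: "(1 :: 'r::{comm_ring, comm_monoid_mult}) \<in> ring_units"
  by (simp add: ring_units_def dvd_def)

lemma ring_unitI:
  assumes "t * u = (1 :: 'r::{comm_ring, comm_monoid_mult})"
  shows "t \<in> ring_units"
  unfolding ring_units_def dvd_def using assms [symmetric] by blast

lemma unit_inv_mult_right [simp]:
  fixes t :: "'r::{comm_ring, comm_monoid_mult}"
  assumes "t \<in> ring_units"
  shows "t * unit_inv t = 1"
proof -
  obtain u where u: "t * u = 1" using assms by (auto simp: ring_units_def dvd_def)
  have "v = u" if "t * v = 1" for v
  proof -
    have "v = v * (t * u)" using u by simp
    also have "\<dots> = (t * v) * u" by (simp add: ac_simps)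
    finally show ?thesis using that by simp
  qed
  then have "(THE v. t * v = 1) = u" using u by (intro the_equality)
  then show ?thesis unfolding unit_inv_def using u by simp
qed

lemma unit_inv_mult_left [simp]:
  "(t :: 'r::{comm_ring, comm_monoid_mult}) \<in> ring_units \<Longrightarrow> unit_inv t * t = 1"
  using unit_inv_mult_right [of t] by (simp add: mult.commute)

lemma unit_inv_ring_unit [simp]:
  assumes "(t :: 'r::{comm_ring, comm_monoid_mult}) \<in> ring_units"
  shows "unit_inv t \<in> ring_units"
  by (rule ring_unitI) (rule unit_inv_mult_left [OF assms])

lemma mult_ring_units [simp]:
  assumes "(t :: 'r::{comm_ring, comm_monoid_mult}) \<in> ring_units" "u \<in> ring_units"
  shows "t * u \<in> ring_units"
proof -
  have "(t * u) * (unit_inv t * unit_inv u) = (t * unit_inv t) * (u * unit_inv u)"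
    by (simp only: ac_simps)
  also have "\<dots> = 1" using assms by simp
  finally show ?thesis by (rule ring_unitI)
qed

lemma unit_inv_eqI:
  assumes "t * u = (1 :: 'r::{comm_ring, comm_monoid_mult})"
  shows "unit_inv t = u"
proof -
  have t: "t \<in> ring_units" using assms by (rule ring_unitI)
  have "unit_inv t = unit_inv t * (t * u)" using assms by simp
  also have "\<dots> = (unit_inv t * t) * u" by (simp only: ac_simps)
  finally show ?thesis using t by simp
qed

lemma unit_inv_one [simp]: "unit_inv (1 :: 'r::{comm_ring, comm_monoid_mult}) = 1"
  by (rule unit_inv_eqI) simp

lemma unit_inv_mult_cancel [simp]:
  assumes "(t :: 'r::{comm_ring, comm_monoid_mult}) \<in> ring_units"
  shows "t * (unit_inv t * a) = a" "unit_inv t * (t * a) = a"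
  using assms by (simp_all add: mult.assoc [symmetric])

lemma unit_inv_unit_inv [simp]:
  "(t :: 'r::{comm_ring, comm_monoid_mult}) \<in> ring_units \<Longrightarrow> unit_inv (unit_inv t) = t"
  by (rule unit_inv_eqI) simp

locale hausdorff_ample_twist = discrete_twist G \<Sigma> i q + G: ample_groupoid G
  for G :: "'g top_groupoid" and \<Sigma> :: "'s top_groupoid"
    and i :: "'g \<times> 'r::{comm_ring, comm_monoid_mult} \<Rightarrow> 's" and q :: "'s \<Rightarrow> 'g" +
  assumes Hausdorff: "Hausdorff_space (arrow_top G)"
begin

abbreviation act :: "'r \<Rightarrow> 's \<Rightarrow> 's"  (infixr \<open>\<cdot>\<close> 75)
  where "t \<cdot> \<sigma> \<equiv> twist_act \<Sigma> i q t \<sigma>"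

abbreviation conv :: "('s \<Rightarrow> 'r) \<Rightarrow> ('s \<Rightarrow> 'r) \<Rightarrow> 's \<Rightarrow> 'r"  (infixl \<open>\<star>\<close> 70)
  where "f \<star> g \<equiv> twisted_conv G \<Sigma> q f g"

lemma q_in [simp]: "\<sigma> \<in> arrows \<Sigma> \<Longrightarrow> q \<sigma> \<in> arrows G"
  using DT1_surj by auto

lemma q_mult:
  assumes "\<sigma> \<in> arrows \<Sigma>" "\<tau> \<in> arrows \<Sigma>" "src \<Sigma> \<sigma> = rng \<Sigma> \<tau>"
  shows "src G (q \<sigma>) = rng G (q \<tau>)" "q (gmult \<Sigma> \<sigma> \<tau>) = gmult G (q \<sigma>) (q \<tau>)"
  using hom_q assms unfolding continuous_groupoid_hom_def composable_def by auto

lemma q_unit [simp]: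
  assumes "u \<in> units \<Sigma>"
  shows "q u \<in> units G"
proof -
  have u: "u \<in> arrows \<Sigma>" "src \<Sigma> u = rng \<Sigma> u" "gmult \<Sigma> u u = u"
    using assms \<Sigma>.rng_mult_left [of u] by auto
  \<comment> \<open>\<open>q u\<close> is an idempotent arrow, hence a unit.\<close>
  have c: "src G (q u) = rng G (q u)" "gmult G (q u) (q u) = q u"
    using q_mult [OF u(1) u(1) u(2)] u(3) by auto
  have "q u = rng G (q u)"
    using G.cancel_left(1) [of "q u" "q u"] c u(1) by simp
  then show ?thesis using G.rng_in_units [of "q u"] u(1) by simp
qed

lemma q_rng [simp]: "\<sigma> \<in> arrows \<Sigma> \<Longrightarrow> q (rng \<Sigma> \<sigma>) = rng G (q \<sigma>)"
  using q_mult(1) [of "rng \<Sigma> \<sigma>" \<sigma>] q_unit [of "rng \<Sigma> \<sigma>"] by simp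

lemma q_src [simp]: "\<sigma> \<in> arrows \<Sigma> \<Longrightarrow> q (src \<Sigma> \<sigma>) = src G (q \<sigma>)"
  using q_mult(1) [of \<sigma> "src \<Sigma> \<sigma>"] q_unit [of "src \<Sigma> \<sigma>"] by simp

lemma q_inv [simp]:
  assumes "\<sigma> \<in> arrows \<Sigma>"
  shows "q (ginv \<Sigma> \<sigma>) = ginv G (q \<sigma>)"
  using q_mult [of \<sigma> "ginv \<Sigma> \<sigma>"] assms by (intro G.inv_unique) auto

lemma i_in:
  assumes "x \<in> units G" "t \<in> ring_units"
  shows "i (x, t) \<in> arrows \<Sigma>" "q (i (x, t)) = x"
proof -
  have "i (x, t) \<in> preimage_arrows \<Sigma> q {x}"
    unfolding DT1_fibre [OF assms(1), symmetric] using assms(2) by auto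
  then show "i (x, t) \<in> arrows \<Sigma>" "q (i (x, t)) = x" by (auto simp: preimage_arrows_def)
qed

lemma i_fibre:
  assumes "\<sigma> \<in> arrows \<Sigma>" "q \<sigma> \<in> units G"
  obtains t where "t \<in> ring_units" "\<sigma> = i (q \<sigma>, t)"
proof -
  have "\<sigma> \<in> i ` ({q \<sigma>} \<times> ring_units)"
    using assms unfolding DT1_fibre [OF assms(2)] preimage_arrows_def by simp
  then show thesis using that by auto
qed

lemma i_unit [simp]: "x \<in> units G \<Longrightarrow> i (x, 1) \<in> units \<Sigma>"
  unfolding units_twist by auto

lemma unit_eq_i:
  assumes "u \<in> units \<Sigma>"
  shows "u = i (q u, 1)"
proof -
  obtain x where "x \<in> units G" "u = i (x, 1)" using assms unfolding units_twist by auto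
  then show ?thesis by (simp add: i_in)
qed

lemma rng_eq_i: "\<sigma> \<in> arrows \<Sigma> \<Longrightarrow> rng \<Sigma> \<sigma> = i (rng G (q \<sigma>), 1)"
  and src_eq_i: "\<sigma> \<in> arrows \<Sigma> \<Longrightarrow> src \<Sigma> \<sigma> = i (src G (q \<sigma>), 1)"
  using unit_eq_i [of "rng \<Sigma> \<sigma>"] unit_eq_i [of "src \<Sigma> \<sigma>"] by simp_all

lemma composable_iff:
  assumes "\<sigma> \<in> arrows \<Sigma>" "\<tau> \<in> arrows \<Sigma>"
  shows "src \<Sigma> \<sigma> = rng \<Sigma> \<tau> \<longleftrightarrow> src G (q \<sigma>) = rng G (q \<tau>)"
    and "rng \<Sigma> \<sigma> = rng \<Sigma> \<tau> \<longleftrightarrow> rng G (q \<sigma>) = rng G (q \<tau>)"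
    and "src \<Sigma> \<sigma> = src \<Sigma> \<tau> \<longleftrightarrow> src G (q \<sigma>) = src G (q \<tau>)"
  using assms rng_eq_i src_eq_i q_rng q_src by metis+

lemma rng_i:
  assumes "x \<in> units G" "t \<in> ring_units"
  shows "rng \<Sigma> (i (x, t)) = i (x, 1)" "src \<Sigma> (i (x, t)) = i (x, 1)"
  using rng_eq_i [of "i (x, t)"] src_eq_i [of "i (x, t)"] i_in [OF assms] assms(1) by simp_all

lemma i_mult:
  assumes "x \<in> units G" "t \<in> ring_units" "u \<in> ring_units"
  shows "gmult \<Sigma> (i (x, t)) (i (x, u)) = i (x, t * u)"
proof -
  have "((x, t), (x, u)) \<in> composable (trivial_bundle G)"
    using assms G.unit_simps(1) [OF assms(1)]
    by (auto simp: composable_def arrows_def trivial_bundle_def unit_top_def)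
  then have "i (gmult (trivial_bundle G) (x, t) (x, u)) = gmult \<Sigma> (i (x, t)) (i (x, u))"
    using hom_i unfolding continuous_groupoid_hom_def by fast
  then show ?thesis by (simp add: trivial_bundle_def)
qed

lemma i_inj: "x \<in> units G \<Longrightarrow> t \<in> ring_units \<Longrightarrow> u \<in> ring_units \<Longrightarrow> i (x, t) = i (x, u) \<Longrightarrow> t = u"
  using DT1_inj unfolding inj_on_def by blast

lemma act_eq: "\<sigma> \<in> arrows \<Sigma> \<Longrightarrow> t \<cdot> \<sigma> = gmult \<Sigma> (i (rng G (q \<sigma>), t)) \<sigma>"
  by (simp add: twist_act_def)

lemma act_composable:
  assumes "\<sigma> \<in> arrows \<Sigma>" "t \<in> ring_units"
  shows "i (rng G (q \<sigma>), t) \<in> arrows \<Sigma>" "src \<Sigma> (i (rng G (q \<sigma>), t)) = rng \<Sigma> \<sigma>"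
    "rng \<Sigma> (i (rng G (q \<sigma>), t)) = rng \<Sigma> \<sigma>"
  using assms i_in [of "rng G (q \<sigma>)" t] rng_i [of "rng G (q \<sigma>)" t] rng_eq_i [of \<sigma>] by auto

lemma act_simps [simp]:
  assumes "\<sigma> \<in> arrows \<Sigma>" "t \<in> ring_units"
  shows "t \<cdot> \<sigma> \<in> arrows \<Sigma>" "rng \<Sigma> (t \<cdot> \<sigma>) = rng \<Sigma> \<sigma>" "src \<Sigma> (t \<cdot> \<sigma>) = src \<Sigma> \<sigma>"
    "q (t \<cdot> \<sigma>) = q \<sigma>"
proof -
  note c = act_composable [OF assms]
  show "t \<cdot> \<sigma> \<in> arrows \<Sigma>" "rng \<Sigma> (t \<cdot> \<sigma>) = rng \<Sigma> \<sigma>" "src \<Sigma> (t \<cdot> \<sigma>) = src \<Sigma> \<sigma>"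
    using c assms by (simp_all add: act_eq)
  show "q (t \<cdot> \<sigma>) = q \<sigma>"
    using c assms i_in(2) [of "rng G (q \<sigma>)" t] by (simp add: act_eq q_mult(2))
qed

lemma act_one [simp]: "\<sigma> \<in> arrows \<Sigma> \<Longrightarrow> 1 \<cdot> \<sigma> = \<sigma>"
  by (simp add: act_eq flip: rng_eq_i)

lemma act_mult_left:
  assumes "\<sigma> \<in> arrows \<Sigma>" "\<tau> \<in> arrows \<Sigma>" "src \<Sigma> \<sigma> = rng \<Sigma> \<tau>" "t \<in> ring_units"
  shows "gmult \<Sigma> (t \<cdot> \<sigma>) \<tau> = t \<cdot> gmult \<Sigma> \<sigma> \<tau>"
  using assms act_composable [OF assms(1,4)] q_mult [OF assms(1-3)]
  by (simp add: act_eq \<Sigma>.assoc)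

lemma act_mult_right:
  assumes "\<sigma> \<in> arrows \<Sigma>" "\<tau> \<in> arrows \<Sigma>" "src \<Sigma> \<sigma> = rng \<Sigma> \<tau>" "t \<in> ring_units"
  shows "gmult \<Sigma> \<sigma> (t \<cdot> \<tau>) = t \<cdot> gmult \<Sigma> \<sigma> \<tau>"
proof -
  have r: "rng G (q \<tau>) = src G (q \<sigma>)" using q_mult [OF assms(1-3)] by simp
  have "gmult \<Sigma> \<sigma> (t \<cdot> \<tau>) = gmult \<Sigma> (gmult \<Sigma> \<sigma> (i (rng G (q \<tau>), t))) \<tau>"
    using assms act_composable [OF assms(2,4)] by (simp add: act_eq \<Sigma>.assoc)
  also have "\<dots> = gmult \<Sigma> (t \<cdot> \<sigma>) \<tau>"
    using DT3 [OF assms(1,4)] assms r by (simp add: twist_act_def)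
  finally show ?thesis using act_mult_left [OF assms] by simp
qed

lemma act_act:
  assumes "\<sigma> \<in> arrows \<Sigma>" "t \<in> ring_units" "u \<in> ring_units"
  shows "t \<cdot> u \<cdot> \<sigma> = (t * u) \<cdot> \<sigma>"
proof -
  let ?x = "rng G (q \<sigma>)"
  have x: "?x \<in> units G" using assms by simp
  have "t \<cdot> u \<cdot> \<sigma> = gmult \<Sigma> (i (?x, t)) (gmult \<Sigma> (i (?x, u)) \<sigma>)"
    using assms by (simp add: act_eq [of "u \<cdot> \<sigma>"]) (simp add: act_eq)
  also have "\<dots> = gmult \<Sigma> (gmult \<Sigma> (i (?x, t)) (i (?x, u))) \<sigma>"
    using assms act_composable [OF assms(1,2)] act_composable [OF assms(1,3)]
    by (simp add: \<Sigma>.assoc)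
  finally show ?thesis using assms x by (simp add: i_mult act_eq)
qed

lemma act_inv:
  assumes "\<sigma> \<in> arrows \<Sigma>" "t \<in> ring_units"
  shows "ginv \<Sigma> (t \<cdot> \<sigma>) = unit_inv t \<cdot> ginv \<Sigma> \<sigma>"
  using assms
  by (intro \<Sigma>.inv_unique [symmetric]) (simp_all add: act_mult_left act_mult_right act_act)

lemma act_inj:
  assumes "\<sigma> \<in> arrows \<Sigma>" "t \<in> ring_units" "u \<in> ring_units" "t \<cdot> \<sigma> = u \<cdot> \<sigma>"
  shows "t = u"
proof -
  have "i (rng G (q \<sigma>), t) = gmult \<Sigma> (t \<cdot> \<sigma>) (ginv \<Sigma> \<sigma>)"
    using assms(1-3) act_composable [OF assms(1,2)] by (simp add: act_eq)
  also have "\<dots> = i (rng G (q \<sigma>), u)"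
    unfolding assms(4) using assms(1-3) act_composable [OF assms(1,3)] by (simp add: act_eq)
  finally show ?thesis by (rule i_inj [rotated -1]) (use assms in simp_all)
qed

text \<open>The fibres of \<open>q\<close> are the orbits of the action: if \<open>q \<sigma> = q \<tau>\<close> then
  \<open>\<tau> \<sigma>\<inverse>\<close> lies over a unit, so it has the form \<open>i (x, t)\<close>.\<close>

lemma same_fibre:
  assumes "\<sigma> \<in> arrows \<Sigma>" "\<tau> \<in> arrows \<Sigma>" "q \<sigma> = q \<tau>"
  obtains t where "t \<in> ring_units" "\<tau> = t \<cdot> \<sigma>"
proof -
  have s: "src \<Sigma> \<tau> = src \<Sigma> \<sigma>" using assms composable_iff by simp
  let ?\<rho> = "gmult \<Sigma> \<tau> (ginv \<Sigma> \<sigma>)"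
  have \<rho>: "?\<rho> \<in> arrows \<Sigma>" "q ?\<rho> = rng G (q \<sigma>)"
    using assms s q_mult(2) [of \<tau> "ginv \<Sigma> \<sigma>"] by simp_all
  then obtain t where t: "t \<in> ring_units" "?\<rho> = i (rng G (q \<sigma>), t)"
    using i_fibre [OF \<rho>(1)] assms by auto
  have "t \<cdot> \<sigma> = gmult \<Sigma> ?\<rho> \<sigma>" using assms t by (simp add: act_eq)
  also have "\<dots> = \<tau>" using assms s by simp
  finally show thesis using that t(1) by simp
qed


section \<open>Convolution of equivariant functions\<close>

text \<open>Associativity of the convolution needs no topology. It holds for all equivariant functions
  whose support meets each range fibre in finitely many classes, and this set is closed under
  convolution. Continuity and compactness of supports are then dealt with separately.\<close>

definition equivariant_functions :: "('s \<Rightarrow> 'r) set" where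
  "equivariant_functions = {f. supp f \<subseteq> arrows \<Sigma> \<and>
     (\<forall>\<sigma>\<in>arrows \<Sigma>. \<forall>t\<in>ring_units. f (t \<cdot> \<sigma>) = unit_inv t * f \<sigma>) \<and>
     (\<forall>x. finite {\<alpha> \<in> q ` supp f. rng G \<alpha> = x})}"

lemma equivariant_outside: "f \<in> equivariant_functions \<Longrightarrow> \<sigma> \<notin> arrows \<Sigma> \<Longrightarrow> f \<sigma> = 0"
  by (auto simp: equivariant_functions_def supp_def)

lemma equivariant_act [simp]:
  "f \<in> equivariant_functions \<Longrightarrow> \<sigma> \<in> arrows \<Sigma> \<Longrightarrow> t \<in> ring_units \<Longrightarrow> f (t \<cdot> \<sigma>) = unit_inv t * f \<sigma>"
  by (auto simp: equivariant_functions_def)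

lemma equivariant_finite_fibre:
  "f \<in> equivariant_functions \<Longrightarrow> finite {\<alpha> \<in> q ` supp f. rng G \<alpha> = x}"
  by (auto simp: equivariant_functions_def)

lemma q_supp_subset: "f \<in> equivariant_functions \<Longrightarrow> q ` supp f \<subseteq> arrows G"
  by (auto simp: equivariant_functions_def)

text \<open>Along a fibre of \<open>q\<close> the values of an equivariant function differ by units of the ring, so
  its support is a union of fibres.\<close>

lemma q_in_q_supp_iff:
  assumes "f \<in> equivariant_functions" "\<sigma> \<in> arrows \<Sigma>"
  shows "q \<sigma> \<in> q ` supp f \<longleftrightarrow> f \<sigma> \<noteq> 0"
proof
  assume "q \<sigma> \<in> q ` supp f"
  then obtain \<tau> where \<tau>: "f \<tau> \<noteq> 0" "q \<tau> = q \<sigma>" by (auto simp: supp_def)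
  then have "\<tau> \<in> arrows \<Sigma>" using equivariant_outside [OF assms(1)] by auto
  then obtain t where "t \<in> ring_units" "\<tau> = t \<cdot> \<sigma>" using same_fibre [OF assms(2)] \<tau>(2) by metis
  then show "f \<sigma> \<noteq> 0" using \<tau>(1) assms by auto
qed (simp add: supp_def)

text \<open>The convolution of \<open>f\<close> and \<open>g\<close> is defined by a section depending on \<open>f\<close>. One fixed
  lift of every arrow makes iterated convolutions comparable.\<close>

definition lift :: "'g \<Rightarrow> 's" where
  "lift = inv_into (arrows \<Sigma>) q"

lemma lift [simp]: "\<alpha> \<in> arrows G \<Longrightarrow> lift \<alpha> \<in> arrows \<Sigma>" "\<alpha> \<in> arrows G \<Longrightarrow> q (lift \<alpha>) = \<alpha>"
  unfolding lift_def using DT1_surj by (metis inv_into_into, metis f_inv_into_f)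

lemma conv_term_well_defined:
  assumes "f \<in> equivariant_functions" "g \<in> equivariant_functions"
    and "\<sigma> \<in> arrows \<Sigma>" "\<tau> \<in> arrows \<Sigma>" "\<tau>' \<in> arrows \<Sigma>" "q \<tau> = q \<tau>'" "rng G (q \<tau>) = rng G (q \<sigma>)"
  shows "f \<tau>' * g (gmult \<Sigma> (ginv \<Sigma> \<tau>') \<sigma>) = f \<tau> * g (gmult \<Sigma> (ginv \<Sigma> \<tau>) \<sigma>)"
proof -
  obtain t where t: "t \<in> ring_units" "\<tau>' = t \<cdot> \<tau>" using same_fibre assms by metis
  have r: "rng \<Sigma> \<tau> = rng \<Sigma> \<sigma>" using composable_iff assms by simp
  have "f \<tau>' * g (gmult \<Sigma> (ginv \<Sigma> \<tau>') \<sigma>) =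
      (unit_inv t * f \<tau>) * (t * g (gmult \<Sigma> (ginv \<Sigma> \<tau>) \<sigma>))"
    using assms t r by (simp add: act_inv act_mult_left)
  also have "\<dots> = (unit_inv t * t) * (f \<tau> * g (gmult \<Sigma> (ginv \<Sigma> \<tau>) \<sigma>))"
    by (simp only: ac_simps)
  finally show ?thesis using t by simp
qed

lemma conv_eq_sum:
  assumes f: "f \<in> equivariant_functions" and g: "g \<in> equivariant_functions"
    and \<sigma>: "\<sigma> \<in> arrows \<Sigma>" and F: "finite F"
    and fib: "\<And>\<alpha>. \<alpha> \<in> q ` supp f \<Longrightarrow> rng G \<alpha> = rng G (q \<sigma>) \<Longrightarrow> \<alpha> \<in> F"
    and S: "\<And>\<alpha>. \<alpha> \<in> F \<Longrightarrow> S \<alpha> \<in> arrows \<Sigma>" "\<And>\<alpha>. \<alpha> \<in> F \<Longrightarrow> q (S \<alpha>) = \<alpha>"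
    and r: "\<And>\<alpha>. \<alpha> \<in> F \<Longrightarrow> rng G \<alpha> = rng G (q \<sigma>)"
  shows "(f \<star> g) \<sigma> = (\<Sum>\<alpha>\<in>F. f (S \<alpha>) * g (gmult \<Sigma> (ginv \<Sigma> (S \<alpha>)) \<sigma>))"
proof -
  let ?T = "inv_into (supp f) q" and ?A = "{\<alpha> \<in> q ` supp f. rng G \<alpha> = rng G (q \<sigma>)}"
  have T: "?T \<alpha> \<in> arrows \<Sigma>" "q (?T \<alpha>) = \<alpha>" if "\<alpha> \<in> q ` supp f" for \<alpha>
    using inv_into_into [OF that] f_inv_into_f [OF that] equivariant_outside [OF f]
    by (auto simp: supp_def)
  have "(f \<star> g) \<sigma> = (\<Sum>\<alpha>\<in>?A. f (?T \<alpha>) * g (gmult \<Sigma> (ginv \<Sigma> (?T \<alpha>)) \<sigma>))"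
    using \<sigma> by (simp add: twisted_conv_def Let_def)
  also have "\<dots> = (\<Sum>\<alpha>\<in>?A. f (S \<alpha>) * g (gmult \<Sigma> (ginv \<Sigma> (S \<alpha>)) \<sigma>))"
  proof (rule sum.cong [OF refl])
    fix \<alpha> assume a: "\<alpha> \<in> ?A"
    then have "\<alpha> \<in> F" using fib by auto
    then show "f (?T \<alpha>) * g (gmult \<Sigma> (ginv \<Sigma> (?T \<alpha>)) \<sigma>) =
        f (S \<alpha>) * g (gmult \<Sigma> (ginv \<Sigma> (S \<alpha>)) \<sigma>)"
      using a T [of \<alpha>] S r by (intro conv_term_well_defined [OF f g \<sigma>]) auto
  qed
  also have "\<dots> = (\<Sum>\<alpha>\<in>F. f (S \<alpha>) * g (gmult \<Sigma> (ginv \<Sigma> (S \<alpha>)) \<sigma>))"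
  proof (rule sum.mono_neutral_left [OF F])
    show "?A \<subseteq> F" using fib by auto
    show "\<forall>\<alpha>\<in>F - ?A. f (S \<alpha>) * g (gmult \<Sigma> (ginv \<Sigma> (S \<alpha>)) \<sigma>) = 0"
    proof
      fix \<alpha> assume a: "\<alpha> \<in> F - ?A"
      then have "\<alpha> \<notin> q ` supp f" using r by auto
      then have "f (S \<alpha>) = 0" using q_in_q_supp_iff [OF f, of "S \<alpha>"] S a by auto
      then show "f (S \<alpha>) * g (gmult \<Sigma> (ginv \<Sigma> (S \<alpha>)) \<sigma>) = 0" by simp
    qed
  qed
  finally show ?thesis .
qed

lemma conv_outside: "\<sigma> \<notin> arrows \<Sigma> \<Longrightarrow> (f \<star> g) \<sigma> = 0"
  by (simp add: twisted_conv_def Let_def)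

lemma supp_convE:
  assumes f: "f \<in> equivariant_functions" and g: "g \<in> equivariant_functions" and "(f \<star> g) \<sigma> \<noteq> 0"
  obtains \<alpha> \<gamma> where "\<alpha> \<in> q ` supp f" "\<gamma> \<in> q ` supp g" "src G \<alpha> = rng G \<gamma>" "q \<sigma> = gmult G \<alpha> \<gamma>"
proof -
  have \<sigma>: "\<sigma> \<in> arrows \<Sigma>" using assms(3) conv_outside by blast
  let ?F = "{\<alpha> \<in> q ` supp f. rng G \<alpha> = rng G (q \<sigma>)}"
  have F: "?F \<subseteq> arrows G" using q_supp_subset [OF f] by auto
  have "(f \<star> g) \<sigma> = (\<Sum>\<alpha>\<in>?F. f (lift \<alpha>) * g (gmult \<Sigma> (ginv \<Sigma> (lift \<alpha>)) \<sigma>))"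
    by (rule conv_eq_sum [OF f g \<sigma>]) (use F equivariant_finite_fibre [OF f] in auto)
  then obtain \<alpha> where a: "\<alpha> \<in> ?F" "f (lift \<alpha>) * g (gmult \<Sigma> (ginv \<Sigma> (lift \<alpha>)) \<sigma>) \<noteq> 0"
    using assms(3) by (metis (no_types, lifting) sum.neutral)
  let ?\<tau> = "gmult \<Sigma> (ginv \<Sigma> (lift \<alpha>)) \<sigma>"
  have \<alpha>: "\<alpha> \<in> arrows G" "rng G \<alpha> = rng G (q \<sigma>)" using a F by auto
  have s: "rng \<Sigma> (lift \<alpha>) = rng \<Sigma> \<sigma>" using composable_iff(2) \<alpha> \<sigma> by simp
  have \<tau>: "?\<tau> \<in> arrows \<Sigma>" "q ?\<tau> = gmult G (ginv G \<alpha>) (q \<sigma>)"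
    using \<alpha> \<sigma> s q_mult(2) [of "ginv \<Sigma> (lift \<alpha>)" \<sigma>] by auto
  have "g ?\<tau> \<noteq> 0" using a by auto
  then have "q ?\<tau> \<in> q ` supp g" by (simp add: supp_def)
  moreover have "src G \<alpha> = rng G (q ?\<tau>)" "q \<sigma> = gmult G \<alpha> (q ?\<tau>)"
    unfolding \<tau>(2) using \<alpha> \<sigma> by simp_all
  ultimately show thesis using that a(1) by blast
qed

lemma conv_equivariant:
  assumes f: "f \<in> equivariant_functions" and g: "g \<in> equivariant_functions"
  shows "f \<star> g \<in> equivariant_functions"
  unfolding equivariant_functions_def
proof (intro CollectI conjI ballI allI)
  show "supp (f \<star> g) \<subseteq> arrows \<Sigma>" using conv_outside by (auto simp: supp_def)
next
  fix \<sigma> t assume \<sigma>: "\<sigma> \<in> arrows \<Sigma>" and t: "t \<in> (ring_units :: 'r set)"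
  let ?F = "{\<alpha> \<in> q ` supp f. rng G \<alpha> = rng G (q \<sigma>)}"
  have F: "?F \<subseteq> arrows G" using q_supp_subset [OF f] by auto
  have "(f \<star> g) (t \<cdot> \<sigma>) = (\<Sum>\<alpha>\<in>?F. f (lift \<alpha>) * g (gmult \<Sigma> (ginv \<Sigma> (lift \<alpha>)) (t \<cdot> \<sigma>)))"
    by (rule conv_eq_sum [OF f g]) (use F equivariant_finite_fibre [OF f] \<sigma> t in auto)
  also have "\<dots> = (\<Sum>\<alpha>\<in>?F. unit_inv t * (f (lift \<alpha>) * g (gmult \<Sigma> (ginv \<Sigma> (lift \<alpha>)) \<sigma>)))"
  proof (rule sum.cong [OF refl])
    fix \<alpha> assume "\<alpha> \<in> ?F"
    then have \<alpha>: "\<alpha> \<in> arrows G" "rng G \<alpha> = rng G (q \<sigma>)" using F by auto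
    have s: "rng \<Sigma> (lift \<alpha>) = rng \<Sigma> \<sigma>" using composable_iff(2) \<alpha> \<sigma> by simp
    show "f (lift \<alpha>) * g (gmult \<Sigma> (ginv \<Sigma> (lift \<alpha>)) (t \<cdot> \<sigma>)) =
        unit_inv t * (f (lift \<alpha>) * g (gmult \<Sigma> (ginv \<Sigma> (lift \<alpha>)) \<sigma>))"
      using \<alpha> s \<sigma> t g by (simp add: act_mult_right ac_simps)
  qed
  also have "\<dots> = unit_inv t * (\<Sum>\<alpha>\<in>?F. f (lift \<alpha>) * g (gmult \<Sigma> (ginv \<Sigma> (lift \<alpha>)) \<sigma>))"
    by (simp add: sum_distrib_left)
  also have "(\<Sum>\<alpha>\<in>?F. f (lift \<alpha>) * g (gmult \<Sigma> (ginv \<Sigma> (lift \<alpha>)) \<sigma>)) = (f \<star> g) \<sigma>"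
    by (rule conv_eq_sum [OF f g \<sigma>, symmetric]) (use F equivariant_finite_fibre [OF f] in auto)
  finally show "(f \<star> g) (t \<cdot> \<sigma>) = unit_inv t * (f \<star> g) \<sigma>" .
next
  fix x
  let ?F = "{\<alpha> \<in> q ` supp f. rng G \<alpha> = x}"
  let ?P = "\<Union>\<alpha>\<in>?F. gmult G \<alpha> ` {\<gamma> \<in> q ` supp g. rng G \<gamma> = src G \<alpha>}"
  have "finite ?P" using equivariant_finite_fibre f g by blast
  moreover have "{\<beta> \<in> q ` supp (f \<star> g). rng G \<beta> = x} \<subseteq> ?P"
  proof
    fix \<beta> assume "\<beta> \<in> {\<beta> \<in> q ` supp (f \<star> g). rng G \<beta> = x}"
    then obtain \<sigma> where \<sigma>: "(f \<star> g) \<sigma> \<noteq> 0" "\<beta> = q \<sigma>" "rng G \<beta> = x" by (auto simp: supp_def)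
    then obtain \<alpha> \<gamma> where h: "\<alpha> \<in> q ` supp f" "\<gamma> \<in> q ` supp g" "src G \<alpha> = rng G \<gamma>"
      "q \<sigma> = gmult G \<alpha> \<gamma>" using supp_convE [OF f g] by metis
    moreover have "\<alpha> \<in> arrows G" "\<gamma> \<in> arrows G" using h q_supp_subset f g by blast+
    then have "rng G \<alpha> = x" using \<sigma>(2,3) h(3,4) by auto
    ultimately show "\<beta> \<in> ?P" using \<sigma>(2) by auto
  qed
  ultimately show "finite {\<beta> \<in> q ` supp (f \<star> g). rng G \<beta> = x}" by (rule rev_finite_subset)
qed

text \<open>Both iterated convolutions at \<open>\<sigma>\<close> are the sum of
  \<open>f(\<tau>\<^sub>\<alpha>) g(\<tau>\<^sub>\<alpha>\<inverse> \<tau>\<^sub>\<beta>) h(\<tau>\<^sub>\<beta>\<inverse> \<sigma>)\<close>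
  over pairs \<open>(\<alpha>, \<beta>)\<close> of arrows with range \<open>r(\<sigma>)\<close>, where \<open>\<tau>\<^sub>\<alpha>\<close> is a lift of
  \<open>\<alpha>\<close>; for \<open>f \<star> (g \<star> h)\<close> one lifts the arrow \<open>\<alpha>\<inverse> \<beta>\<close> to
  \<open>\<tau>\<^sub>\<alpha>\<inverse> \<tau>\<^sub>\<beta>\<close>.\<close>

lemma conv_assoc:
  assumes f: "f \<in> equivariant_functions" and g: "g \<in> equivariant_functions"
    and h: "h \<in> equivariant_functions"
  shows "(f \<star> g) \<star> h = f \<star> (g \<star> h)"
proof
  fix \<sigma>
  show "((f \<star> g) \<star> h) \<sigma> = (f \<star> (g \<star> h)) \<sigma>"
  proof (cases "\<sigma> \<in> arrows \<Sigma>")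
    case \<sigma>: True
    let ?x = "rng G (q \<sigma>)"
    let ?\<tau> = "\<lambda>\<alpha>. ginv \<Sigma> (lift \<alpha>)"
    let ?F = "{\<alpha> \<in> q ` supp f. rng G \<alpha> = ?x}"
    let ?P = "\<Union>\<alpha>\<in>?F. gmult G \<alpha> ` {\<gamma> \<in> q ` supp g. rng G \<gamma> = src G \<alpha>}"
    have finF: "finite ?F" and finP: "finite ?P" using equivariant_finite_fibre f g by blast+
    have F: "\<alpha> \<in> arrows G" "rng G \<alpha> = ?x" if "\<alpha> \<in> ?F" for \<alpha>
      using that q_supp_subset [OF f] by auto
    have P: "\<beta> \<in> arrows G \<and> rng G \<beta> = ?x" if "\<beta> \<in> ?P" for \<beta>
    proof -
      obtain \<alpha> \<gamma> where *: "\<alpha> \<in> ?F" "\<gamma> \<in> q ` supp g" "rng G \<gamma> = src G \<alpha>" "\<beta> = gmult G \<alpha> \<gamma>"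
        using \<open>\<beta> \<in> ?P\<close> by blast
      have "\<gamma> \<in> arrows G" using * q_supp_subset [OF g] by blast
      then show ?thesis using F [OF *(1)] *(3,4) by simp
    qed
    have r\<sigma>: "rng \<Sigma> (lift \<alpha>) = rng \<Sigma> \<sigma>" if "\<alpha> \<in> arrows G" "rng G \<alpha> = ?x" for \<alpha>
      using composable_iff(2) that \<sigma> by simp
    have "((f \<star> g) \<star> h) \<sigma> = (\<Sum>\<beta>\<in>?P. (f \<star> g) (lift \<beta>) * h (gmult \<Sigma> (?\<tau> \<beta>) \<sigma>))"
    proof (rule conv_eq_sum [OF conv_equivariant [OF f g] h \<sigma> finP])
      fix \<beta>
      show "lift \<beta> \<in> arrows \<Sigma>" "q (lift \<beta>) = \<beta>" "rng G \<beta> = ?x" if "\<beta> \<in> ?P"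
        using P [OF that] by simp_all
      assume \<beta>: "\<beta> \<in> q ` supp (f \<star> g)" "rng G \<beta> = ?x"
      then obtain \<rho> where "(f \<star> g) \<rho> \<noteq> 0" "\<beta> = q \<rho>" by (auto simp: supp_def)
      then obtain \<alpha> \<gamma> where *: "\<alpha> \<in> q ` supp f" "\<gamma> \<in> q ` supp g" "src G \<alpha> = rng G \<gamma>"
        "\<beta> = gmult G \<alpha> \<gamma>" using supp_convE [OF f g] by metis
      moreover have "\<alpha> \<in> arrows G" "\<gamma> \<in> arrows G" using * q_supp_subset f g by blast+
      then have "rng G \<alpha> = ?x" using \<beta>(2) * by simp
      ultimately show "\<beta> \<in> ?P" by auto
    qed
    also have "\<dots> = (\<Sum>\<beta>\<in>?P. \<Sum>\<alpha>\<in>?F.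
        f (lift \<alpha>) * (g (gmult \<Sigma> (?\<tau> \<alpha>) (lift \<beta>)) * h (gmult \<Sigma> (?\<tau> \<beta>) \<sigma>)))"
    proof (rule sum.cong [OF refl])
      fix \<beta> assume "\<beta> \<in> ?P"
      note b = P [OF this]
      have "(f \<star> g) (lift \<beta>) = (\<Sum>\<alpha>\<in>?F. f (lift \<alpha>) * g (gmult \<Sigma> (?\<tau> \<alpha>) (lift \<beta>)))"
      proof (rule conv_eq_sum [OF f g _ finF])
        show "lift \<beta> \<in> arrows \<Sigma>" using b by simp
        fix \<alpha>
        show "\<alpha> \<in> ?F" if "\<alpha> \<in> q ` supp f" "rng G \<alpha> = rng G (q (lift \<beta>))" using that b by simp
        show "lift \<alpha> \<in> arrows \<Sigma>" "q (lift \<alpha>) = \<alpha>" "rng G \<alpha> = rng G (q (lift \<beta>))"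
          if "\<alpha> \<in> ?F" using F [OF that] b by simp_all
      qed
      then show "(f \<star> g) (lift \<beta>) * h (gmult \<Sigma> (?\<tau> \<beta>) \<sigma>) = (\<Sum>\<alpha>\<in>?F.
        f (lift \<alpha>) * (g (gmult \<Sigma> (?\<tau> \<alpha>) (lift \<beta>)) * h (gmult \<Sigma> (?\<tau> \<beta>) \<sigma>)))"
        by (simp add: sum_distrib_right mult.assoc)
    qed
    also have "\<dots> = (\<Sum>\<alpha>\<in>?F. \<Sum>\<beta>\<in>?P.
        f (lift \<alpha>) * (g (gmult \<Sigma> (?\<tau> \<alpha>) (lift \<beta>)) * h (gmult \<Sigma> (?\<tau> \<beta>) \<sigma>)))"
      by (rule sum.swap)
    also have "\<dots> = (\<Sum>\<alpha>\<in>?F. f (lift \<alpha>) * (g \<star> h) (gmult \<Sigma> (?\<tau> \<alpha>) \<sigma>))"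
    proof (rule sum.cong [OF refl])
      fix \<alpha> assume a: "\<alpha> \<in> ?F"
      note \<alpha> = F [OF a]
      have r\<alpha>: "rng \<Sigma> (lift \<alpha>) = rng \<Sigma> \<sigma>" using r\<sigma> \<alpha> by blast
      have P': "lift \<beta> \<in> arrows \<Sigma>" "\<beta> \<in> arrows G" "rng \<Sigma> (lift \<beta>) = rng \<Sigma> \<sigma>" "rng G \<beta> = rng G \<alpha>"
        if "\<beta> \<in> ?P" for \<beta> using P [OF that] r\<sigma> \<alpha> by auto
      let ?Q = "gmult G (ginv G \<alpha>) ` ?P"
      let ?S = "\<lambda>\<gamma>. gmult \<Sigma> (?\<tau> \<alpha>) (lift (gmult G \<alpha> \<gamma>))"
      have cancel: "gmult G \<alpha> (gmult G (ginv G \<alpha>) \<beta>) = \<beta>" if "\<beta> \<in> ?P" for \<beta>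
        using P' [OF that] \<alpha> by simp
      have q\<tau>: "q (gmult \<Sigma> (?\<tau> \<alpha>) \<rho>) = gmult G (ginv G \<alpha>) (q \<rho>)"
        if "\<rho> \<in> arrows \<Sigma>" "rng \<Sigma> \<rho> = rng \<Sigma> \<sigma>" for \<rho>
        using that \<alpha> r\<alpha> by (subst q_mult(2)) simp_all
      have inj: "inj_on (gmult G (ginv G \<alpha>)) ?P"
        by (rule inj_on_inverseI [where g = "gmult G \<alpha>"]) (rule cancel)
      have "(g \<star> h) (gmult \<Sigma> (?\<tau> \<alpha>) \<sigma>) = (\<Sum>\<gamma>\<in>?Q. g (?S \<gamma>) *
          h (gmult \<Sigma> (ginv \<Sigma> (?S \<gamma>)) (gmult \<Sigma> (?\<tau> \<alpha>) \<sigma>)))"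
      proof (rule conv_eq_sum [OF g h])
        show "gmult \<Sigma> (?\<tau> \<alpha>) \<sigma> \<in> arrows \<Sigma>" using \<sigma> \<alpha> r\<alpha> by simp
        show "finite ?Q" using finP by simp
        have rg: "rng G (q (gmult \<Sigma> (?\<tau> \<alpha>) \<sigma>)) = src G \<alpha>"
          using q\<tau> [OF \<sigma> refl] \<alpha> \<sigma> by simp
        fix \<gamma>
        show "\<gamma> \<in> ?Q" if "\<gamma> \<in> q ` supp g" "rng G \<gamma> = rng G (q (gmult \<Sigma> (?\<tau> \<alpha>) \<sigma>))"
        proof -
          have "\<gamma> \<in> arrows G" using that q_supp_subset [OF g] by auto
          then have "\<gamma> = gmult G (ginv G \<alpha>) (gmult G \<alpha> \<gamma>)" using that \<alpha> rg by simp
          moreover have "gmult G \<alpha> \<gamma> \<in> ?P" using a that rg by auto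
          ultimately show ?thesis by (rule image_eqI)
        qed
        show "?S \<gamma> \<in> arrows \<Sigma>" "q (?S \<gamma>) = \<gamma>" "rng G \<gamma> = rng G (q (gmult \<Sigma> (?\<tau> \<alpha>) \<sigma>))"
          if "\<gamma> \<in> ?Q"
        proof -
          obtain \<beta> where b: "\<beta> \<in> ?P" "\<gamma> = gmult G (ginv G \<alpha>) \<beta>" using \<open>\<gamma> \<in> ?Q\<close> by blast
          note \<beta> = P' [OF b(1)]
          have S: "?S \<gamma> = gmult \<Sigma> (?\<tau> \<alpha>) (lift \<beta>)" using cancel [OF b(1)] b(2) by simp
          show "?S \<gamma> \<in> arrows \<Sigma>" unfolding S using \<beta> \<alpha> r\<alpha> by simp
          show "q (?S \<gamma>) = \<gamma>" unfolding S using q\<tau> [OF \<beta>(1,3)] \<beta> b by simp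
          show "rng G \<gamma> = rng G (q (gmult \<Sigma> (?\<tau> \<alpha>) \<sigma>))" unfolding rg b(2) using \<beta> \<alpha> by simp
        qed
      qed
      also have "\<dots> = (\<Sum>\<beta>\<in>?P. g (gmult \<Sigma> (?\<tau> \<alpha>) (lift \<beta>)) * h (gmult \<Sigma> (?\<tau> \<beta>) \<sigma>))"
      proof (subst sum.reindex [OF inj], rule sum.cong [OF refl])
        fix \<beta> assume b: "\<beta> \<in> ?P"
        note \<beta> = P' [OF b]
        have S: "?S (gmult G (ginv G \<alpha>) \<beta>) = gmult \<Sigma> (?\<tau> \<alpha>) (lift \<beta>)"
          using cancel [OF b] by simp
        have "gmult \<Sigma> (ginv \<Sigma> (gmult \<Sigma> (?\<tau> \<alpha>) (lift \<beta>))) (gmult \<Sigma> (?\<tau> \<alpha>) \<sigma>) =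
            gmult \<Sigma> (gmult \<Sigma> (?\<tau> \<beta>) (lift \<alpha>)) (gmult \<Sigma> (?\<tau> \<alpha>) \<sigma>)"
          using \<beta> \<alpha> \<sigma> r\<alpha> by (simp add: \<Sigma>.inv_mult)
        also have "\<dots> = gmult \<Sigma> (?\<tau> \<beta>) \<sigma>"
          using \<beta> \<alpha> \<sigma> r\<alpha> by (simp add: \<Sigma>.assoc)
        finally show "((\<lambda>\<gamma>. g (?S \<gamma>) * h (gmult \<Sigma> (ginv \<Sigma> (?S \<gamma>)) (gmult \<Sigma> (?\<tau> \<alpha>) \<sigma>))) \<circ>
            gmult G (ginv G \<alpha>)) \<beta> =
            g (gmult \<Sigma> (?\<tau> \<alpha>) (lift \<beta>)) * h (gmult \<Sigma> (?\<tau> \<beta>) \<sigma>)"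
          unfolding o_def S by simp
      qed
      finally show "(\<Sum>\<beta>\<in>?P. f (lift \<alpha>) *
          (g (gmult \<Sigma> (?\<tau> \<alpha>) (lift \<beta>)) * h (gmult \<Sigma> (?\<tau> \<beta>) \<sigma>))) =
          f (lift \<alpha>) * (g \<star> h) (gmult \<Sigma> (?\<tau> \<alpha>) \<sigma>)"
        by (simp add: sum_distrib_left)
    qed
    also have "\<dots> = (f \<star> (g \<star> h)) \<sigma>"
      by (rule conv_eq_sum [OF f conv_equivariant [OF g h] \<sigma> finF, symmetric]) (use q_supp_subset [OF f] in auto)
    finally show ?thesis .
  qed (simp add: conv_outside)
qed

text \<open>If one factor is supported over the units, at most one term of the convolution is nonzero,
  since a unit is determined by its range.\<close>

lemma diagonal_conv:
  assumes b: "b \<in> equivariant_functions" "q ` supp b \<subseteq> units G" and f: "f \<in> equivariant_functions"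
    and \<sigma>: "\<sigma> \<in> arrows \<Sigma>"
  shows "(b \<star> f) \<sigma> = b (rng \<Sigma> \<sigma>) * f \<sigma>"
proof -
  have "(b \<star> f) \<sigma> =
      (\<Sum>\<alpha>\<in>{rng G (q \<sigma>)}. b (rng \<Sigma> \<sigma>) * f (gmult \<Sigma> (ginv \<Sigma> (rng \<Sigma> \<sigma>)) \<sigma>))"
  proof (rule conv_eq_sum [OF b(1) f \<sigma>])
    fix \<alpha> assume "\<alpha> \<in> q ` supp b" "rng G \<alpha> = rng G (q \<sigma>)"
    moreover from this have "\<alpha> \<in> units G" using b by blast
    ultimately show "\<alpha> \<in> {rng G (q \<sigma>)}" by simp
  qed (use \<sigma> in auto)
  then show ?thesis using \<sigma> by simp
qed

lemma conv_diagonal: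
  assumes b: "b \<in> equivariant_functions" "q ` supp b \<subseteq> units G" and f: "f \<in> equivariant_functions"
    and \<sigma>: "\<sigma> \<in> arrows \<Sigma>"
  shows "(f \<star> b) \<sigma> = f \<sigma> * b (src \<Sigma> \<sigma>)"
proof -
  let ?F = "insert (q \<sigma>) {\<alpha> \<in> q ` supp f. rng G \<alpha> = rng G (q \<sigma>)}"
  let ?S = "\<lambda>\<alpha>. if \<alpha> = q \<sigma> then \<sigma> else lift \<alpha>"
  have F: "\<alpha> \<in> arrows G" "rng G \<alpha> = rng G (q \<sigma>)" if "\<alpha> \<in> ?F" for \<alpha>
    using that q_supp_subset [OF f] \<sigma> by auto
  have fin: "finite ?F" using equivariant_finite_fibre [OF f] by simp
  have "(f \<star> b) \<sigma> = (\<Sum>\<alpha>\<in>?F. f (?S \<alpha>) * b (gmult \<Sigma> (ginv \<Sigma> (?S \<alpha>)) \<sigma>))"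
    by (rule conv_eq_sum [OF f b(1) \<sigma> fin]) (use \<sigma> q_supp_subset [OF f] in auto)
  also have "\<dots> = (\<Sum>\<alpha>\<in>?F. if \<alpha> = q \<sigma> then f \<sigma> * b (src \<Sigma> \<sigma>) else 0)"
  proof (rule sum.cong [OF refl])
    fix \<alpha> assume a: "\<alpha> \<in> ?F"
    note \<alpha> = F [OF a]
    show "f (?S \<alpha>) * b (gmult \<Sigma> (ginv \<Sigma> (?S \<alpha>)) \<sigma>) = (if \<alpha> = q \<sigma> then f \<sigma> * b (src \<Sigma> \<sigma>) else 0)"
    proof (cases "\<alpha> = q \<sigma>")
      case True
      then show ?thesis using \<sigma> by simp
    next
      case False
      let ?\<rho> = "gmult \<Sigma> (ginv \<Sigma> (lift \<alpha>)) \<sigma>"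
      have r: "rng \<Sigma> (lift \<alpha>) = rng \<Sigma> \<sigma>" using composable_iff(2) \<alpha> \<sigma> by simp
      have \<rho>: "?\<rho> \<in> arrows \<Sigma>" "q ?\<rho> = gmult G (ginv G \<alpha>) (q \<sigma>)"
        using \<alpha> \<sigma> r q_mult(2) [of "ginv \<Sigma> (lift \<alpha>)" \<sigma>] by auto
      have "b ?\<rho> = 0"
      proof (rule ccontr)
        assume "b ?\<rho> \<noteq> 0"
        then have u: "gmult G (ginv G \<alpha>) (q \<sigma>) \<in> units G"
          using b(2) \<rho> by (auto simp: supp_def)
        have "gmult G (ginv G \<alpha>) (q \<sigma>) = src G \<alpha>"
          by (rule trans [OF G.unit_simps(2) [OF u, symmetric]]) (use \<alpha> \<sigma> in simp)
        then have "\<alpha> = q \<sigma>"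
          using G.cancel_left(2) [of \<alpha> "q \<sigma>"] \<alpha> \<sigma> by simp
        with False show False ..
      qed
      with False show ?thesis by simp
    qed
  qed
  also have "\<dots> = f \<sigma> * b (src \<Sigma> \<sigma>)" using fin by (simp add: sum.delta)
  finally show ?thesis .
qed

end

section \<open>The twisted Steinberg algebra\<close>

lemma Hausdorff_finite_disjoint_nhds:
  assumes "Hausdorff_space X" "finite F" "F \<subseteq> topspace X"
  obtains M where "\<And>a. a \<in> F \<Longrightarrow> openin X (M a)" "\<And>a. a \<in> F \<Longrightarrow> a \<in> M a"
    "\<And>a b. a \<in> F \<Longrightarrow> b \<in> F \<Longrightarrow> a \<noteq> b \<Longrightarrow> M a \<inter> M b = {}"
proof -
  have "\<exists>U V. openin X U \<and> openin X V \<and> a \<in> U \<and> b \<in> V \<and> disjnt U V"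
    if "a \<in> F" "b \<in> F" "a \<noteq> b" for a b
    using assms(1,3) that unfolding Hausdorff_space_def by (meson subsetD)
  then obtain U V where UV: "\<And>a b. a \<in> F \<Longrightarrow> b \<in> F \<Longrightarrow> a \<noteq> b \<Longrightarrow>
      openin X (U a b) \<and> openin X (V a b) \<and> a \<in> U a b \<and> b \<in> V a b \<and> disjnt (U a b) (V a b)"
    by metis
  let ?M = "\<lambda>a. (\<Inter>b\<in>F - {a}. U a b \<inter> V b a) \<inter> topspace X"
  show thesis
  proof (rule that [of ?M])
    show "openin X (?M a)" if "a \<in> F" for a
    proof (rule openin_INT)
      show "finite (F - {a})" using assms(2) by simp
      show "openin X (U a b \<inter> V b a)" if "b \<in> F - {a}" for b
        using UV [of a b] UV [of b a] \<open>a \<in> F\<close> that by (intro openin_Int) auto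
    qed
    show "a \<in> ?M a" if "a \<in> F" for a
    proof (intro IntI INT_I)
      show "a \<in> topspace X" using that assms(3) by blast
      show "a \<in> U a b" "a \<in> V b a" if "b \<in> F - {a}" for b
        using UV [of a b] UV [of b a] \<open>a \<in> F\<close> that by auto
    qed
    show "?M a \<inter> ?M b = {}" if "a \<in> F" "b \<in> F" "a \<noteq> b" for a b
      using UV [OF that] that unfolding disjnt_def by blast
  qed
qed

context hausdorff_ample_twist
begin

abbreviation A where "A \<equiv> steinberg_algebra G \<Sigma> i q"
abbreviation B where "B \<equiv> diagonal_algebra G \<Sigma> i q"

lemma topspace_arrows [simp]:
  "topspace (arrow_top G) = arrows G" "topspace (arrow_top \<Sigma>) = arrows \<Sigma>"
  by (simp_all add: arrows_def)

lemma continuous_q: "continuous_map (arrow_top \<Sigma>) (arrow_top G) q"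
  using hom_q unfolding continuous_groupoid_hom_def by blast

lemma openin_vimage_q:
  "openin (arrow_top G) U \<Longrightarrow> openin (arrow_top \<Sigma>) {\<sigma> \<in> arrows \<Sigma>. q \<sigma> \<in> U}"
  using openin_continuous_map_preimage [OF continuous_q] by simp

lemma preimage_arrows_open:
  "openin (arrow_top G) U \<Longrightarrow> openin (arrow_top \<Sigma>) (preimage_arrows \<Sigma> q U)"
  unfolding preimage_arrows_def by (rule openin_vimage_q)

lemma local_trivialisation:
  assumes "\<alpha> \<in> arrows G"
  obtains D P where "\<alpha> \<in> D" "openin (arrow_top G) D" "bisection G D" "D \<subseteq> arrows G"
    "continuous_map (subtopology (arrow_top G) D) (arrow_top \<Sigma>) P"
    "\<And>\<beta>. \<beta> \<in> D \<Longrightarrow> q (P \<beta>) = \<beta>" "\<And>\<beta>. \<beta> \<in> D \<Longrightarrow> P \<beta> \<in> arrows \<Sigma>"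
    "homeomorphic_map
      (prod_topology (subtopology (arrow_top G) D) (discrete_topology (ring_units :: 'r set)))
      (subtopology (arrow_top \<Sigma>) (preimage_arrows \<Sigma> q D)) (\<lambda>(\<beta>, t). t \<cdot> P \<beta>)"
proof -
  obtain D P where DP: "\<alpha> \<in> D" "openin (arrow_top G) D" "bisection G D"
    "continuous_map (subtopology (arrow_top G) D) (arrow_top \<Sigma>) P"
    "\<forall>\<beta>\<in>D. q (P \<beta>) = \<beta>"
    "homeomorphic_map
      (prod_topology (subtopology (arrow_top G) D) (discrete_topology (ring_units :: 'r set)))
      (subtopology (arrow_top \<Sigma>) (preimage_arrows \<Sigma> q D))
      (\<lambda>(\<beta>, t). gmult \<Sigma> (i (rng G \<beta>, t)) (P \<beta>))"
    using DT2 [OF assms] by blast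
  have D: "D \<subseteq> arrows G" using openin_subset [OF DP(2)] by simp
  have P: "P \<beta> \<in> arrows \<Sigma>" if "\<beta> \<in> D" for \<beta>
    using continuous_map_image_subset_topspace [OF DP(4)] D that by auto
  have "homeomorphic_map
      (prod_topology (subtopology (arrow_top G) D) (discrete_topology (ring_units :: 'r set)))
      (subtopology (arrow_top \<Sigma>) (preimage_arrows \<Sigma> q D)) (\<lambda>(\<beta>, t). t \<cdot> P \<beta>)"
    by (rule homeomorphic_map_eq [OF DP(6)]) (use P DP(5) in \<open>auto simp: act_eq\<close>)
  with that DP D P show thesis by blast
qed

text \<open>The map \<open>q\<close> is open, being a projection in each local trivialisation.\<close>

lemma q_open:
  assumes U: "openin (arrow_top \<Sigma>) U"
  shows "openin (arrow_top G) (q ` U)"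
proof (subst openin_subopen, intro ballI)
  fix \<alpha> assume "\<alpha> \<in> q ` U"
  then obtain \<sigma> where \<sigma>: "\<sigma> \<in> U" "\<alpha> = q \<sigma>" by blast
  have \<sigma>': "\<sigma> \<in> arrows \<Sigma>" using openin_subset [OF U] \<sigma> by auto
  then obtain D P where D: "\<alpha> \<in> D" "openin (arrow_top G) D" "D \<subseteq> arrows G"
    and P: "\<And>\<beta>. \<beta> \<in> D \<Longrightarrow> q (P \<beta>) = \<beta>" "\<And>\<beta>. \<beta> \<in> D \<Longrightarrow> P \<beta> \<in> arrows \<Sigma>"
    and h: "homeomorphic_map
      (prod_topology (subtopology (arrow_top G) D) (discrete_topology (ring_units :: 'r set)))
      (subtopology (arrow_top \<Sigma>) (preimage_arrows \<Sigma> q D)) (\<lambda>(\<beta>, t). t \<cdot> P \<beta>)"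
    using local_trivialisation [of \<alpha>] \<sigma>(2) by (metis q_in)
  let ?X = "prod_topology (subtopology (arrow_top G) D) (discrete_topology (ring_units :: 'r set))"
  let ?W = "{p \<in> topspace ?X. (\<lambda>(\<beta>, t). t \<cdot> P \<beta>) p \<in> U}"
  have "continuous_map ?X (arrow_top \<Sigma>) (\<lambda>(\<beta>, t). t \<cdot> P \<beta>)"
    using homeomorphic_imp_continuous_map [OF h] continuous_map_in_subtopology by blast
  then have "openin ?X ?W" using U by (rule openin_continuous_map_preimage)
  then have "openin (subtopology (arrow_top G) D) (fst ` ?W)"
    using open_map_fst unfolding open_map_def by blast
  then have o: "openin (arrow_top G) (fst ` ?W)" using D by (simp add: openin_open_subtopology)
  obtain t where t: "t \<in> ring_units" "\<sigma> = t \<cdot> P \<alpha>"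
    using same_fibre [of "P \<alpha>" \<sigma>] P D(1) \<sigma>' \<sigma>(2) by metis
  have "(\<alpha>, t) \<in> ?W" using t \<sigma> D by auto
  then have "\<alpha> \<in> fst ` ?W" by force
  moreover have "fst ` ?W \<subseteq> q ` U"
  proof
    fix \<beta> assume "\<beta> \<in> fst ` ?W"
    then obtain s where "\<beta> \<in> D" "s \<in> ring_units" "s \<cdot> P \<beta> \<in> U" by auto
    then show "\<beta> \<in> q ` U" using P act_simps(4) [of "P \<beta>" s] by (metis image_eqI)
  qed
  ultimately show "\<exists>T. openin (arrow_top G) T \<and> \<alpha> \<in> T \<and> T \<subseteq> q ` U" using o by blast
qed

text \<open>Each sheet of the bundle over the units is open in \<open>\<Sigma>\<close>: in a local trivialisation around
  \<open>i (x, t)\<close>, the second coordinate of \<open>i (y, t)\<close> depends continuously on \<open>y\<close> and takes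
  discrete values, so it is constant near \<open>x\<close>.\<close>

lemma sheet_open:
  assumes t: "t \<in> ring_units"
  shows "openin (arrow_top \<Sigma>) (i ` (units G \<times> {t}))"
proof (subst openin_subopen, intro ballI)
  fix \<sigma> assume "\<sigma> \<in> i ` (units G \<times> {t})"
  then obtain x where x: "x \<in> units G" "\<sigma> = i (x, t)" by auto
  then obtain D P where D: "x \<in> D" "openin (arrow_top G) D" "D \<subseteq> arrows G"
    and P: "\<And>\<beta>. \<beta> \<in> D \<Longrightarrow> q (P \<beta>) = \<beta>" "\<And>\<beta>. \<beta> \<in> D \<Longrightarrow> P \<beta> \<in> arrows \<Sigma>"
    and h: "homeomorphic_map
      (prod_topology (subtopology (arrow_top G) D) (discrete_topology (ring_units :: 'r set)))
      (subtopology (arrow_top \<Sigma>) (preimage_arrows \<Sigma> q D)) (\<lambda>(\<beta>, t). t \<cdot> P \<beta>)"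
    using local_trivialisation [of x] by (metis G.unit_simps(1))
  let ?X = "prod_topology (subtopology (arrow_top G) D) (discrete_topology (ring_units :: 'r set))"
  let ?Y = "subtopology (arrow_top \<Sigma>) (preimage_arrows \<Sigma> q D)"
  let ?\<phi> = "\<lambda>(\<beta>, t). t \<cdot> P \<beta>"
  let ?N = "subtopology (arrow_top G) (D \<inter> units G)"
  obtain \<psi> where \<psi>: "continuous_map ?Y ?X \<psi>" "\<And>y. y \<in> topspace ?Y \<Longrightarrow> ?\<phi> (\<psi> y) = y"
    using h unfolding homeomorphic_map_maps homeomorphic_maps_def by blast
  have N: "topspace ?N = D \<inter> units G" using D by auto
  have it: "i (y, t) \<in> topspace ?Y" if "y \<in> D \<inter> units G" for y
    using that i_in [of y t] t by (auto simp: preimage_arrows_def)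
  have "continuous_map ?N (prod_topology (unit_top G) (discrete_topology ring_units)) (\<lambda>y. (y, t))"
    using t unfolding unit_top_def
    by (auto simp: continuous_map_paired continuous_map_in_subtopology
        intro!: continuous_map_from_subtopology continuous_map_id [unfolded id_def])
  moreover have "continuous_map (prod_topology (unit_top G) (discrete_topology ring_units))
      (arrow_top \<Sigma>) i"
    using hom_i unfolding continuous_groupoid_hom_def by (simp add: trivial_bundle_def)
  ultimately have "continuous_map ?N (arrow_top \<Sigma>) (\<lambda>y. i (y, t))"
    using continuous_map_compose by (fastforce simp: o_def)
  then have "continuous_map ?N ?Y (\<lambda>y. i (y, t))"
    using it N unfolding continuous_map_in_subtopology by auto
  then have c: "continuous_map ?N (discrete_topology (ring_units :: 'r set)) (\<lambda>y. snd (\<psi> (i (y, t))))"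
    using continuous_map_compose [OF continuous_map_compose [OF _ \<psi>(1)] continuous_map_snd]
    by (simp add: o_def)
  define u where "u = snd (\<psi> (i (x, t)))"
  have \<psi>': "\<psi> (i (y, t)) = (y, snd (\<psi> (i (y, t)))) \<and> snd (\<psi> (i (y, t))) \<in> ring_units"
    if y: "y \<in> D \<inter> units G" for y
  proof -
    obtain z s where zs: "\<psi> (i (y, t)) = (z, s)" by (cases "\<psi> (i (y, t))") blast
    have "\<psi> (i (y, t)) \<in> topspace ?X"
      using continuous_map_image_subset_topspace [OF \<psi>(1)] it [OF y] by blast
    then have z: "z \<in> D" "s \<in> ring_units" using zs by auto
    have "s \<cdot> P z = i (y, t)" using \<psi>(2) [OF it [OF y]] zs by simp
    then have "z = y" using z P act_simps(4) [of "P z" s] i_in(2) [of y t] t y by auto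
    then show ?thesis using zs z by simp
  qed
  have u: "u \<in> ring_units" using \<psi>' [of x] x D unfolding u_def by blast
  let ?M = "{y \<in> topspace ?N. snd (\<psi> (i (y, t))) \<in> {u}}"
  have "openin ?N ?M" by (rule openin_continuous_map_preimage [OF c]) (use u in simp)
  then have oM: "openin (arrow_top G) ?M"
    using openin_open_subtopology [OF openin_Int [OF D(2) G.openin_units]] by blast
  have M: "?M \<subseteq> D" "?M \<subseteq> units G" "x \<in> ?M" using N x D by (auto simp: u_def)
  have \<phi>M: "u \<cdot> P y = i (y, t)" if "y \<in> ?M" for y
  proof -
    have "y \<in> D \<inter> units G" using that M by blast
    then show ?thesis using \<psi>' [of y] \<psi>(2) [OF it] that by (metis (mono_tags, lifting) case_prod_conv mem_Collect_eq singletonD)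
  qed
  have "openin ?X (?M \<times> {u})"
    using oM M u by (intro openin_prod_Times_iff [THEN iffD2]) (simp add: openin_open_subtopology D)
  then have "openin ?Y (?\<phi> ` (?M \<times> {u}))"
    using homeomorphic_imp_open_map [OF h] unfolding open_map_def by blast
  moreover have "openin (arrow_top \<Sigma>) (preimage_arrows \<Sigma> q D)" by (rule preimage_arrows_open [OF D(2)])
  ultimately have "openin (arrow_top \<Sigma>) (?\<phi> ` (?M \<times> {u}))"
    using openin_open_subtopology by blast
  moreover have "?\<phi> ` (?M \<times> {u}) = (\<lambda>y. i (y, t)) ` ?M"
  proof -
    have "?\<phi> ` (?M \<times> {u}) = (\<lambda>y. u \<cdot> P y) ` ?M" by force
    also have "\<dots> = (\<lambda>y. i (y, t)) ` ?M" by (rule image_cong [OF refl \<phi>M])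
    finally show ?thesis .
  qed
  ultimately have "openin (arrow_top \<Sigma>) ((\<lambda>y. i (y, t)) ` ?M)" by simp
  moreover have "\<sigma> \<in> (\<lambda>y. i (y, t)) ` ?M" "(\<lambda>y. i (y, t)) ` ?M \<subseteq> i ` (units G \<times> {t})"
    using M x by blast+
  ultimately show "\<exists>T. openin (arrow_top \<Sigma>) T \<and> \<sigma> \<in> T \<and> T \<subseteq> i ` (units G \<times> {t})" by blast
qed

lemma algebraI:
  assumes "supp f \<subseteq> arrows \<Sigma>"
    and "\<And>\<sigma>. \<sigma> \<in> arrows \<Sigma> \<Longrightarrow> \<exists>U. openin (arrow_top \<Sigma>) U \<and> \<sigma> \<in> U \<and> (\<forall>\<tau>\<in>U. f \<tau> = f \<sigma>)"
    and "\<And>\<sigma> t. \<sigma> \<in> arrows \<Sigma> \<Longrightarrow> t \<in> ring_units \<Longrightarrow> f (t \<cdot> \<sigma>) = unit_inv t * f \<sigma>"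
    and "compactin (arrow_top G) (q ` supp f)"
  shows "f \<in> A"
  using assms by (simp add: steinberg_algebra_def locally_constant_on_def)

lemma algebraD:
  assumes "f \<in> A"
  shows "supp f \<subseteq> arrows \<Sigma>"
    and "\<And>\<sigma>. \<sigma> \<in> arrows \<Sigma> \<Longrightarrow> \<exists>U. openin (arrow_top \<Sigma>) U \<and> \<sigma> \<in> U \<and> (\<forall>\<tau>\<in>U. f \<tau> = f \<sigma>)"
    and "\<And>\<sigma> t. \<sigma> \<in> arrows \<Sigma> \<Longrightarrow> t \<in> ring_units \<Longrightarrow> f (t \<cdot> \<sigma>) = unit_inv t * f \<sigma>"
    and "compactin (arrow_top G) (q ` supp f)"
  using assms by (simp_all add: steinberg_algebra_def locally_constant_on_def)

lemma algebra_equivariant [simp, intro]: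
  assumes "f \<in> A"
  shows "f \<in> equivariant_functions"
  unfolding equivariant_functions_def
proof (intro CollectI conjI ballI allI)
  show "finite {\<alpha> \<in> q ` supp f. rng G \<alpha> = x}" for x
    by (rule G.finite_rng_fibre [OF algebraD(4) [OF assms]])
qed (use algebraD(1,3) [OF assms] in blast)+

lemma level_set_open:
  assumes "f \<in> A"
  shows "openin (arrow_top \<Sigma>) {\<sigma> \<in> arrows \<Sigma>. Q (f \<sigma>)}"
proof (subst openin_subopen, intro ballI)
  fix \<sigma> assume s: "\<sigma> \<in> {\<sigma> \<in> arrows \<Sigma>. Q (f \<sigma>)}"
  then obtain U where U: "openin (arrow_top \<Sigma>) U" "\<sigma> \<in> U" "\<forall>\<tau>\<in>U. f \<tau> = f \<sigma>"
    using algebraD(2) [OF assms] by blast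
  have "U \<subseteq> {\<sigma> \<in> arrows \<Sigma>. Q (f \<sigma>)}"
  proof
    fix \<tau> assume "\<tau> \<in> U"
    then have "f \<tau> = f \<sigma>" "\<tau> \<in> topspace (arrow_top \<Sigma>)"
      using U(3) openin_subset [OF U(1)] by blast+
    then show "\<tau> \<in> {\<sigma> \<in> arrows \<Sigma>. Q (f \<sigma>)}" using s by simp
  qed
  with U show "\<exists>T. openin (arrow_top \<Sigma>) T \<and> \<sigma> \<in> T \<and> T \<subseteq> {\<sigma> \<in> arrows \<Sigma>. Q (f \<sigma>)}" by blast
qed

lemma q_supp_open:
  assumes "f \<in> A"
  shows "openin (arrow_top G) (q ` supp f)"
proof -
  have "supp f = {\<sigma> \<in> arrows \<Sigma>. f \<sigma> \<noteq> 0}" using algebraD(1) [OF assms] by (auto simp: supp_def)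
  then show ?thesis using q_open [OF level_set_open [OF assms, of "\<lambda>c. c \<noteq> 0"]] by simp
qed

lemma compact_closed: "compactin (arrow_top G) K \<Longrightarrow> closedin (arrow_top G) K"
  using compactin_imp_closedin [OF Hausdorff] .

lemma openin_vimage_q_compl:
  assumes "compactin (arrow_top G) K"
  shows "openin (arrow_top \<Sigma>) {\<sigma> \<in> arrows \<Sigma>. q \<sigma> \<notin> K}"
proof -
  have eq: "{\<sigma> \<in> arrows \<Sigma>. q \<sigma> \<notin> K} = {\<sigma> \<in> arrows \<Sigma>. q \<sigma> \<in> arrows G - K}" using q_in by blast
  have "openin (arrow_top G) (arrows G - K)"
    using compact_closed [OF assms] by (simp add: closedin_def)
  then show ?thesis unfolding eq by (rule openin_vimage_q)
qed

text \<open>The algebra of the twist over an open set of arrows consists, by extension by zero, of the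
  elements of \<open>A\<close> supported over this set. Extension by zero preserves local constancy
  because the compact support is closed.\<close>

lemma algebra_restrict:
  assumes H: "openin (arrow_top G) H"
  shows "steinberg_algebra (restrict_groupoid G H)
      (restrict_groupoid \<Sigma> (preimage_arrows \<Sigma> q H)) i q = {f \<in> A. q ` supp f \<subseteq> H}"
    (is "?L = ?R")
proof -
  let ?J = "preimage_arrows \<Sigma> q H"
  have J: "?J \<subseteq> arrows \<Sigma>" "\<And>\<sigma>. \<sigma> \<in> arrows \<Sigma> \<Longrightarrow> \<sigma> \<in> ?J \<longleftrightarrow> q \<sigma> \<in> H"
    by (auto simp: preimage_arrows_def)
  have oJ: "openin (arrow_top \<Sigma>) ?J" by (rule preimage_arrows_open [OF H])
  have L: "f \<in> ?L \<longleftrightarrow> supp f \<subseteq> ?J \<and>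
      (\<forall>\<sigma>\<in>?J. \<exists>U. openin (arrow_top \<Sigma>) U \<and> U \<subseteq> ?J \<and> \<sigma> \<in> U \<and> (\<forall>\<tau>\<in>U. f \<tau> = f \<sigma>)) \<and>
      (\<forall>\<sigma>\<in>?J. \<forall>t\<in>ring_units. f (t \<cdot> \<sigma>) = unit_inv t * f \<sigma>) \<and>
      compactin (arrow_top G) (q ` supp f) \<and> q ` supp f \<subseteq> H" for f
    using J(1) by (simp add: steinberg_algebra_def locally_constant_on_def Int_absorb1 twist_act_def
        openin_open_subtopology [OF oJ] compactin_subtopology conj_ac)
  have "f \<in> ?R" if f: "f \<in> ?L" for f
  proof -
    have f1: "supp f \<subseteq> ?J"
      and f2: "\<And>\<sigma>. \<sigma> \<in> ?J \<Longrightarrow>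
        \<exists>U. openin (arrow_top \<Sigma>) U \<and> U \<subseteq> ?J \<and> \<sigma> \<in> U \<and> (\<forall>\<tau>\<in>U. f \<tau> = f \<sigma>)"
      and f3: "\<And>\<sigma> t. \<sigma> \<in> ?J \<Longrightarrow> t \<in> ring_units \<Longrightarrow> f (t \<cdot> \<sigma>) = unit_inv t * f \<sigma>"
      and f4: "compactin (arrow_top G) (q ` supp f)" and f5: "q ` supp f \<subseteq> H"
      using f [unfolded L] by simp_all
    have z: "f \<sigma> = 0" if "q \<sigma> \<notin> q ` supp f" for \<sigma>
      using that by (auto simp: supp_def)
    have "f \<in> A"
    proof (rule algebraI)
      show "supp f \<subseteq> arrows \<Sigma>" using f1 J(1) by (rule subset_trans)
      fix \<sigma> assume \<sigma>: "\<sigma> \<in> arrows \<Sigma>"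
      have J': "q \<sigma> \<notin> q ` supp f" if "\<sigma> \<notin> ?J" using that J(2) [OF \<sigma>] f5 by auto
      show "\<exists>U. openin (arrow_top \<Sigma>) U \<and> \<sigma> \<in> U \<and> (\<forall>\<tau>\<in>U. f \<tau> = f \<sigma>)"
      proof (cases "\<sigma> \<in> ?J")
        case True
        from f2 [OF this] show ?thesis by meson
      next
        case False
        let ?U = "{\<sigma> \<in> arrows \<Sigma>. q \<sigma> \<notin> q ` supp f}"
        have "openin (arrow_top \<Sigma>) ?U" using f4 by (rule openin_vimage_q_compl)
        moreover have "\<sigma> \<in> ?U" using J' [OF False] \<sigma> by simp
        moreover have "\<forall>\<tau>\<in>?U. f \<tau> = f \<sigma>" using z [OF J' [OF False]] z by simp
        ultimately show ?thesis by blast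
      qed
      fix t assume t: "t \<in> (ring_units :: 'r set)"
      show "f (t \<cdot> \<sigma>) = unit_inv t * f \<sigma>"
      proof (cases "\<sigma> \<in> ?J")
        case True
        then show ?thesis using f3 t by simp
      next
        case False
        then show ?thesis using z [OF J'] z [of "t \<cdot> \<sigma>"] J' \<sigma> t by simp
      qed
    qed (rule f4)
    then show ?thesis using f5 by simp
  qed
  moreover have "f \<in> ?L" if f: "f \<in> ?R" for f
    unfolding L
  proof (intro conjI ballI)
    have A: "f \<in> A" and H: "q ` supp f \<subseteq> H" using f by auto
    show "supp f \<subseteq> ?J"
    proof
      fix \<sigma> assume "\<sigma> \<in> supp f"
      then show "\<sigma> \<in> ?J" using algebraD(1) [OF A] H by (auto simp: preimage_arrows_def)
    qed
    show "compactin (arrow_top G) (q ` supp f)" "q ` supp f \<subseteq> H" using algebraD(4) [OF A] H by auto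
    fix \<sigma> assume \<sigma>: "\<sigma> \<in> ?J"
    then have \<sigma>': "\<sigma> \<in> arrows \<Sigma>" using J(1) by blast
    then obtain U where U: "openin (arrow_top \<Sigma>) U" "\<sigma> \<in> U" "\<forall>\<tau>\<in>U. f \<tau> = f \<sigma>"
      using algebraD(2) [OF A] by meson
    show "\<exists>U. openin (arrow_top \<Sigma>) U \<and> U \<subseteq> ?J \<and> \<sigma> \<in> U \<and> (\<forall>\<tau>\<in>U. f \<tau> = f \<sigma>)"
    proof (intro exI conjI)
      show "openin (arrow_top \<Sigma>) (U \<inter> ?J)" using U(1) oJ by (rule openin_Int)
      show "\<sigma> \<in> U \<inter> ?J" using U(2) \<sigma> ..
      show "\<forall>\<tau>\<in>U \<inter> ?J. f \<tau> = f \<sigma>" using U(3) by blast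
    qed blast
    show "f (t \<cdot> \<sigma>) = unit_inv t * f \<sigma>" if "t \<in> ring_units" for t
      using algebraD(3) [OF A \<sigma>' that] .
  qed
  ultimately show ?thesis by blast
qed

lemma diagonal_iff: "b \<in> B \<longleftrightarrow> b \<in> A \<and> q ` supp b \<subseteq> units G"
  unfolding diagonal_algebra_def algebra_restrict [OF G.openin_units] by blast

text \<open>Let \<open>\<tau>\<close> lift \<open>\<alpha>\<close>. The term \<open>f(\<tau>) g(\<tau>\<inverse> \<sigma>)\<close> of the convolution is jointly
  locally constant in \<open>(\<alpha>, \<sigma>)\<close> because \<open>\<tau>\<close> can be chosen to depend continuously on
  \<open>\<alpha>\<close> near a given arrow.\<close>

lemma conv_term_locally_constant:
  assumes f: "f \<in> A" and g: "g \<in> A"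
    and \<alpha>: "\<alpha> \<in> arrows G" and \<sigma>: "\<sigma> \<in> arrows \<Sigma>" and r: "rng G \<alpha> = rng G (q \<sigma>)"
  obtains N V where "openin (arrow_top G) N" "\<alpha> \<in> N" "inj_on (rng G) N"
    "openin (arrow_top \<Sigma>) V" "\<sigma> \<in> V"
    "\<And>\<beta> \<rho>. \<beta> \<in> N \<Longrightarrow> \<rho> \<in> V \<Longrightarrow> rng G \<beta> = rng G (q \<rho>) \<Longrightarrow>
      f (lift \<beta>) * g (gmult \<Sigma> (ginv \<Sigma> (lift \<beta>)) \<rho>) =
      f (lift \<alpha>) * g (gmult \<Sigma> (ginv \<Sigma> (lift \<alpha>)) \<sigma>)"
proof -
  obtain D P where D: "\<alpha> \<in> D" "openin (arrow_top G) D" "bisection G D" "D \<subseteq> arrows G"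
    and cP: "continuous_map (subtopology (arrow_top G) D) (arrow_top \<Sigma>) P"
    and P: "\<And>\<beta>. \<beta> \<in> D \<Longrightarrow> q (P \<beta>) = \<beta>" "\<And>\<beta>. \<beta> \<in> D \<Longrightarrow> P \<beta> \<in> arrows \<Sigma>"
    by (rule local_trivialisation [OF \<alpha>]) (rule that)
  let ?T = "prod_topology (subtopology (arrow_top G) D) (arrow_top \<Sigma>)"
  let ?C = "{p. rng G (fst p) = rng G (q (snd p))}"
  let ?X = "subtopology ?T ?C"
  let ?m = "\<lambda>p. gmult \<Sigma> (ginv \<Sigma> (P (fst p))) (snd p)"
  have X: "fst p \<in> D" "snd p \<in> arrows \<Sigma>" "rng G (fst p) = rng G (q (snd p))"
    if "p \<in> topspace ?X" for p using that by auto
  have c1: "continuous_map ?X (arrow_top \<Sigma>) (\<lambda>p. P (fst p))"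
    using continuous_map_compose [OF continuous_map_from_subtopology [OF continuous_map_fst] cP]
    by (simp add: o_def)
  have c2: "continuous_map ?X (arrow_top \<Sigma>) snd"
    by (rule continuous_map_from_subtopology [OF continuous_map_snd])
  have c3: "continuous_map ?X (arrow_top \<Sigma>) (\<lambda>p. ginv \<Sigma> (P (fst p)))"
    using continuous_map_compose [OF c1 \<Sigma>.continuous_inv] by (simp add: o_def)
  have rP: "rng \<Sigma> (P \<beta>) = rng \<Sigma> \<rho>" if "\<beta> \<in> D" "\<rho> \<in> arrows \<Sigma>" "rng G \<beta> = rng G (q \<rho>)" for \<beta> \<rho>
    using composable_iff(2) [of "P \<beta>" \<rho>] that P by simp
  have cm: "continuous_map ?X (arrow_top \<Sigma>) ?m"
  proof (rule \<Sigma>.continuous_mult_comp [OF c3 c2])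
    fix p assume "p \<in> topspace ?X"
    note p = X [OF this]
    show "src \<Sigma> (ginv \<Sigma> (P (fst p))) = rng \<Sigma> (snd p)" using rP [OF p] P [OF p(1)] by simp
  qed
  have a0: "P \<alpha> \<in> arrows \<Sigma>" "gmult \<Sigma> (ginv \<Sigma> (P \<alpha>)) \<sigma> \<in> arrows \<Sigma>"
    using P D(1) \<sigma> rP [OF D(1) \<sigma> r] by simp_all
  obtain U1 where U1: "openin (arrow_top \<Sigma>) U1" "P \<alpha> \<in> U1" "\<forall>\<tau>\<in>U1. f \<tau> = f (P \<alpha>)"
    using algebraD(2) [OF f a0(1)] by blast
  obtain U2 where U2: "openin (arrow_top \<Sigma>) U2" "gmult \<Sigma> (ginv \<Sigma> (P \<alpha>)) \<sigma> \<in> U2"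
    "\<forall>\<tau>\<in>U2. g \<tau> = g (gmult \<Sigma> (ginv \<Sigma> (P \<alpha>)) \<sigma>)"
    using algebraD(2) [OF g a0(2)] by blast
  have "openin ?X ({p \<in> topspace ?X. P (fst p) \<in> U1} \<inter> {p \<in> topspace ?X. ?m p \<in> U2})"
    by (intro openin_Int openin_continuous_map_preimage [OF c1 U1(1)]
        openin_continuous_map_preimage [OF cm U2(1)])
  then obtain W where W: "openin ?T W"
    "{p \<in> topspace ?X. P (fst p) \<in> U1} \<inter> {p \<in> topspace ?X. ?m p \<in> U2} = W \<inter> ?C"
    unfolding openin_subtopology by blast
  have "(\<alpha>, \<sigma>) \<in> {p \<in> topspace ?X. P (fst p) \<in> U1} \<inter> {p \<in> topspace ?X. ?m p \<in> U2}"
    using D \<alpha> \<sigma> r U1(2) U2(2) by auto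
  then have "(\<alpha>, \<sigma>) \<in> W" unfolding W(2) by blast
  then obtain N V where NV: "openin (subtopology (arrow_top G) D) N" "openin (arrow_top \<Sigma>) V"
    "\<alpha> \<in> N" "\<sigma> \<in> V" "N \<times> V \<subseteq> W"
    using W(1) unfolding openin_prod_topology_alt by meson
  have N: "openin (arrow_top G) N" "N \<subseteq> D"
    using NV(1) openin_open_subtopology [OF D(2)] by auto
  have V: "V \<subseteq> arrows \<Sigma>" using openin_subset [OF NV(2)] by simp
  have key: "f (lift \<beta>) * g (gmult \<Sigma> (ginv \<Sigma> (lift \<beta>)) \<rho>) =
      f (P \<alpha>) * g (gmult \<Sigma> (ginv \<Sigma> (P \<alpha>)) \<sigma>)"
    if b: "\<beta> \<in> N" "\<rho> \<in> V" "rng G \<beta> = rng G (q \<rho>)" for \<beta> \<rho>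
  proof -
    have "(\<beta>, \<rho>) \<in> W \<inter> ?C" using NV(5) b by auto
    then have "P \<beta> \<in> U1" "gmult \<Sigma> (ginv \<Sigma> (P \<beta>)) \<rho> \<in> U2" unfolding W(2) [symmetric] by simp_all
    moreover have "f (lift \<beta>) * g (gmult \<Sigma> (ginv \<Sigma> (lift \<beta>)) \<rho>) =
        f (P \<beta>) * g (gmult \<Sigma> (ginv \<Sigma> (P \<beta>)) \<rho>)"
    proof (rule conv_term_well_defined)
      have b': "\<beta> \<in> D" "\<beta> \<in> arrows G" using b N D by auto
      show "P \<beta> \<in> arrows \<Sigma>" "lift \<beta> \<in> arrows \<Sigma>" "q (P \<beta>) = q (lift \<beta>)"
        "rng G (q (P \<beta>)) = rng G (q \<rho>)" using b' P b by simp_all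
    qed (use f g b V in auto)
    moreover have "f (P \<beta>) = f (P \<alpha>)" if "P \<beta> \<in> U1" using U1(3) that by blast
    moreover have "g (gmult \<Sigma> (ginv \<Sigma> (P \<beta>)) \<rho>) = g (gmult \<Sigma> (ginv \<Sigma> (P \<alpha>)) \<sigma>)"
      if "gmult \<Sigma> (ginv \<Sigma> (P \<beta>)) \<rho> \<in> U2" using U2(3) that by blast
    ultimately show ?thesis by simp
  qed
  show thesis
  proof (rule that [OF N(1) NV(3) _ NV(2,4)])
    show "inj_on (rng G) N" using bisectionD(1) [OF D(3)] N(2) by (rule inj_on_subset)
    show "f (lift \<beta>) * g (gmult \<Sigma> (ginv \<Sigma> (lift \<beta>)) \<rho>) =
      f (lift \<alpha>) * g (gmult \<Sigma> (ginv \<Sigma> (lift \<alpha>)) \<sigma>)"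
      if "\<beta> \<in> N" "\<rho> \<in> V" "rng G \<beta> = rng G (q \<rho>)" for \<beta> \<rho>
      using key [OF that] key [OF NV(3,4) r] by simp
  qed
qed

text \<open>Near \<open>\<sigma>\<close>, each of the finitely many arrows \<open>\<alpha>\<close> in the support of \<open>f\<close> with range
  \<open>r(\<sigma>)\<close> continues uniquely to an arrow with range \<open>r(\<rho>)\<close>, and the corresponding term of
  the sum is locally constant. No other arrows contribute, since the rest of the support is
  compact and its set of ranges misses \<open>r(\<sigma>)\<close>.\<close>

lemma conv_locally_constant:
  assumes f: "f \<in> A" and g: "g \<in> A" and \<sigma>: "\<sigma> \<in> arrows \<Sigma>"
  shows "\<exists>U. openin (arrow_top \<Sigma>) U \<and> \<sigma> \<in> U \<and> (\<forall>\<rho>\<in>U. (f \<star> g) \<rho> = (f \<star> g) \<sigma>)"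
proof -
  let ?w = "\<lambda>\<beta> \<rho>. f (lift \<beta>) * g (gmult \<Sigma> (ginv \<Sigma> (lift \<beta>)) \<rho>)"
  let ?K = "q ` supp f"
  define F where "F = {\<alpha> \<in> ?K. rng G \<alpha> = rng G (q \<sigma>)}"
  have K: "?K \<subseteq> arrows G" using q_supp_subset f by blast
  have finF: "finite F" unfolding F_def using equivariant_finite_fibre f by blast
  have F: "\<alpha> \<in> arrows G" "rng G \<alpha> = rng G (q \<sigma>)" if "\<alpha> \<in> F" for \<alpha>
    using that K unfolding F_def by auto
  have ex: "\<exists>N V. openin (arrow_top G) N \<and> \<alpha> \<in> N \<and> inj_on (rng G) N \<and>
      openin (arrow_top \<Sigma>) V \<and> \<sigma> \<in> V \<and>
      (\<forall>\<beta> \<rho>. \<beta> \<in> N \<longrightarrow> \<rho> \<in> V \<longrightarrow> rng G \<beta> = rng G (q \<rho>) \<longrightarrow> ?w \<beta> \<rho> = ?w \<alpha> \<sigma>)"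
    if a: "\<alpha> \<in> F" for \<alpha>
  proof -
    obtain N V where "openin (arrow_top G) N" "\<alpha> \<in> N" "inj_on (rng G) N"
      "openin (arrow_top \<Sigma>) V" "\<sigma> \<in> V"
      "\<And>\<beta> \<rho>. \<beta> \<in> N \<Longrightarrow> \<rho> \<in> V \<Longrightarrow> rng G \<beta> = rng G (q \<rho>) \<Longrightarrow> ?w \<beta> \<rho> = ?w \<alpha> \<sigma>"
      by (rule conv_term_locally_constant [OF f g F(1) [OF a] \<sigma> F(2) [OF a]]) (rule that)
    then show ?thesis by meson
  qed
  obtain N V where N: "\<And>\<alpha>. \<alpha> \<in> F \<Longrightarrow> openin (arrow_top G) (N \<alpha>)" "\<And>\<alpha>. \<alpha> \<in> F \<Longrightarrow> \<alpha> \<in> N \<alpha>"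
      "\<And>\<alpha>. \<alpha> \<in> F \<Longrightarrow> inj_on (rng G) (N \<alpha>)"
    and V: "\<And>\<alpha>. \<alpha> \<in> F \<Longrightarrow> openin (arrow_top \<Sigma>) (V \<alpha>)" "\<And>\<alpha>. \<alpha> \<in> F \<Longrightarrow> \<sigma> \<in> V \<alpha>"
    and w: "\<And>\<alpha> \<beta> \<rho>. \<alpha> \<in> F \<Longrightarrow> \<beta> \<in> N \<alpha> \<Longrightarrow> \<rho> \<in> V \<alpha> \<Longrightarrow> rng G \<beta> = rng G (q \<rho>) \<Longrightarrow>
      ?w \<beta> \<rho> = ?w \<alpha> \<sigma>"
  proof -
    have "\<exists>N. \<forall>\<alpha>\<in>F. \<exists>V. openin (arrow_top G) (N \<alpha>) \<and> \<alpha> \<in> N \<alpha> \<and> inj_on (rng G) (N \<alpha>) \<and>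
      openin (arrow_top \<Sigma>) V \<and> \<sigma> \<in> V \<and>
      (\<forall>\<beta> \<rho>. \<beta> \<in> N \<alpha> \<longrightarrow> \<rho> \<in> V \<longrightarrow> rng G \<beta> = rng G (q \<rho>) \<longrightarrow> ?w \<beta> \<rho> = ?w \<alpha> \<sigma>)"
      by (rule bchoice, rule ballI, rule ex)
    then obtain N where N: "\<forall>\<alpha>\<in>F. \<exists>V. openin (arrow_top G) (N \<alpha>) \<and> \<alpha> \<in> N \<alpha> \<and>
      inj_on (rng G) (N \<alpha>) \<and> openin (arrow_top \<Sigma>) V \<and> \<sigma> \<in> V \<and>
      (\<forall>\<beta> \<rho>. \<beta> \<in> N \<alpha> \<longrightarrow> \<rho> \<in> V \<longrightarrow> rng G \<beta> = rng G (q \<rho>) \<longrightarrow> ?w \<beta> \<rho> = ?w \<alpha> \<sigma>)" ..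
    from bchoice [OF this] obtain V where NV: "\<forall>\<alpha>\<in>F. openin (arrow_top G) (N \<alpha>) \<and> \<alpha> \<in> N \<alpha> \<and>
      inj_on (rng G) (N \<alpha>) \<and> openin (arrow_top \<Sigma>) (V \<alpha>) \<and> \<sigma> \<in> V \<alpha> \<and>
      (\<forall>\<beta> \<rho>. \<beta> \<in> N \<alpha> \<longrightarrow> \<rho> \<in> V \<alpha> \<longrightarrow> rng G \<beta> = rng G (q \<rho>) \<longrightarrow> ?w \<beta> \<rho> = ?w \<alpha> \<sigma>)" ..
    show thesis
      by (rule that [of N V]; drule NV [THEN bspec]; elim conjE; (assumption | blast))
  qed
  have F': "F \<subseteq> topspace (arrow_top G)" using F(1) by auto
  obtain M where M: "\<And>\<alpha>. \<alpha> \<in> F \<Longrightarrow> openin (arrow_top G) (M \<alpha>)" "\<And>\<alpha>. \<alpha> \<in> F \<Longrightarrow> \<alpha> \<in> M \<alpha>"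
    "\<And>\<alpha> \<beta>. \<alpha> \<in> F \<Longrightarrow> \<beta> \<in> F \<Longrightarrow> \<alpha> \<noteq> \<beta> \<Longrightarrow> M \<alpha> \<inter> M \<beta> = {}"
    by (rule Hausdorff_finite_disjoint_nhds [OF Hausdorff finF F']) (rule that)
  define N' where "N' = (\<lambda>\<alpha>. N \<alpha> \<inter> M \<alpha>)"
  have N': "openin (arrow_top G) (N' \<alpha>)" "\<alpha> \<in> N' \<alpha>" if "\<alpha> \<in> F" for \<alpha>
    unfolding N'_def using N(1,2) [OF that] M(1,2) [OF that] by (simp_all only: openin_Int Int_iff)
  define L where "L = ?K - (\<Union>\<alpha>\<in>F. N' \<alpha>)"
  have cK: "compactin (arrow_top G) ?K" by (rule algebraD(4) [OF f])
  have "openin (arrow_top G) (\<Union>\<alpha>\<in>F. N' \<alpha>)" using N'(1) by (intro openin_Union) blast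
  then have "closedin (arrow_top G) L" unfolding L_def by (rule closedin_diff [OF compact_closed [OF cK]])
  then have "compactin (arrow_top G) L"
    by (rule closed_compactin [OF cK, rotated]) (simp add: L_def)
  then have "compactin (arrow_top G) (rng G ` L)"
    by (rule image_compactin [OF _ G.continuous_rng])
  then have oL: "openin (arrow_top G) (arrows G - rng G ` L)"
    using compact_closed by (simp add: closedin_def)
  have cq: "continuous_map (arrow_top \<Sigma>) (arrow_top G) (\<lambda>\<rho>. rng G (q \<rho>))"
    using continuous_map_compose [OF continuous_q G.continuous_rng] by (simp add: o_def)
  let ?U1 = "{\<rho> \<in> topspace (arrow_top \<Sigma>). rng G (q \<rho>) \<in> arrows G - rng G ` L}"
  let ?R = "\<lambda>\<alpha>. {\<rho> \<in> topspace (arrow_top \<Sigma>). rng G (q \<rho>) \<in> rng G ` N' \<alpha>}"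
  let ?U2 = "(\<Inter>\<alpha>\<in>F. V \<alpha> \<inter> ?R \<alpha>) \<inter> topspace (arrow_top \<Sigma>)"
  have o1: "openin (arrow_top \<Sigma>) ?U1" by (rule openin_continuous_map_preimage [OF cq oL])
  have o2: "openin (arrow_top \<Sigma>) ?U2"
  proof (rule openin_INT [OF finF])
    fix \<alpha> assume a: "\<alpha> \<in> F"
    have "openin (arrow_top G) (rng G ` N' \<alpha>)"
      using G.open_rng [OF N'(1) [OF a]] G.openin_unit_top by blast
    then show "openin (arrow_top \<Sigma>) (V \<alpha> \<inter> ?R \<alpha>)"
      by (intro openin_Int V(1) [OF a] openin_continuous_map_preimage [OF cq])
  qed
  have s1: "\<sigma> \<in> ?U1"
  proof -
    have "rng G (q \<sigma>) \<notin> rng G ` L"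
    proof
      assume "rng G (q \<sigma>) \<in> rng G ` L"
      then obtain \<alpha> where "rng G (q \<sigma>) = rng G \<alpha>" "\<alpha> \<in> L" by (rule imageE)
      then show False using N'(2) [of \<alpha>] unfolding L_def F_def by auto
    qed
    then show ?thesis using \<sigma> by simp
  qed
  have s2: "\<sigma> \<in> ?U2"
  proof (intro IntI INT_I CollectI conjI)
    fix \<alpha> assume a: "\<alpha> \<in> F"
    show "\<sigma> \<in> V \<alpha>" by (rule V(2) [OF a])
    show "rng G (q \<sigma>) \<in> rng G ` N' \<alpha>"
      by (rule image_eqI [OF _ N'(2) [OF a]]) (use F(2) [OF a] in simp)
  qed (use \<sigma> in simp_all)
  have "(f \<star> g) \<rho> = (f \<star> g) \<sigma>" if r1: "\<rho> \<in> ?U1" and r2: "\<rho> \<in> ?U2" for \<rho>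
  proof -
    have \<rho>: "\<rho> \<in> arrows \<Sigma>" using r1 by simp
    have "\<exists>\<beta>. \<beta> \<in> N' \<alpha> \<and> rng G \<beta> = rng G (q \<rho>)" if "\<alpha> \<in> F" for \<alpha>
    proof -
      have "rng G (q \<rho>) \<in> rng G ` N' \<alpha>" using r2 that by blast
      then show ?thesis by auto
    qed
    then have "\<forall>\<alpha>\<in>F. \<exists>\<beta>. \<beta> \<in> N' \<alpha> \<and> rng G \<beta> = rng G (q \<rho>)" by blast
    from bchoice [OF this] obtain b where "\<forall>\<alpha>\<in>F. b \<alpha> \<in> N' \<alpha> \<and> rng G (b \<alpha>) = rng G (q \<rho>)" ..
    then have b: "b \<alpha> \<in> N' \<alpha>" "rng G (b \<alpha>) = rng G (q \<rho>)" if "\<alpha> \<in> F" for \<alpha>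
      using that by blast+
    have bar: "b \<alpha> \<in> arrows G" if "\<alpha> \<in> F" for \<alpha>
      using openin_subset [OF N'(1) [OF that]] b(1) [OF that] by auto
    have inj: "inj_on b F"
    proof (rule inj_onI, rule ccontr)
      fix \<alpha> \<beta> assume *: "\<alpha> \<in> F" "\<beta> \<in> F" "b \<alpha> = b \<beta>" "\<alpha> \<noteq> \<beta>"
      have "b \<alpha> \<in> M \<alpha>" "b \<beta> \<in> M \<beta>" using b(1) * unfolding N'_def by blast+
      then show False using M(3) [OF *(1,2,4)] *(3) by auto
    qed
    have "(f \<star> g) \<rho> = (\<Sum>\<beta>\<in>b ` F. ?w \<beta> \<rho>)"
    proof (rule conv_eq_sum [OF algebra_equivariant [OF f] algebra_equivariant [OF g] \<rho>])
      show "finite (b ` F)" using finF by simp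
      fix \<beta>
      show "\<beta> \<in> b ` F" if \<beta>: "\<beta> \<in> ?K" "rng G \<beta> = rng G (q \<rho>)"
      proof -
        have "\<beta> \<notin> L" using r1 imageI [of \<beta> L "rng G"] \<beta>(2) by auto
        then obtain \<alpha> where a: "\<alpha> \<in> F" "\<beta> \<in> N' \<alpha>" using \<beta>(1) unfolding L_def by blast
        have "\<beta> = b \<alpha>"
          by (rule inj_onD [OF N(3) [OF a(1)]]) (use a b [OF a(1)] \<beta>(2) in \<open>auto simp: N'_def\<close>)
        then show ?thesis using a(1) by (rule image_eqI)
      qed
      assume "\<beta> \<in> b ` F"
      then obtain \<alpha> where a: "\<alpha> \<in> F" "\<beta> = b \<alpha>" by blast
      then show "lift \<beta> \<in> arrows \<Sigma>" "q (lift \<beta>) = \<beta>" "rng G \<beta> = rng G (q \<rho>)"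
        using bar [OF a(1)] b(2) [OF a(1)] by simp_all
    qed
    also have "\<dots> = (\<Sum>\<alpha>\<in>F. ?w (b \<alpha>) \<rho>)" by (simp add: sum.reindex [OF inj])
    also have "\<dots> = (\<Sum>\<alpha>\<in>F. ?w \<alpha> \<sigma>)"
    proof (rule sum.cong [OF refl])
      fix \<alpha> assume a: "\<alpha> \<in> F"
      show "?w (b \<alpha>) \<rho> = ?w \<alpha> \<sigma>"
      proof (rule w [OF a _ _ b(2) [OF a]])
        show "b \<alpha> \<in> N \<alpha>" using b(1) [OF a] unfolding N'_def by blast
        show "\<rho> \<in> V \<alpha>" using r2 a by blast
      qed
    qed
    also have "\<dots> = (f \<star> g) \<sigma>"
    proof (rule conv_eq_sum [OF algebra_equivariant [OF f] algebra_equivariant [OF g] \<sigma> finF,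
          symmetric])
      fix \<alpha> assume a: "\<alpha> \<in> F"
      show "lift \<alpha> \<in> arrows \<Sigma>" "q (lift \<alpha>) = \<alpha>" "rng G \<alpha> = rng G (q \<sigma>)"
        using F [OF a] by simp_all
    qed (simp add: F_def)
    finally show ?thesis .
  qed
  then have "\<forall>\<rho>\<in>?U1 \<inter> ?U2. (f \<star> g) \<rho> = (f \<star> g) \<sigma>" by (intro ballI) (elim IntD1 IntD2 IntE, blast)
  then show ?thesis using openin_Int [OF o1 o2] s1 s2 by (intro exI [of _ "?U1 \<inter> ?U2"]) blast
qed

lemma compactin_mult:
  assumes K: "compactin (arrow_top G) K" and L: "compactin (arrow_top G) L"
  shows "compactin (arrow_top G) ((\<lambda>(x, y). gmult G x y) ` ((K \<times> L) \<inter> composable G))"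
proof -
  let ?T = "prod_topology (arrow_top G) (arrow_top G)"
  have comp: "composable G = {p \<in> topspace ?T. src G (fst p) = rng G (snd p)}"
    by (auto simp: composable_def)
  have "closedin ?T (composable G)"
    unfolding comp
  proof (rule closedin_continuous_maps_eq [OF Hausdorff])
    show "continuous_map ?T (arrow_top G) (\<lambda>p. src G (fst p))"
      using continuous_map_compose [OF continuous_map_fst G.continuous_src] by (simp add: o_def)
    show "continuous_map ?T (arrow_top G) (\<lambda>p. rng G (snd p))"
      using continuous_map_compose [OF continuous_map_snd G.continuous_rng] by (simp add: o_def)
  qed
  moreover have "compactin ?T (K \<times> L)" using K L by (simp add: compactin_Times)
  ultimately have "compactin ?T ((K \<times> L) \<inter> composable G)"
    by (metis closed_Int_compactin Int_commute)
  then have "compactin (subtopology ?T (composable G)) ((K \<times> L) \<inter> composable G)"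
    by (simp add: compactin_subtopology)
  then show ?thesis by (rule image_compactin [OF _ G.continuous_mult])
qed

lemma conv_in_algebra [simp]:
  assumes f: "f \<in> A" and g: "g \<in> A"
  shows "f \<star> g \<in> A"
proof (rule algebraI)
  have fg: "f \<star> g \<in> equivariant_functions" using f g by (simp add: conv_equivariant)
  show "supp (f \<star> g) \<subseteq> arrows \<Sigma>" using conv_outside by (auto simp: supp_def)
  show "\<exists>U. openin (arrow_top \<Sigma>) U \<and> \<sigma> \<in> U \<and> (\<forall>\<tau>\<in>U. (f \<star> g) \<tau> = (f \<star> g) \<sigma>)"
    if "\<sigma> \<in> arrows \<Sigma>" for \<sigma> using conv_locally_constant [OF f g that] .
  show "(f \<star> g) (t \<cdot> \<sigma>) = unit_inv t * (f \<star> g) \<sigma>" if "\<sigma> \<in> arrows \<Sigma>" "t \<in> ring_units" for \<sigma> t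
    using fg that by (rule equivariant_act)
  \<comment> \<open>The support is closed because \<open>f \<star> g\<close> is locally constant, and it lies in the product of
    two compact sets.\<close>
  let ?S = "q ` supp (f \<star> g)"
  have Z: "openin (arrow_top \<Sigma>) {\<sigma> \<in> arrows \<Sigma>. (f \<star> g) \<sigma> = 0}"
  proof (subst openin_subopen, intro ballI)
    fix \<sigma> assume s: "\<sigma> \<in> {\<sigma> \<in> arrows \<Sigma>. (f \<star> g) \<sigma> = 0}"
    then obtain U where U: "openin (arrow_top \<Sigma>) U" "\<sigma> \<in> U" "\<forall>\<rho>\<in>U. (f \<star> g) \<rho> = (f \<star> g) \<sigma>"
      using conv_locally_constant [OF f g] by blast
    have "U \<subseteq> {\<sigma> \<in> arrows \<Sigma>. (f \<star> g) \<sigma> = 0}"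
    proof
      fix \<rho> assume "\<rho> \<in> U"
      then have "(f \<star> g) \<rho> = (f \<star> g) \<sigma>" "\<rho> \<in> topspace (arrow_top \<Sigma>)"
        using U(3) openin_subset [OF U(1)] by blast+
      then show "\<rho> \<in> {\<sigma> \<in> arrows \<Sigma>. (f \<star> g) \<sigma> = 0}" using s by simp
    qed
    then show "\<exists>T. openin (arrow_top \<Sigma>) T \<and> \<sigma> \<in> T \<and> T \<subseteq> {\<sigma> \<in> arrows \<Sigma>. (f \<star> g) \<sigma> = 0}"
      using U(1,2) by blast
  qed
  have S: "?S \<subseteq> arrows G" by (rule q_supp_subset [OF fg])
  have "arrows G - ?S = q ` {\<sigma> \<in> arrows \<Sigma>. (f \<star> g) \<sigma> = 0}"
  proof (intro equalityI subsetI)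
    fix \<alpha> assume a: "\<alpha> \<in> arrows G - ?S"
    then have "(f \<star> g) (lift \<alpha>) = 0" using q_in_q_supp_iff [OF fg, of "lift \<alpha>"] by simp
    then show "\<alpha> \<in> q ` {\<sigma> \<in> arrows \<Sigma>. (f \<star> g) \<sigma> = 0}"
      using a by (intro image_eqI [of _ _ "lift \<alpha>"]) simp_all
  next
    fix \<alpha> assume "\<alpha> \<in> q ` {\<sigma> \<in> arrows \<Sigma>. (f \<star> g) \<sigma> = 0}"
    then obtain \<sigma> where "\<sigma> \<in> arrows \<Sigma>" "(f \<star> g) \<sigma> = 0" "\<alpha> = q \<sigma>" by blast
    then show "\<alpha> \<in> arrows G - ?S" using q_in_q_supp_iff [OF fg, of \<sigma>] by simp
  qed
  then have "closedin (arrow_top G) ?S" using q_open [OF Z] S by (simp add: closedin_def)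
  moreover have "?S \<subseteq> (\<lambda>(x, y). gmult G x y) ` ((q ` supp f \<times> q ` supp g) \<inter> composable G)"
  proof
    fix \<alpha> assume "\<alpha> \<in> ?S"
    then obtain \<sigma> where \<sigma>: "(f \<star> g) \<sigma> \<noteq> 0" "\<alpha> = q \<sigma>" by (auto simp: supp_def)
    obtain \<beta> \<gamma> where *: "\<beta> \<in> q ` supp f" "\<gamma> \<in> q ` supp g" "src G \<beta> = rng G \<gamma>" "q \<sigma> = gmult G \<beta> \<gamma>"
      using supp_convE [OF algebra_equivariant [OF f] algebra_equivariant [OF g] \<sigma>(1)] by metis
    have "(\<beta>, \<gamma>) \<in> (q ` supp f \<times> q ` supp g) \<inter> composable G"
      using * q_supp_subset [OF algebra_equivariant [OF f]] q_supp_subset [OF algebra_equivariant [OF g]]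
      unfolding composable_def by blast
    then show "\<alpha> \<in> (\<lambda>(x, y). gmult G x y) ` ((q ` supp f \<times> q ` supp g) \<inter> composable G)"
      using *(4) \<sigma>(2) by (intro image_eqI [of _ _ "(\<beta>, \<gamma>)"]) simp_all
  qed
  ultimately show "compactin (arrow_top G) ?S"
    using closed_compactin [OF compactin_mult [OF algebraD(4) [OF f] algebraD(4) [OF g]]] by blast
qed


section \<open>Functions defined by continuous sections\<close>

text \<open>For a section \<open>P\<close> of \<open>q\<close> over \<open>D\<close>, this is the equivariant function supported over
  \<open>D\<close> with value \<open>1\<close> on the image of \<open>P\<close>.\<close>

definition section_function :: "'g set \<Rightarrow> ('g \<Rightarrow> 's) \<Rightarrow> 's \<Rightarrow> 'r" where
  "section_function D P \<sigma> =
     (if \<sigma> \<in> arrows \<Sigma> \<and> q \<sigma> \<in> D then (THE t. t \<in> ring_units \<and> t \<cdot> \<sigma> = P (q \<sigma>)) else 0)"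

lemma section_function_eq:
  assumes "\<sigma> \<in> arrows \<Sigma>" "q \<sigma> \<in> D" "t \<in> ring_units" "t \<cdot> \<sigma> = P (q \<sigma>)"
  shows "section_function D P \<sigma> = t"
proof -
  have "(THE t. t \<in> ring_units \<and> t \<cdot> \<sigma> = P (q \<sigma>)) = t"
  proof (rule the_equality)
    fix s assume "s \<in> ring_units \<and> s \<cdot> \<sigma> = P (q \<sigma>)"
    then show "s = t" using act_inj [OF assms(1), of s t] assms(3,4) by simp
  qed (use assms in simp)
  then show ?thesis using assms by (simp add: section_function_def)
qed

definition compact_open_section :: "'g set \<Rightarrow> ('g \<Rightarrow> 's) \<Rightarrow> bool" where
  "compact_open_section D P \<longleftrightarrow> openin (arrow_top G) D \<and> compactin (arrow_top G) D \<and>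
     continuous_map (subtopology (arrow_top G) D) (arrow_top \<Sigma>) P \<and> (\<forall>\<beta>\<in>D. q (P \<beta>) = \<beta>)"

lemma compact_open_sectionD:
  assumes "compact_open_section D P"
  shows "openin (arrow_top G) D" "compactin (arrow_top G) D"
    "continuous_map (subtopology (arrow_top G) D) (arrow_top \<Sigma>) P"
    "\<And>\<beta>. \<beta> \<in> D \<Longrightarrow> q (P \<beta>) = \<beta>" "\<And>\<beta>. \<beta> \<in> D \<Longrightarrow> P \<beta> \<in> arrows \<Sigma>" "D \<subseteq> arrows G"
proof -
  show *: "openin (arrow_top G) D" "compactin (arrow_top G) D"
    "continuous_map (subtopology (arrow_top G) D) (arrow_top \<Sigma>) P"
    "\<And>\<beta>. \<beta> \<in> D \<Longrightarrow> q (P \<beta>) = \<beta>" using assms unfolding compact_open_section_def by blast+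
  show D: "D \<subseteq> arrows G" using openin_subset [OF *(1)] by simp
  show "P \<beta> \<in> arrows \<Sigma>" if "\<beta> \<in> D" for \<beta>
    using continuous_map_image_subset_topspace [OF *(3)] D that by auto
qed

lemma section_function_on_section:
  assumes "compact_open_section D P" "\<beta> \<in> D"
  shows "section_function D P (P \<beta>) = 1"
  using compact_open_sectionD(4,5) [OF assms] assms(2) by (intro section_function_eq) simp_all

lemma section_function_support: "q ` supp (section_function D P) \<subseteq> D"
  by (auto simp: supp_def section_function_def split: if_splits)

lemma section_function_in_algebra:
  assumes D: "compact_open_section D P"
  shows "section_function D P \<in> A"
proof (rule algebraI)
  let ?m = "section_function D P"
  note D' = compact_open_sectionD [OF D]
  have val: "\<exists>s\<in>ring_units. s \<cdot> \<sigma> = P (q \<sigma>) \<and> ?m \<sigma> = s" if \<sigma>: "\<sigma> \<in> arrows \<Sigma>" "q \<sigma> \<in> D" for \<sigma>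
  proof -
    obtain s where s: "s \<in> ring_units" "P (q \<sigma>) = s \<cdot> \<sigma>"
      using same_fibre [OF \<sigma>(1) D'(5) [OF \<sigma>(2)]] D'(4) [OF \<sigma>(2)] by metis
    then show ?thesis using section_function_eq [OF \<sigma> s(1)] by metis
  qed
  show "supp ?m \<subseteq> arrows \<Sigma>" by (auto simp: supp_def section_function_def split: if_splits)
  fix \<sigma> assume \<sigma>: "\<sigma> \<in> arrows \<Sigma>"
  show "?m (t \<cdot> \<sigma>) = unit_inv t * ?m \<sigma>" if t: "t \<in> ring_units" for t
  proof (cases "q \<sigma> \<in> D")
    case True
    then obtain s where s: "s \<in> ring_units" "s \<cdot> \<sigma> = P (q \<sigma>)" "?m \<sigma> = s" using val \<sigma> by blast
    have "(unit_inv t * s) * t = (unit_inv t * t) * s" by (simp only: ac_simps)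
    then have "(unit_inv t * s) \<cdot> t \<cdot> \<sigma> = P (q \<sigma>)" using s t \<sigma> by (simp add: act_act)
    then have "?m (t \<cdot> \<sigma>) = unit_inv t * s"
      using section_function_eq [of "t \<cdot> \<sigma>" D "unit_inv t * s" P] \<sigma> s t True by simp
    then show ?thesis using s by simp
  next
    case False
    then show ?thesis using \<sigma> t by (simp add: section_function_def)
  qed
  show "\<exists>U. openin (arrow_top \<Sigma>) U \<and> \<sigma> \<in> U \<and> (\<forall>\<tau>\<in>U. ?m \<tau> = ?m \<sigma>)"
  proof (cases "q \<sigma> \<in> D")
    case True
    then obtain s where s: "s \<in> ring_units" "s \<cdot> \<sigma> = P (q \<sigma>)" "?m \<sigma> = s" using val \<sigma> by blast
    let ?Y = "subtopology (arrow_top \<Sigma>) (preimage_arrows \<Sigma> q D)"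
    have Y: "\<rho> \<in> arrows \<Sigma>" "q \<rho> \<in> D" if "\<rho> \<in> topspace ?Y" for \<rho>
      using that by (auto simp: preimage_arrows_def)
    have oY: "openin (arrow_top \<Sigma>) (preimage_arrows \<Sigma> q D)" by (rule preimage_arrows_open [OF D'(1)])
    have "continuous_map ?Y (subtopology (arrow_top G) D) q"
      using continuous_q by (auto simp: continuous_map_in_subtopology preimage_arrows_def
          intro: continuous_map_from_subtopology)
    from continuous_map_compose [OF this D'(3)]
    have c1: "continuous_map ?Y (arrow_top \<Sigma>) (\<lambda>\<rho>. P (q \<rho>))" by (simp add: o_def)
    have c2: "continuous_map ?Y (arrow_top \<Sigma>) (\<lambda>\<rho>. ginv \<Sigma> \<rho>)"
      using \<Sigma>.continuous_inv by (rule continuous_map_from_subtopology)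
    have comp: "src \<Sigma> (P (q \<rho>)) = src \<Sigma> \<rho>" if "\<rho> \<in> arrows \<Sigma>" "q \<rho> \<in> D" for \<rho>
      using composable_iff(3) [of "P (q \<rho>)" \<rho>] D'(4,5) that by simp
    have c: "continuous_map ?Y (arrow_top \<Sigma>) (\<lambda>\<rho>. gmult \<Sigma> (P (q \<rho>)) (ginv \<Sigma> \<rho>))"
      by (rule \<Sigma>.continuous_mult_comp [OF c1 c2]) (use Y comp in simp)
    \<comment> \<open>On this set \<open>P (q \<rho>) \<rho>\<inverse>\<close> lies in the open sheet \<open>{i (x, s) | x}\<close>.\<close>
    let ?U = "{\<rho> \<in> topspace ?Y. gmult \<Sigma> (P (q \<rho>)) (ginv \<Sigma> \<rho>) \<in> i ` (units G \<times> {s})}"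
    have "openin ?Y ?U" by (rule openin_continuous_map_preimage [OF c sheet_open [OF s(1)]])
    then have "openin (arrow_top \<Sigma>) ?U" using openin_open_subtopology [OF oY] by blast
    moreover have "\<sigma> \<in> ?U"
    proof -
      have "gmult \<Sigma> (P (q \<sigma>)) (ginv \<Sigma> \<sigma>) = i (rng G (q \<sigma>), s)"
        using s act_composable [OF \<sigma> s(1)] \<sigma> by (simp add: act_eq flip: s(2))
      then show ?thesis using \<sigma> True by (simp add: preimage_arrows_def)
    qed
    moreover have "?m \<tau> = ?m \<sigma>" if t: "\<tau> \<in> ?U" for \<tau>
    proof -
      have \<tau>: "\<tau> \<in> arrows \<Sigma>" "q \<tau> \<in> D" using t Y by blast+
      obtain x where x: "x \<in> units G" "gmult \<Sigma> (P (q \<tau>)) (ginv \<Sigma> \<tau>) = i (x, s)" using t by blast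
      have P: "P (q \<tau>) \<in> arrows \<Sigma>" "src \<Sigma> (P (q \<tau>)) = src \<Sigma> \<tau>"
        using D'(5) \<tau> comp by simp_all
      have "x = q (gmult \<Sigma> (P (q \<tau>)) (ginv \<Sigma> \<tau>))" using i_in(2) x s(1) by simp
      also have "\<dots> = rng G (q \<tau>)" using q_mult(2) [of "P (q \<tau>)" "ginv \<Sigma> \<tau>"] P \<tau> D'(4) by simp
      finally have "s \<cdot> \<tau> = gmult \<Sigma> (gmult \<Sigma> (P (q \<tau>)) (ginv \<Sigma> \<tau>)) \<tau>"
        using x \<tau> by (simp add: act_eq)
      also have "\<dots> = P (q \<tau>)" using P \<tau> by simp
      finally have "?m \<tau> = s" by (rule section_function_eq [OF \<tau> s(1)])
      then show ?thesis using s(3) by simp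
    qed
    ultimately show ?thesis by blast
  next
    case False
    have "?m \<tau> = ?m \<sigma>" if "\<tau> \<in> {\<sigma> \<in> arrows \<Sigma>. q \<sigma> \<notin> D}" for \<tau>
      using that False by (simp add: section_function_def)
    moreover have "\<sigma> \<in> {\<sigma> \<in> arrows \<Sigma>. q \<sigma> \<notin> D}" using \<sigma> False by simp
    ultimately show ?thesis using openin_vimage_q_compl [OF D'(2)] by blast
  qed
next
  let ?m = "section_function D P"
  note D' = compact_open_sectionD [OF D]
  show "compactin (arrow_top G) (q ` supp ?m)"
  proof (cases "(1 :: 'r) = 0")
    case True
    then have "a = 0" for a :: 'r using mult_1_left [of a] by simp
    then have "supp ?m = {}" by (simp add: supp_def)
    then show ?thesis by simp
  next
    case False
    have "D \<subseteq> q ` supp ?m"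
    proof
      fix \<beta> assume b: "\<beta> \<in> D"
      have "P \<beta> \<in> supp ?m" using section_function_on_section [OF D b] False by (simp add: supp_def)
      then show "\<beta> \<in> q ` supp ?m" using D'(4) [OF b] by (intro image_eqI) simp_all
    qed
    then have "q ` supp ?m = D" using section_function_support by blast
    then show ?thesis using D'(2) by simp
  qed
qed

lemma section_conv:
  assumes D: "compact_open_section D P" and inj: "inj_on (rng G) D"
    and f: "f \<in> equivariant_functions" and \<sigma>: "\<sigma> \<in> arrows \<Sigma>"
    and \<beta>: "\<beta> \<in> D" "rng G \<beta> = rng G (q \<sigma>)"
  shows "(section_function D P \<star> f) \<sigma> = f (gmult \<Sigma> (ginv \<Sigma> (P \<beta>)) \<sigma>)"
proof -
  let ?m = "section_function D P"
  note D' = compact_open_sectionD [OF D]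
  have "(?m \<star> f) \<sigma> = (\<Sum>\<alpha>\<in>{\<beta>}. ?m (P \<alpha>) * f (gmult \<Sigma> (ginv \<Sigma> (P \<alpha>)) \<sigma>))"
  proof (rule conv_eq_sum [OF algebra_equivariant [OF section_function_in_algebra [OF D]] f \<sigma>])
    fix \<alpha> assume "\<alpha> \<in> q ` supp ?m" "rng G \<alpha> = rng G (q \<sigma>)"
    moreover have "\<alpha> \<in> D" using calculation(1) section_function_support by blast
    ultimately have "\<alpha> = \<beta>" using \<beta> by - (rule inj_onD [OF inj], simp_all)
    then show "\<alpha> \<in> {\<beta>}" by simp
  qed (use D' \<beta> in simp_all)
  then show ?thesis using section_function_on_section [OF D \<beta>(1)] by simp
qed

definition inverse_section :: "('g \<Rightarrow> 's) \<Rightarrow> 'g \<Rightarrow> 's" where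
  "inverse_section P = (\<lambda>\<gamma>. ginv \<Sigma> (P (ginv G \<gamma>)))"

lemma compact_open_inverse_section:
  assumes D: "compact_open_section D P"
  shows "compact_open_section (ginv G ` D) (inverse_section P)"
  unfolding compact_open_section_def
proof (intro conjI ballI)
  note D' = compact_open_sectionD [OF D]
  show "openin (arrow_top G) (ginv G ` D)" by (rule G.inv_image_open [OF D'(1)])
  show "compactin (arrow_top G) (ginv G ` D)" by (rule image_compactin [OF D'(2) G.continuous_inv])
  have "continuous_map (subtopology (arrow_top G) (ginv G ` D)) (subtopology (arrow_top G) D) (ginv G)"
    unfolding continuous_map_in_subtopology
    using G.continuous_inv D'(6) by (auto intro: continuous_map_from_subtopology)
  from continuous_map_compose [OF continuous_map_compose [OF this D'(3)] \<Sigma>.continuous_inv]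
  show "continuous_map (subtopology (arrow_top G) (ginv G ` D)) (arrow_top \<Sigma>) (inverse_section P)"
    by (simp add: o_def inverse_section_def)
  fix \<gamma> assume "\<gamma> \<in> ginv G ` D"
  then obtain \<beta> where "\<beta> \<in> D" "\<beta> \<in> arrows G" "\<gamma> = ginv G \<beta>" using D'(6) by blast
  then show "q (inverse_section P \<gamma>) = \<gamma>" using D'(4,5) by (simp add: inverse_section_def)
qed

text \<open>Such a section comes from restricting a local trivialisation to a compact open bisection.\<close>

lemma local_section:
  assumes "openin (arrow_top G) W" "\<alpha> \<in> W"
  obtains D P where "\<alpha> \<in> D" "D \<subseteq> W" "compact_open_section D P" "inj_on (rng G) D" "inj_on (src G) D"
proof -
  have "\<alpha> \<in> arrows G" using openin_subset [OF assms(1)] assms(2) by auto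
  then obtain D0 P where D0: "\<alpha> \<in> D0" "openin (arrow_top G) D0"
    and cP: "continuous_map (subtopology (arrow_top G) D0) (arrow_top \<Sigma>) P"
    and P: "\<And>\<beta>. \<beta> \<in> D0 \<Longrightarrow> q (P \<beta>) = \<beta>" by (rule local_trivialisation) (rule that)
  obtain D where D: "\<alpha> \<in> D" "D \<subseteq> W \<inter> D0" "openin (arrow_top G) D" "compactin (arrow_top G) D"
    "bisection G D"
    using G.compact_open_bisection_base [of "W \<inter> D0" \<alpha>] assms D0 by blast
  have "compact_open_section D P"
    unfolding compact_open_section_def using D P continuous_map_from_subtopology_mono [OF cP, of D]
    by blast
  then show thesis using that D bisectionD [OF D(5)] by blast
qed


section \<open>The diagonal subalgebra\<close>

definition unit_indicator :: "'g set \<Rightarrow> 's \<Rightarrow> 'r" where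
  "unit_indicator W = section_function W (\<lambda>x. i (x, 1))"

lemma unit_indicator_diagonal:
  assumes "openin (arrow_top G) W" "compactin (arrow_top G) W" "W \<subseteq> units G"
  shows "unit_indicator W \<in> B"
proof -
  have "continuous_map (unit_top G) (prod_topology (unit_top G) (discrete_topology (ring_units :: 'r set)))
      (\<lambda>y. (y, 1))"
    by (simp add: continuous_map_paired continuous_map_id [unfolded id_def])
  moreover have "continuous_map (prod_topology (unit_top G) (discrete_topology ring_units))
      (arrow_top \<Sigma>) i"
    using hom_i unfolding continuous_groupoid_hom_def by (simp add: trivial_bundle_def)
  ultimately have "continuous_map (unit_top G) (arrow_top \<Sigma>) (i \<circ> (\<lambda>y. (y, 1)))"
    by (rule continuous_map_compose)
  then have "continuous_map (subtopology (arrow_top G) W) (arrow_top \<Sigma>) (\<lambda>y. i (y, 1))"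
    using assms(3) unfolding unit_top_def o_def by (rule continuous_map_from_subtopology_mono)
  then have "compact_open_section W (\<lambda>y. i (y, 1))"
    unfolding compact_open_section_def using assms i_in(2) one_ring_unit by blast
  then show ?thesis
    unfolding diagonal_iff unit_indicator_def
    using section_function_in_algebra section_function_support assms(3) by blast
qed

lemma unit_indicator_unit:
  assumes "u \<in> units \<Sigma>"
  shows "unit_indicator W u = (if q u \<in> W then 1 else 0)"
proof (cases "q u \<in> W")
  case True
  have "section_function W (\<lambda>x. i (x, 1)) u = 1"
    using unit_eq_i [OF assms] assms True by (intro section_function_eq) simp_all
  then show ?thesis using True by (simp add: unit_indicator_def)
qed (simp add: unit_indicator_def section_function_def)

lemma separating_indicator:
  assumes "x \<in> units G" "y \<in> arrows G" "x \<noteq> y"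
  obtains W where "unit_indicator W \<in> B" "x \<in> W" "y \<notin> W"
proof -
  have "closedin (arrow_top G) {y}"
    using compact_closed [of "{y}"] assms(2) by simp
  then have "openin (arrow_top G) (units G - {y})" by (rule openin_diff [OF G.openin_units])
  then obtain W where "x \<in> W" "W \<subseteq> units G - {y}" "openin (arrow_top G) W" "compactin (arrow_top G) W"
    using G.compact_open_bisection_base [of "units G - {y}" x] assms(1,3) by blast
  then show thesis using that unit_indicator_diagonal [of W] by blast
qed

lemma diagonal_algebra [simp, intro]: "b \<in> B \<Longrightarrow> b \<in> A"
  and diagonal_support: "b \<in> B \<Longrightarrow> q ` supp b \<subseteq> units G"
  by (simp_all add: diagonal_iff)

lemma diagonal_conv_apply:
  "b \<in> B \<Longrightarrow> f \<in> A \<Longrightarrow> \<sigma> \<in> arrows \<Sigma> \<Longrightarrow> (b \<star> f) \<sigma> = b (rng \<Sigma> \<sigma>) * f \<sigma>"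
  by (rule diagonal_conv) (simp_all add: diagonal_support)

lemma conv_diagonal_apply:
  "b \<in> B \<Longrightarrow> f \<in> A \<Longrightarrow> \<sigma> \<in> arrows \<Sigma> \<Longrightarrow> (f \<star> b) \<sigma> = f \<sigma> * b (src \<Sigma> \<sigma>)"
  by (rule conv_diagonal) (simp_all add: diagonal_support)

lemma algebra_ext:
  assumes "f \<in> A" "g \<in> A" "\<And>\<sigma>. \<sigma> \<in> arrows \<Sigma> \<Longrightarrow> f \<sigma> = g \<sigma>"
  shows "f = g"
proof
  fix \<sigma> show "f \<sigma> = g \<sigma>"
    using assms(3) equivariant_outside [OF algebra_equivariant [OF assms(1)], of \<sigma>]
      equivariant_outside [OF algebra_equivariant [OF assms(2)], of \<sigma>]
    by (cases "\<sigma> \<in> arrows \<Sigma>") auto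
qed

lemma isotropy_commutes_diagonal:
  assumes b: "b \<in> B" and f: "f \<in> A" "q ` supp f \<subseteq> isotropy G"
  shows "f \<star> b = b \<star> f"
proof (rule algebra_ext)
  fix \<sigma> assume \<sigma>: "\<sigma> \<in> arrows \<Sigma>"
  have "f \<sigma> * b (src \<Sigma> \<sigma>) = b (rng \<Sigma> \<sigma>) * f \<sigma>"
  proof (cases "f \<sigma> = 0")
    case False
    then have "q \<sigma> \<in> isotropy G" using f(2) by (auto simp: supp_def)
    then have "rng \<Sigma> \<sigma> = src \<Sigma> \<sigma>" using \<sigma> by (simp add: isotropy_def rng_eq_i src_eq_i)
    then show ?thesis by (simp add: mult.commute)
  qed simp
  then show "(f \<star> b) \<sigma> = (b \<star> f) \<sigma>"
    using conv_diagonal_apply [OF b f(1) \<sigma>] diagonal_conv_apply [OF b f(1) \<sigma>] by simp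
qed (use b f in simp_all)

lemma diagonal_commute: "b \<in> B \<Longrightarrow> c \<in> B \<Longrightarrow> b \<star> c = c \<star> b"
  using isotropy_commutes_diagonal diagonal_support G.units_subset by blast

lemma A_conv_assoc [simp]: "f \<in> A \<Longrightarrow> g \<in> A \<Longrightarrow> h \<in> A \<Longrightarrow> (f \<star> g) \<star> h = f \<star> (g \<star> h)"
  by (intro conv_assoc algebra_equivariant)

text \<open>Elements of \<open>A\<close> have local units in \<open>B\<close>: the indicator of the source of the support.\<close>

lemma diagonal_local_unit:
  assumes f: "f \<in> A"
  obtains b where "b \<in> B" "f \<star> b = f"
proof -
  let ?W = "src G ` q ` supp f"
  have "openin (arrow_top G) ?W" "?W \<subseteq> units G"
    using G.open_src [OF q_supp_open [OF f]] by (auto simp: G.openin_unit_top)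
  moreover have "compactin (arrow_top G) ?W"
    by (rule image_compactin [OF algebraD(4) [OF f] G.continuous_src])
  ultimately have b: "unit_indicator ?W \<in> B" by (intro unit_indicator_diagonal)
  have "f \<star> unit_indicator ?W = f"
  proof (rule algebra_ext)
    fix \<sigma> assume \<sigma>: "\<sigma> \<in> arrows \<Sigma>"
    have "f \<sigma> * unit_indicator ?W (src \<Sigma> \<sigma>) = f \<sigma>"
    proof (cases "f \<sigma> = 0")
      case False
      then have "src G (q \<sigma>) \<in> ?W" by (simp add: supp_def)
      then show ?thesis using \<sigma> by (simp add: unit_indicator_unit)
    qed simp
    then show "(f \<star> unit_indicator ?W) \<sigma> = f \<sigma>" using conv_diagonal_apply [OF b f \<sigma>] by simp
  qed (use b f in simp_all)
  with b show thesis by (rule that)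
qed

text \<open>The product is supported on arrows \<open>\<beta> \<delta>\<inverse>\<close> with \<open>\<beta>, \<delta> \<in> D\<close> of the same source.\<close>

lemma conjugate_diagonal:
  assumes f: "f \<in> A" "q ` supp f \<subseteq> D" and g: "g \<in> A" "q ` supp g \<subseteq> ginv G ` D"
    and D: "D \<subseteq> arrows G" "inj_on (src G) D" and b: "b \<in> B"
  shows "(f \<star> b) \<star> g \<in> B"
  unfolding diagonal_iff
proof
  show "(f \<star> b) \<star> g \<in> A" using f g b by simp
  show "q ` supp ((f \<star> b) \<star> g) \<subseteq> units G"
  proof
    fix \<alpha> assume "\<alpha> \<in> q ` supp ((f \<star> b) \<star> g)"
    then obtain \<sigma> where \<sigma>: "((f \<star> b) \<star> g) \<sigma> \<noteq> 0" "\<alpha> = q \<sigma>" unfolding supp_def by blast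
    have E: "f \<star> b \<in> equivariant_functions" "g \<in> equivariant_functions" using f g b by simp_all
    obtain \<beta> \<gamma> where *: "\<beta> \<in> q ` supp (f \<star> b)" "\<gamma> \<in> q ` supp g" "src G \<beta> = rng G \<gamma>"
      "q \<sigma> = gmult G \<beta> \<gamma>" by (rule supp_convE [OF E \<sigma>(1)])
    have "\<beta> \<in> D"
    proof -
      obtain \<tau> where \<tau>: "(f \<star> b) \<tau> \<noteq> 0" "\<beta> = q \<tau>" using *(1) unfolding supp_def by blast
      then have "\<tau> \<in> arrows \<Sigma>" using conv_outside by blast
      then have "f \<tau> \<noteq> 0" using conv_diagonal_apply [OF b f(1)] \<tau>(1) by auto
      then show ?thesis using f(2) \<tau>(2) by (auto simp: supp_def)
    qed
    moreover obtain \<delta> where \<delta>: "\<delta> \<in> D" "\<gamma> = ginv G \<delta>" using *(2) g(2) by blast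
    moreover have "\<beta> \<in> arrows G" "\<delta> \<in> arrows G" using calculation D(1) by blast+
    ultimately have "\<beta> = \<delta>" using *(3) by - (rule inj_onD [OF D(2)], simp_all)
    then show "\<alpha> \<in> units G" using \<sigma>(2) *(4) \<delta> \<open>\<delta> \<in> arrows G\<close> by simp
  qed
qed

text \<open>If \<open>m\<close> belongs to a section over a bisection and \<open>m'\<close> to the inverse section, then
  \<open>m \<star> m'\<close> is the indicator of the range of the bisection.\<close>

lemma section_inverse_products:
  assumes D: "compact_open_section D P" "inj_on (rng G) D" "inj_on (src G) D"
  defines "m \<equiv> section_function D P"
    and "m' \<equiv> section_function (ginv G ` D) (inverse_section P)"
  shows "m \<star> m' \<in> B" "(m \<star> m') \<star> m = m" "m' \<star> (m \<star> m') = m'"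
proof -
  note D' = compact_open_sectionD [OF D(1)]
  note I = compact_open_inverse_section [OF D(1)]
  have m: "m \<in> A" "q ` supp m \<subseteq> D" and m': "m' \<in> A" "q ` supp m' \<subseteq> ginv G ` D"
    unfolding m_def m'_def
    by (rule section_function_in_algebra [OF D(1)] section_function_support
        section_function_in_algebra [OF I])+
  obtain b where b: "b \<in> B" "m \<star> b = m" using diagonal_local_unit [OF m(1)] .
  show c: "m \<star> m' \<in> B"
    using conjugate_diagonal [OF m m' D'(6) D(3) b(1)] unfolding b(2) .
  have val: "(m \<star> m') (rng \<Sigma> (P \<beta>)) = 1" if \<beta>: "\<beta> \<in> D" for \<beta>
  proof -
    have "(m \<star> m') (rng \<Sigma> (P \<beta>)) = m' (gmult \<Sigma> (ginv \<Sigma> (P \<beta>)) (rng \<Sigma> (P \<beta>)))"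
      unfolding m_def
      by (rule section_conv [OF D(1,2) algebra_equivariant [OF m'(1)] _ \<beta>])
         (use D'(4-6) \<beta> in \<open>simp_all add: subset_iff\<close>)
    also have "gmult \<Sigma> (ginv \<Sigma> (P \<beta>)) (rng \<Sigma> (P \<beta>)) = ginv \<Sigma> (P \<beta>)"
      using D'(5) [OF \<beta>] \<Sigma>.src_mult_right [of "ginv \<Sigma> (P \<beta>)"] by simp
    also have "\<dots> = inverse_section P (ginv G \<beta>)"
      using D'(6) \<beta> unfolding inverse_section_def by (subst G.inv_inv) auto
    also have "m' \<dots> = 1"
      unfolding m'_def using \<beta> by (intro section_function_on_section [OF I]) blast
    finally show ?thesis .
  qed
  show "(m \<star> m') \<star> m = m"
  proof (rule algebra_ext)
    fix \<sigma> assume \<sigma>: "\<sigma> \<in> arrows \<Sigma>"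
    have "(m \<star> m') (rng \<Sigma> \<sigma>) * m \<sigma> = m \<sigma>"
    proof (cases "m \<sigma> = 0")
      case False
      then have q: "q \<sigma> \<in> D" using m(2) by (auto simp: supp_def)
      then have "rng \<Sigma> \<sigma> = rng \<Sigma> (P (q \<sigma>))"
        using composable_iff(2) [OF \<sigma> D'(5)] D'(4) by simp
      then show ?thesis using val [OF q] by simp
    qed simp
    then show "((m \<star> m') \<star> m) \<sigma> = m \<sigma>" using diagonal_conv_apply [OF c m(1) \<sigma>] by simp
  qed (use m m' in simp_all)
  show "m' \<star> (m \<star> m') = m'"
  proof (rule algebra_ext)
    fix \<sigma> assume \<sigma>: "\<sigma> \<in> arrows \<Sigma>"
    have "m' \<sigma> * (m \<star> m') (src \<Sigma> \<sigma>) = m' \<sigma>"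
    proof (cases "m' \<sigma> = 0")
      case False
      then have "q \<sigma> \<in> ginv G ` D" using m'(2) by (auto simp: supp_def)
      then obtain \<beta> where \<beta>: "\<beta> \<in> D" "q \<sigma> = ginv G \<beta>" by blast
      then have "src \<Sigma> \<sigma> = rng \<Sigma> (P \<beta>)"
        using composable_iff(1) [OF \<sigma> D'(5) [OF \<beta>(1)]] D'(4,6) by (simp add: subset_iff)
      then show ?thesis using val [OF \<beta>(1)] by simp
    qed simp
    then show "(m' \<star> (m \<star> m')) \<sigma> = m' \<sigma>" using conv_diagonal_apply [OF c m'(1) \<sigma>] by simp
  qed (use m m' in simp_all)
qed

end

section \<open>Normalisers of the diagonal subalgebra\<close>

lemma normaliser_cong:
  assumes "\<And>f g. f \<in> C \<Longrightarrow> g \<in> C \<Longrightarrow> mul f g \<in> C \<and> mul' f g = mul f g" "B \<subseteq> C"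
  shows "normaliser mul' C B = normaliser mul C B"
proof -
  have b: "b \<in> C" if "b \<in> B" for b using assms(2) that by blast
  have "mul' (mul' f g) h = mul (mul f g) h" if "f \<in> C" "g \<in> C" "h \<in> C" for f g h
    using assms(1) that by simp
  then show ?thesis unfolding normaliser_def using b by (intro Collect_cong) (simp cong: conj_cong bex_cong)
qed

context hausdorff_ample_twist
begin

definition partial_inverses :: "('s \<Rightarrow> 'r) \<Rightarrow> ('s \<Rightarrow> 'r) \<Rightarrow> bool" where
  "partial_inverses n k \<longleftrightarrow> n \<in> A \<and> k \<in> A \<and> (k \<star> n) \<star> k = k \<and> (n \<star> k) \<star> n = n \<and>
     (\<forall>b\<in>B. (k \<star> b) \<star> n \<in> B \<and> (n \<star> b) \<star> k \<in> B)"

lemma normaliser_iff: "n \<in> normaliser (\<star>) A B \<longleftrightarrow> (\<exists>k. partial_inverses n k)"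
  unfolding normaliser_def partial_inverses_def by blast

lemma partial_inversesD:
  assumes "partial_inverses n k"
  shows "n \<in> A" "k \<in> A" "n \<star> (k \<star> n) = n" "k \<star> (n \<star> k) = k"
    "\<And>b. b \<in> B \<Longrightarrow> k \<star> (b \<star> n) \<in> B" "\<And>b. b \<in> B \<Longrightarrow> n \<star> (b \<star> k) \<in> B"
    "k \<star> n \<in> B" "n \<star> k \<in> B"
proof -
  show A: "n \<in> A" "k \<in> A" using assms unfolding partial_inverses_def by blast+
  have n: "(n \<star> k) \<star> n = n" and k: "(k \<star> n) \<star> k = k"
    and b: "\<And>b. b \<in> B \<Longrightarrow> (k \<star> b) \<star> n \<in> B" "\<And>b. b \<in> B \<Longrightarrow> (n \<star> b) \<star> k \<in> B"
    using assms unfolding partial_inverses_def by blast+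
  show "n \<star> (k \<star> n) = n" "k \<star> (n \<star> k) = k" using n k A by simp_all
  show "k \<star> (b \<star> n) \<in> B" "n \<star> (b \<star> k) \<in> B" if "b \<in> B" for b
    using b [OF that] A diagonal_algebra [OF that] by simp_all
  obtain d where "d \<in> B" "k \<star> d = k" using diagonal_local_unit [OF A(2)] .
  then show "k \<star> n \<in> B" using b(1) [of d] by simp
  obtain e where "e \<in> B" "n \<star> e = n" using diagonal_local_unit [OF A(1)] .
  then show "n \<star> k \<in> B" using b(2) [of e] by simp
qed

text \<open>Evaluating \<open>k b = b k\<close> at \<open>\<sigma>\<close> for an indicator \<open>b\<close> that is \<open>1\<close> at the range of
  \<open>\<sigma>\<close> and \<open>0\<close> at its source gives \<open>k(\<sigma>) = 0\<close>.\<close>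

lemma commutes_imp_isotropy:
  assumes k: "k \<in> A" and comm: "\<And>b. b \<in> B \<Longrightarrow> k \<star> b = b \<star> k"
  shows "q ` supp k \<subseteq> isotropy G"
proof
  fix \<alpha> assume "\<alpha> \<in> q ` supp k"
  then obtain \<sigma> where \<sigma>: "k \<sigma> \<noteq> 0" "\<alpha> = q \<sigma>" unfolding supp_def by blast
  have \<sigma>': "\<sigma> \<in> arrows \<Sigma>" using \<sigma>(1) equivariant_outside [OF algebra_equivariant [OF k]] by blast
  have "rng G \<alpha> = src G \<alpha>"
  proof (rule ccontr)
    assume ne: "rng G \<alpha> \<noteq> src G \<alpha>"
    obtain W where W: "unit_indicator W \<in> B" "rng G \<alpha> \<in> W" "src G \<alpha> \<notin> W"
      by (rule separating_indicator [OF _ _ ne]) (use \<sigma>(2) \<sigma>' in simp_all)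
    have "(k \<star> unit_indicator W) \<sigma> = 0"
      using conv_diagonal_apply [OF W(1) k \<sigma>'] W(3) \<sigma>(2) \<sigma>' by (simp add: unit_indicator_unit)
    moreover have "(unit_indicator W \<star> k) \<sigma> = k \<sigma>"
      using diagonal_conv_apply [OF W(1) k \<sigma>'] W(2) \<sigma>(2) \<sigma>' by (simp add: unit_indicator_unit)
    ultimately show False using comm [OF W(1)] \<sigma>(1) by simp
  qed
  then show "\<alpha> \<in> isotropy G" using \<sigma>(2) \<sigma>' by (simp add: isotropy_def)
qed

text \<open>If \<open>n\<close> is supported on the isotropy then it commutes with \<open>B\<close>. As \<open>k \<star> n\<close> and
  \<open>n \<star> k\<close> lie in the commutative algebra \<open>B\<close>, this passes to the partial inverse:
  \<open>k b = k (n k) b = k b (n k) = k n b k = b (k n) k = b k\<close>.\<close>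

lemma partial_inverse_isotropy:
  assumes nk: "partial_inverses n k" and iso: "q ` supp n \<subseteq> isotropy G"
  shows "q ` supp k \<subseteq> isotropy G"
proof (rule commutes_imp_isotropy)
  note N = partial_inversesD [OF nk]
  show "k \<in> A" by (rule N(2))
  fix b assume b: "b \<in> B"
  have b': "b \<in> A" using b by simp
  have "k \<star> b = (k \<star> (n \<star> k)) \<star> b" using N(4) by simp
  also have "\<dots> = k \<star> ((n \<star> k) \<star> b)" using N(1,2) b' by simp
  also have "\<dots> = k \<star> (b \<star> (n \<star> k))" using diagonal_commute [OF N(8) b] by simp
  also have "\<dots> = k \<star> ((b \<star> n) \<star> k)" using N b' by simp
  also have "b \<star> n = n \<star> b" using isotropy_commutes_diagonal [OF b N(1) iso] by simp
  also have "k \<star> ((n \<star> b) \<star> k) = ((k \<star> n) \<star> b) \<star> k" using N b' by simp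
  also have "(k \<star> n) \<star> b = b \<star> (k \<star> n)" by (rule diagonal_commute [OF N(7) b])
  also have "(b \<star> (k \<star> n)) \<star> k = b \<star> k" using N b' by simp
  finally show "k \<star> b = b \<star> k" .
qed

lemma idempotent_diagonal_values:
  assumes R: "indecomposable_ring TYPE('r)" and c: "c \<in> B" "c \<star> c = c" and u: "u \<in> units \<Sigma>"
  shows "c u = 0 \<or> c u = 1"
proof -
  have "c u * c u = c u"
    using diagonal_conv_apply [OF c(1) diagonal_algebra [OF c(1)] \<Sigma>.unit_simps(1) [OF u]] c(2) u
    by simp
  then show ?thesis using R unfolding indecomposable_ring_def by blast
qed

text \<open>For an idempotent \<open>b \<in> B\<close>, conjugation gives idempotents \<open>c = k b n\<close> and
  \<open>d = n b k\<close> of \<open>B\<close> with \<open>b n = n c\<close> and \<open>d n = n b\<close>. Indecomposability of the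
  coefficient ring makes their values \<open>0\<close> or \<open>1\<close>. Choosing for \<open>b\<close> an indicator that
  separates two units, one sees that on the support of \<open>n\<close> range and source determine each
  other.\<close>

lemma normaliser_rng_eq_iff_src_eq:
  assumes R: "indecomposable_ring TYPE('r)" and nk: "partial_inverses n k"
    and \<alpha>: "\<alpha> \<in> q ` supp n" and \<beta>: "\<beta> \<in> q ` supp n"
  shows "rng G \<alpha> = rng G \<beta> \<longleftrightarrow> src G \<alpha> = src G \<beta>"
proof -
  note N = partial_inversesD [OF nk]
  obtain \<sigma> \<tau> where *: "n \<sigma> \<noteq> 0" "\<alpha> = q \<sigma>" "n \<tau> \<noteq> 0" "\<beta> = q \<tau>"
    using \<alpha> \<beta> unfolding supp_def by blast
  have \<sigma>: "\<sigma> \<in> arrows \<Sigma>" and \<tau>: "\<tau> \<in> arrows \<Sigma>"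
    using * equivariant_outside [OF algebra_equivariant [OF N(1)]] by blast+
  have idem: "unit_indicator W \<star> unit_indicator W = unit_indicator W" if W: "unit_indicator W \<in> B" for W
  proof (rule algebra_ext)
    fix \<rho> assume \<rho>: "\<rho> \<in> arrows \<Sigma>"
    show "(unit_indicator W \<star> unit_indicator W) \<rho> = unit_indicator W \<rho>"
    proof (cases "unit_indicator W \<rho> = 0")
      case False
      then have "q \<rho> \<in> W" unfolding unit_indicator_def section_function_def by presburger
      moreover have "q \<rho> \<in> units G" using False diagonal_support [OF W] by (auto simp: supp_def)
      ultimately have "rng G (q \<rho>) \<in> W" by simp
      then show ?thesis using diagonal_conv_apply [OF W diagonal_algebra [OF W] \<rho>] \<rho>
        by (simp add: unit_indicator_unit)
    qed (use diagonal_conv_apply [OF W diagonal_algebra [OF W] \<rho>] in simp)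
  qed (use W in simp_all)
  have "src G \<alpha> = src G \<beta>" if r: "rng G \<alpha> = rng G \<beta>"
  proof (rule ccontr)
    assume ne: "src G \<alpha> \<noteq> src G \<beta>"
    obtain W where W: "unit_indicator W \<in> B" "src G \<alpha> \<in> W" "src G \<beta> \<notin> W"
      by (rule separating_indicator [OF _ _ ne]) (use * \<sigma> \<tau> in simp_all)
    let ?b = "unit_indicator W"
    let ?d = "n \<star> (?b \<star> k)"
    have b: "?b \<in> A" and d: "?d \<in> B" using W(1) N(6) by auto
    have dn: "?d \<star> n = n \<star> ?b"
    proof -
      have "?d \<star> n = n \<star> (?b \<star> (k \<star> n))" using N b by simp
      also have "?b \<star> (k \<star> n) = (k \<star> n) \<star> ?b" by (rule diagonal_commute [OF W(1) N(7)])
      also have "n \<star> ((k \<star> n) \<star> ?b) = (n \<star> (k \<star> n)) \<star> ?b" using N(1,2) b by simp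
      finally show ?thesis using N(3) by simp
    qed
    have "?d \<star> ?d = (?d \<star> n) \<star> (?b \<star> k)" using N b by simp
    also have "\<dots> = n \<star> ((?b \<star> ?b) \<star> k)" unfolding dn using N b by simp
    finally have dd: "?d \<star> ?d = ?d" using idem [OF W(1)] by simp
    have v: "?d (rng \<Sigma> \<rho>) * n \<rho> = n \<rho> * ?b (src \<Sigma> \<rho>)" if "\<rho> \<in> arrows \<Sigma>" for \<rho>
      using dn diagonal_conv_apply [OF d N(1) that] conv_diagonal_apply [OF W(1) N(1) that] by simp
    have "?d (rng \<Sigma> \<sigma>) * n \<sigma> = n \<sigma>" using v [OF \<sigma>] W(2) *(2) \<sigma> by (simp add: unit_indicator_unit)
    then have "?d (rng \<Sigma> \<sigma>) \<noteq> 0" using *(1) by auto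
    then have "?d (rng \<Sigma> \<sigma>) = 1" using idempotent_diagonal_values [OF R d dd \<Sigma>.rng_in_units [OF \<sigma>]] by blast
    moreover have "rng \<Sigma> \<tau> = rng \<Sigma> \<sigma>" using composable_iff(2) [OF \<tau> \<sigma>] r * by simp
    ultimately have "n \<tau> = 0" using v [OF \<tau>] W(3) *(4) \<tau> by (simp add: unit_indicator_unit)
    with *(3) show False ..
  qed
  moreover have "rng G \<alpha> = rng G \<beta>" if s: "src G \<alpha> = src G \<beta>"
  proof (rule ccontr)
    assume ne: "rng G \<alpha> \<noteq> rng G \<beta>"
    obtain W where W: "unit_indicator W \<in> B" "rng G \<alpha> \<in> W" "rng G \<beta> \<notin> W"
      by (rule separating_indicator [OF _ _ ne]) (use * \<sigma> \<tau> in simp_all)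
    let ?b = "unit_indicator W"
    let ?c = "k \<star> (?b \<star> n)"
    have b: "?b \<in> A" and c: "?c \<in> B" using W(1) N(5) by auto
    have nc: "n \<star> ?c = ?b \<star> n"
    proof -
      have "n \<star> ?c = ((n \<star> k) \<star> ?b) \<star> n" using N b by simp
      also have "(n \<star> k) \<star> ?b = ?b \<star> (n \<star> k)" by (rule diagonal_commute [OF N(8) W(1)])
      also have "(?b \<star> (n \<star> k)) \<star> n = ?b \<star> (n \<star> (k \<star> n))" using N(1,2) b by simp
      finally show ?thesis using N(3) by simp
    qed
    have "?c \<star> ?c = k \<star> (?b \<star> (n \<star> ?c))" using N b by simp
    also have "\<dots> = k \<star> ((?b \<star> ?b) \<star> n)" unfolding nc using N b by simp
    finally have cc: "?c \<star> ?c = ?c" using idem [OF W(1)] by simp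
    have v: "?b (rng \<Sigma> \<rho>) * n \<rho> = n \<rho> * ?c (src \<Sigma> \<rho>)" if "\<rho> \<in> arrows \<Sigma>" for \<rho>
      using nc diagonal_conv_apply [OF W(1) N(1) that] conv_diagonal_apply [OF c N(1) that] by simp
    have "n \<sigma> * ?c (src \<Sigma> \<sigma>) = n \<sigma>" using v [OF \<sigma>] W(2) *(2) \<sigma> by (simp add: unit_indicator_unit)
    then have "?c (src \<Sigma> \<sigma>) \<noteq> 0" using *(1) by auto
    then have "?c (src \<Sigma> \<sigma>) = 1" using idempotent_diagonal_values [OF R c cc \<Sigma>.src_in_units [OF \<sigma>]] by blast
    moreover have "src \<Sigma> \<tau> = src \<Sigma> \<sigma>" using composable_iff(3) [OF \<tau> \<sigma>] s * by simp
    ultimately have "n \<tau> = 0" using v [OF \<tau>] W(3) *(4) \<tau> by (simp add: unit_indicator_unit)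
    with *(3) show False ..
  qed
  ultimately show ?thesis by blast
qed

text \<open>Multiplying by the function \<open>m'\<close> of a section translates the support of a normaliser. The
  result is again a normaliser because \<open>m \<star> m'\<close> is in \<open>B\<close> and so commutes with
  \<open>n \<star> k\<close>.\<close>

lemma partial_inverses_translate:
  assumes nk: "partial_inverses n k"
    and m: "m \<in> A" "m' \<in> A" "m \<star> m' \<in> B" "(m \<star> m') \<star> m = m" "m' \<star> (m \<star> m') = m'"
    and conj: "\<And>b. b \<in> B \<Longrightarrow> (m \<star> b) \<star> m' \<in> B" "\<And>b. b \<in> B \<Longrightarrow> (m' \<star> b) \<star> m \<in> B"
  shows "partial_inverses (m' \<star> n) (k \<star> m)"
  unfolding partial_inverses_def
proof (intro conjI ballI)
  note N = partial_inversesD [OF nk]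
  note c = diagonal_commute [OF m(3) N(8)]
  let ?c = "m \<star> m'"
  show "m' \<star> n \<in> A" "k \<star> m \<in> A" using N m by simp_all
  have "((k \<star> m) \<star> (m' \<star> n)) \<star> (k \<star> m) = k \<star> ((?c \<star> (n \<star> k)) \<star> m)" using N(1,2) m(1,2) by simp
  also have "\<dots> = (k \<star> (n \<star> k)) \<star> (?c \<star> m)" unfolding c using N(1,2) m(1,2) by simp
  finally show "((k \<star> m) \<star> (m' \<star> n)) \<star> (k \<star> m) = k \<star> m" using N(4) m(4) by simp
  have "((m' \<star> n) \<star> (k \<star> m)) \<star> (m' \<star> n) = m' \<star> (((n \<star> k) \<star> ?c) \<star> n)" using N(1,2) m(1,2) by simp
  also have "\<dots> = (m' \<star> ?c) \<star> (n \<star> (k \<star> n))"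
    unfolding c [symmetric] using N(1,2) m(1,2) by simp
  finally show "((m' \<star> n) \<star> (k \<star> m)) \<star> (m' \<star> n) = m' \<star> n" using N(3) m(5) by simp
  fix b assume b: "b \<in> B"
  have "((k \<star> m) \<star> b) \<star> (m' \<star> n) = k \<star> (((m \<star> b) \<star> m') \<star> n)" using N(1,2) m(1,2) b by simp
  then show "((k \<star> m) \<star> b) \<star> (m' \<star> n) \<in> B" using N(5) [OF conj(1) [OF b]] by simp
  have "((m' \<star> n) \<star> b) \<star> (k \<star> m) = (m' \<star> (n \<star> (b \<star> k))) \<star> m" using N(1,2) m(1,2) b by simp
  then show "((m' \<star> n) \<star> b) \<star> (k \<star> m) \<in> B" using conj(2) [OF N(6) [OF b]] by simp
qed


section \<open>The interior of the isotropy\<close>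

definition isotropy_algebra :: "('s \<Rightarrow> 'r) set" where
  "isotropy_algebra = {f \<in> A. q ` supp f \<subseteq> isotropy G}"

text \<open>Supports of elements of \<open>A\<close> are open in \<open>G\<close>, so they lie in the isotropy iff they lie in
  its interior.\<close>

lemma isotropy_algebra_interior:
  "isotropy_algebra = {f \<in> A. q ` supp f \<subseteq> arrow_top G interior_of isotropy G}"
proof -
  have "q ` supp f \<subseteq> arrow_top G interior_of isotropy G \<longleftrightarrow> q ` supp f \<subseteq> isotropy G" if "f \<in> A" for f
    using interior_of_maximal [OF _ q_supp_open [OF that]] interior_of_subset [of "arrow_top G" "isotropy G"]
    by blast
  then show ?thesis unfolding isotropy_algebra_def by blast
qed

lemma diagonal_subset_isotropy_algebra: "B \<subseteq> isotropy_algebra"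
  using diagonal_support G.units_subset unfolding isotropy_algebra_def by blast

lemma isotropy_algebra_conv:
  assumes "f \<in> isotropy_algebra" "g \<in> isotropy_algebra"
  shows "f \<star> g \<in> isotropy_algebra"
proof -
  have A: "f \<in> A" "g \<in> A" and iso: "q ` supp f \<subseteq> isotropy G" "q ` supp g \<subseteq> isotropy G"
    using assms unfolding isotropy_algebra_def by blast+
  have "q ` supp (f \<star> g) \<subseteq> isotropy G"
  proof
    fix \<alpha> assume "\<alpha> \<in> q ` supp (f \<star> g)"
    then obtain \<sigma> where \<sigma>: "(f \<star> g) \<sigma> \<noteq> 0" "\<alpha> = q \<sigma>" unfolding supp_def by blast
    obtain \<beta> \<gamma> where *: "\<beta> \<in> q ` supp f" "\<gamma> \<in> q ` supp g" "src G \<beta> = rng G \<gamma>" "q \<sigma> = gmult G \<beta> \<gamma>"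
      by (rule supp_convE [OF algebra_equivariant [OF A(1)] algebra_equivariant [OF A(2)] \<sigma>(1)])
    have "\<beta> \<in> isotropy G" "\<gamma> \<in> isotropy G" using * iso by blast+
    then show "\<alpha> \<in> isotropy G" using *(3,4) \<sigma>(2) by (simp add: isotropy_def)
  qed
  then show ?thesis using A unfolding isotropy_algebra_def by simp
qed

theorem normaliser_isotropy_algebra:
  "normaliser (\<star>) isotropy_algebra B = normaliser (\<star>) A B \<inter> isotropy_algebra"
proof (intro equalityI subsetI)
  fix n assume "n \<in> normaliser (\<star>) isotropy_algebra B"
  then show "n \<in> normaliser (\<star>) A B \<inter> isotropy_algebra"
    unfolding normaliser_def isotropy_algebra_def by blast
next
  fix n assume n: "n \<in> normaliser (\<star>) A B \<inter> isotropy_algebra"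
  then obtain k where nk: "partial_inverses n k" using normaliser_iff by blast
  have "k \<in> isotropy_algebra"
    using partial_inverse_isotropy [OF nk] partial_inversesD(2) [OF nk] n
    unfolding isotropy_algebra_def by blast
  then show "n \<in> normaliser (\<star>) isotropy_algebra B"
    using n nk unfolding normaliser_def partial_inverses_def by blast
qed

text \<open>Let \<open>\<alpha>\<close> and \<open>\<beta>\<close> be in the support of the normaliser \<open>n\<close> with the same source, and
  \<open>m'\<close> the function of a section inverse to one through \<open>\<alpha>\<close>. Then \<open>m' \<star> n\<close> is a normaliser
  supported on the isotropy whose support contains \<open>\<alpha>\<inverse> \<alpha>\<close> and \<open>\<alpha>\<inverse> \<beta>\<close>. If its
  support is a bisection, these two arrows with the same source agree.\<close>

lemma bisection_from_isotropy:
  assumes R: "indecomposable_ring TYPE('r)" and nk: "partial_inverses n k"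
    and iso: "\<And>f. f \<in> normaliser (\<star>) isotropy_algebra B \<Longrightarrow> inj_on (src G) (q ` supp f)"
  shows "bisection G (q ` supp n)"
proof (rule G.bisectionI)
  note N = partial_inversesD [OF nk]
  note rs = normaliser_rng_eq_iff_src_eq [OF R nk]
  show open_supp: "openin (arrow_top G) (q ` supp n)" by (rule q_supp_open [OF N(1)])
  have S: "q ` supp n \<subseteq> arrows G" by (rule q_supp_subset [OF algebra_equivariant [OF N(1)]])
  have eq: "\<alpha> = \<beta>" if \<alpha>: "\<alpha> \<in> q ` supp n" and \<beta>: "\<beta> \<in> q ` supp n" and s: "src G \<alpha> = src G \<beta>" for \<alpha> \<beta>
  proof -
    obtain D P where D: "\<alpha> \<in> D" "D \<subseteq> q ` supp n" "compact_open_section D P"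
      "inj_on (rng G) D" "inj_on (src G) D" by (rule local_section [OF open_supp \<alpha>])
    note D' = compact_open_sectionD [OF D(3)]
    note I = compact_open_inverse_section [OF D(3)]
    define m where "m = section_function D P"
    define m' where "m' = section_function (ginv G ` D) (inverse_section P)"
    have m: "m \<in> A" "q ` supp m \<subseteq> D" and m': "m' \<in> A" "q ` supp m' \<subseteq> ginv G ` D"
      unfolding m_def m'_def
      by (rule section_function_in_algebra [OF D(3)] section_function_support
          section_function_in_algebra [OF I])+
    have inv: "ginv G ` D \<subseteq> arrows G" "ginv G ` ginv G ` D = D"
      using D'(6) by (auto simp: subset_iff image_iff)
    have inj': "inj_on (src G) (ginv G ` D)" "inj_on (rng G) (ginv G ` D)"
      using D(4,5) D'(6) unfolding inj_on_def by (simp_all add: subset_iff) metis+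
    have pi: "partial_inverses (m' \<star> n) (k \<star> m)"
    proof (rule partial_inverses_translate [OF nk m(1) m'(1)])
      show "m \<star> m' \<in> B" "(m \<star> m') \<star> m = m" "m' \<star> (m \<star> m') = m'"
        unfolding m_def m'_def by (rule section_inverse_products [OF D(3-5)])+
      show "(m \<star> b) \<star> m' \<in> B" if "b \<in> B" for b
        by (rule conjugate_diagonal [OF m m' D'(6) D(5) that])
      show "(m' \<star> b) \<star> m \<in> B" if "b \<in> B" for b
        by (rule conjugate_diagonal [OF m' m(1) _ inv(1) inj'(1) that]) (use m(2) inv(2) in simp)
    qed
    have "q ` supp (m' \<star> n) \<subseteq> isotropy G"
    proof
      fix \<eta> assume "\<eta> \<in> q ` supp (m' \<star> n)"
      then obtain \<sigma> where \<sigma>: "(m' \<star> n) \<sigma> \<noteq> 0" "\<eta> = q \<sigma>" unfolding supp_def by blast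
      obtain \<delta>' \<gamma> where *: "\<delta>' \<in> q ` supp m'" "\<gamma> \<in> q ` supp n" "src G \<delta>' = rng G \<gamma>"
        "q \<sigma> = gmult G \<delta>' \<gamma>"
        by (rule supp_convE [OF algebra_equivariant [OF m'(1)] algebra_equivariant [OF N(1)] \<sigma>(1)])
      obtain \<delta> where \<delta>: "\<delta> \<in> D" "\<delta>' = ginv G \<delta>" using *(1) m'(2) by blast
      have ar: "\<delta> \<in> arrows G" "\<gamma> \<in> arrows G" "\<delta> \<in> q ` supp n" using \<delta>(1) D'(6) D(2) *(2) S by blast+
      have r: "rng G \<delta> = rng G \<gamma>" using *(3) \<delta>(2) ar by simp
      then have "src G \<delta> = src G \<gamma>" using rs [OF ar(3) *(2)] by simp
      then show "\<eta> \<in> isotropy G" using *(4) \<sigma>(2) \<delta>(2) ar r by (simp add: isotropy_def)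
    qed
    then have "m' \<star> n \<in> normaliser (\<star>) A B \<inter> isotropy_algebra"
      using pi normaliser_iff N(1) m'(1) unfolding isotropy_algebra_def by auto
    then have inj: "inj_on (src G) (q ` supp (m' \<star> n))"
      using iso unfolding normaliser_isotropy_algebra by blast
    have \<alpha>': "\<alpha> \<in> arrows G" using \<alpha> S by blast
    have mem: "gmult G (ginv G \<alpha>) \<gamma> \<in> q ` supp (m' \<star> n)"
      if \<gamma>: "\<gamma> \<in> q ` supp n" "src G \<gamma> = src G \<alpha>" for \<gamma>
    proof -
      have r: "rng G \<gamma> = rng G \<alpha>" using rs [OF \<gamma>(1) \<alpha>] \<gamma>(2) by simp
      obtain \<tau> where \<tau>: "n \<tau> \<noteq> 0" "\<gamma> = q \<tau>" using \<gamma>(1) unfolding supp_def by blast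
      have \<tau>': "\<tau> \<in> arrows \<Sigma>" using \<tau>(1) equivariant_outside [OF algebra_equivariant [OF N(1)]] by blast
      have P: "P \<alpha> \<in> arrows \<Sigma>" "q (P \<alpha>) = \<alpha>" using D'(4,5) D(1) by simp_all
      have c: "rng \<Sigma> (P \<alpha>) = rng \<Sigma> \<tau>" using composable_iff(2) [OF P(1) \<tau>'] P(2) r \<tau>(2) by simp
      let ?\<rho> = "gmult \<Sigma> (ginv \<Sigma> (P \<alpha>)) \<tau>"
      have \<rho>: "?\<rho> \<in> arrows \<Sigma>" "q ?\<rho> = gmult G (ginv G \<alpha>) \<gamma>"
        using P \<tau>' c \<tau>(2) q_mult(2) [of "ginv \<Sigma> (P \<alpha>)" \<tau>] by simp_all
      have "(m' \<star> n) ?\<rho> = n (gmult \<Sigma> (ginv \<Sigma> (inverse_section P (ginv G \<alpha>))) ?\<rho>)"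
        unfolding m'_def
      proof (rule section_conv [OF I inj'(2) algebra_equivariant [OF N(1)] \<rho>(1)])
        show "ginv G \<alpha> \<in> ginv G ` D" using D(1) by (rule imageI)
        show "rng G (ginv G \<alpha>) = rng G (q ?\<rho>)"
          unfolding \<rho>(2) using \<alpha>' \<tau>' \<tau>(2) r by simp
      qed
      also have "gmult \<Sigma> (ginv \<Sigma> (inverse_section P (ginv G \<alpha>))) ?\<rho> = \<tau>"
        unfolding inverse_section_def using P \<alpha>' \<tau>' c by simp
      finally have "?\<rho> \<in> supp (m' \<star> n)" using \<tau>(1) by (simp add: supp_def)
      then show ?thesis using \<rho>(2) by (metis imageI)
    qed
    have \<beta>': "\<beta> \<in> arrows G" "rng G \<beta> = rng G \<alpha>" using \<beta> S rs [OF \<beta> \<alpha>] s by auto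
    have "gmult G (ginv G \<alpha>) \<alpha> = gmult G (ginv G \<alpha>) \<beta>"
      by (rule inj_onD [OF inj _ mem [OF \<alpha> refl] mem [OF \<beta> s [symmetric]]]) (use \<alpha>' \<beta>' s in simp)
    then have "gmult G \<alpha> (gmult G (ginv G \<alpha>) \<alpha>) = gmult G \<alpha> (gmult G (ginv G \<alpha>) \<beta>)" by simp
    then show ?thesis using \<alpha>' \<beta>' by (metis G.cancel_left(2))
  qed
  show "inj_on (src G) (q ` supp n)" by (rule inj_onI) (rule eq)
  show "inj_on (rng G) (q ` supp n)"
  proof (rule inj_onI)
    fix \<alpha> \<beta> assume *: "\<alpha> \<in> q ` supp n" "\<beta> \<in> q ` supp n" "rng G \<alpha> = rng G \<beta>"
    show "\<alpha> = \<beta>" by (rule eq [OF *(1,2)]) (use rs [OF *(1,2)] *(3) in simp)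
  qed
qed

text \<open>The units form an open set of isotropy arrows, so they lie in the interior of the isotropy, and
  the twist over the interior has the same diagonal. The two convolutions agree on functions
  supported over the interior: elsewhere \<open>f \<star> g\<close> vanishes too, since \<open>q\<close> maps its support to
  an open set of isotropy arrows.\<close>

lemma units_subset_interior_isotropy: "units G \<subseteq> arrow_top G interior_of isotropy G"
  by (rule interior_of_maximal [OF G.units_subset G.openin_units])

lemma algebra_over_isotropy:
  "steinberg_algebra (restrict_groupoid G (arrow_top G interior_of isotropy G))
    (restrict_groupoid \<Sigma> (preimage_arrows \<Sigma> q (arrow_top G interior_of isotropy G))) i q =
    isotropy_algebra"
  unfolding isotropy_algebra_interior by (rule algebra_restrict) simp

lemma diagonal_over_isotropy:
  "diagonal_algebra (restrict_groupoid G (arrow_top G interior_of isotropy G))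
    (restrict_groupoid \<Sigma> (preimage_arrows \<Sigma> q (arrow_top G interior_of isotropy G))) i q = B"
proof -
  let ?I = "arrow_top G interior_of isotropy G"
  let ?J = "preimage_arrows \<Sigma> q ?I"
  have "preimage_arrows (restrict_groupoid \<Sigma> ?J) q (units G) = preimage_arrows \<Sigma> q (units G)"
    using units_subset_interior_isotropy by (auto simp: preimage_arrows_def)
  moreover have "preimage_arrows \<Sigma> q (units G) \<subseteq> ?J"
    using units_subset_interior_isotropy by (auto simp: preimage_arrows_def)
  ultimately show ?thesis
    unfolding diagonal_algebra_def G.unit_top_restrict(1) [OF units_subset_interior_isotropy]
    by (simp add: restrict_restrict units_subset_interior_isotropy)
qed

lemma normaliser_over_isotropy:
  "normaliser (twisted_conv (restrict_groupoid G (arrow_top G interior_of isotropy G))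
      (restrict_groupoid \<Sigma> (preimage_arrows \<Sigma> q (arrow_top G interior_of isotropy G))) q)
      isotropy_algebra B =
    normaliser (\<star>) isotropy_algebra B"
proof (rule normaliser_cong [OF _ diagonal_subset_isotropy_algebra])
  let ?I = "arrow_top G interior_of isotropy G"
  let ?J = "preimage_arrows \<Sigma> q ?I"
  fix f g assume fg: "f \<in> isotropy_algebra" "g \<in> isotropy_algebra"
  have c: "f \<star> g \<in> isotropy_algebra" by (rule isotropy_algebra_conv [OF fg])
  have "twisted_conv (restrict_groupoid G ?I) (restrict_groupoid \<Sigma> ?J) q f g = f \<star> g"
  proof
    fix \<sigma>
    show "twisted_conv (restrict_groupoid G ?I) (restrict_groupoid \<Sigma> ?J) q f g \<sigma> = (f \<star> g) \<sigma>"
    proof (cases "\<sigma> \<in> ?J")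
      case True
      then show ?thesis by (simp add: twisted_conv_def Let_def preimage_arrows_def)
    next
      case False
      have "(f \<star> g) \<sigma> = 0"
      proof (rule ccontr)
        assume nz: "(f \<star> g) \<sigma> \<noteq> 0"
        then have "\<sigma> \<in> arrows \<Sigma>" using conv_outside by blast
        moreover have "q \<sigma> \<in> ?I" using c nz unfolding isotropy_algebra_interior supp_def by blast
        ultimately show False using False by (simp add: preimage_arrows_def)
      qed
      then show ?thesis using False by (simp add: twisted_conv_def Let_def)
    qed
  qed
  with c show "f \<star> g \<in> isotropy_algebra \<and>
    twisted_conv (restrict_groupoid G ?I) (restrict_groupoid \<Sigma> ?J) q f g = f \<star> g" by blast
qed

theorem local_bisection_hypothesis_isotropy:
  assumes R: "indecomposable_ring TYPE('r)"
  shows "local_bisection_hypothesis G \<Sigma> i q \<longleftrightarrow>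
    local_bisection_hypothesis (restrict_groupoid G (arrow_top G interior_of isotropy G))
      (restrict_groupoid \<Sigma> (preimage_arrows \<Sigma> q (arrow_top G interior_of isotropy G))) i q"
proof -
  let ?I = "arrow_top G interior_of isotropy G"
  have "local_bisection_hypothesis (restrict_groupoid G ?I)
      (restrict_groupoid \<Sigma> (preimage_arrows \<Sigma> q ?I)) i q \<longleftrightarrow>
    (\<forall>n \<in> normaliser (\<star>) isotropy_algebra B. bisection (restrict_groupoid G ?I) (q ` supp n))"
    unfolding local_bisection_hypothesis_def algebra_over_isotropy diagonal_over_isotropy
      normaliser_over_isotropy ..
  moreover have "local_bisection_hypothesis G \<Sigma> i q \<longleftrightarrow>
    (\<forall>n \<in> normaliser (\<star>) A B. bisection G (q ` supp n))"
    unfolding local_bisection_hypothesis_def ..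
  moreover have "bisection (restrict_groupoid G ?I) (q ` supp n)"
    if L: "\<forall>n \<in> normaliser (\<star>) A B. bisection G (q ` supp n)"
      and n: "n \<in> normaliser (\<star>) isotropy_algebra B" for n
  proof -
    have n': "n \<in> normaliser (\<star>) A B" "n \<in> isotropy_algebra"
      using n unfolding normaliser_isotropy_algebra by blast+
    then have n'': "n \<in> A" "q ` supp n \<subseteq> ?I" unfolding isotropy_algebra_interior by blast+
    have b: "bisection G (q ` supp n)" using L n'(1) by blast
    show ?thesis
      by (rule G.bisection_restrictI [OF openin_interior_of units_subset_interior_isotropy
            q_supp_open [OF n''(1)] n''(2) bisectionD [OF b]])
  qed
  moreover have "bisection G (q ` supp n)"
    if L: "\<forall>n \<in> normaliser (\<star>) isotropy_algebra B. bisection (restrict_groupoid G ?I) (q ` supp n)"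
      and n: "n \<in> normaliser (\<star>) A B" for n
  proof -
    obtain k where nk: "partial_inverses n k" using n normaliser_iff by blast
    show ?thesis
    proof (rule bisection_from_isotropy [OF R nk])
      fix f assume "f \<in> normaliser (\<star>) isotropy_algebra B"
      then have "bisection (restrict_groupoid G ?I) (q ` supp f)" using L by blast
      then show "inj_on (src G) (q ` supp f)" using bisectionD(2) by fastforce
    qed
  qed
  ultimately show ?thesis by blast
qed

end

theorem lemma4p7:
  fixes G :: "'g top_groupoid" and \<Sigma> :: "'s top_groupoid"
    and i :: "'g \<times> 'r::{comm_ring, comm_monoid_mult} \<Rightarrow> 's" and q :: "'s \<Rightarrow> 'g"
    and \<I> :: "'g set" and \<J> :: "'s set"
    and A A' B :: "('s \<Rightarrow> 'r) set"
  assumes "indecomposable_ring TYPE('r)"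
    and "ample_groupoid G" and "Hausdorff_space (arrow_top G)"
    and "discrete_twist G \<Sigma> i q"
  defines "\<I> \<equiv> arrow_top G interior_of isotropy G"
    and "\<J> \<equiv> preimage_arrows \<Sigma> q \<I>"
  defines "A \<equiv> steinberg_algebra G \<Sigma> i q"
    and "A' \<equiv> steinberg_algebra (restrict_groupoid G \<I>) (restrict_groupoid \<Sigma> \<J>) i q"
    and "B \<equiv> diagonal_algebra G \<Sigma> i q"
  shows "normaliser (twisted_conv G \<Sigma> q) A' B = normaliser (twisted_conv G \<Sigma> q) A B \<inter> A' \<and>
    (local_bisection_hypothesis G \<Sigma> i q \<longleftrightarrow>
      local_bisection_hypothesis (restrict_groupoid G \<I>) (restrict_groupoid \<Sigma> \<J>) i q)"
proof -
  interpret T: hausdorff_ample_twist G \<Sigma> i q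
    using assms(2-4) by (intro hausdorff_ample_twist.intro hausdorff_ample_twist_axioms.intro)
  show ?thesis
    unfolding A_def A'_def B_def \<J>_def \<I>_def T.algebra_over_isotropy
    using T.normaliser_isotropy_algebra T.local_bisection_hypothesis_isotropy [OF assms(1)] by blast
qed

end
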